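(* Let $k\ge 1$, $0\le s\le k$ be integers, let $\gamma>0$ and $\delta\in\{1,0,-1\}$, and let $u_k^{dg}\in DG(\mathcal T_h,k)$ satisfy the discontinuous Galerkin problem $$a_{dg}(u_k^{dg},v)=(f,v)_\Omega-\langle g,v\rangle_{\Gamma_N}\qquad\forall\, v\in DG(\mathcal T_h,k).$$ Let $\tilde{\boldsymbol\sigma}_s^{dg}=\tilde{\boldsymbol\sigma}_s(u_k^{dg})\in RT(\mathcal T_h,s)$ be the averaging numerical flux of $u_k^{dg}$, and let $\boldsymbol\sigma_s^\Delta\in RT(\mathcal T_h,s)$ be defined by $$\int_F\boldsymbol\sigma_s^\Delta\cdot\mathbf n_F\,\phi\,ds=\begin{cases}\gamma\,\dfrac{\alpha_{F,min}}{h_F}\displaystyle\int_F[\![u_k^{dg}]\!]\,\phi\,ds, & F\in\mathcal E\setminus\mathcal E_N,\\ 0,& F\in\mathcal E_N,\end{cases}\qquad\forall\,\phi\in\mathbb P_s(F),$$ and, when $s\ge1$, additionally, for every $K\in\mathcal T_h$, $$(\boldsymbol\sigma_s^\Delta,\boldsymbol\psi)_K=-\delta\sum_{F\in\mathcal E_K\setminus\mathcal E_N}\int_F\{A\boldsymbol\psi\cdot\mathbf n_F\}_w^F\,[\![u_k^{dg}]\!]\,ds\qquad\forall\,\boldsymbol\psi\in\mathbb P_{s-1}(K)^d,$$ where $\boldsymbol\psi$ is extended by zero outside $K$. Then the recovered flux $\hat{\boldsymbol\sigma}_s^{dg}:=\tilde{\boldsymbol\sigma}_s^{dg}+\boldsymbol\sigma_s^\Delta$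 belongs to $RT(\mathcal T_h,s)$. Furthermore, it is locally conservative, in the sense that $\hat{\boldsymbol\sigma}_s^{dg}\in RT_f(\mathcal T_h,s)$.
   Context: Setting. $\Omega\subset\mathbb R^d$, $d\in\{2,3\}$, is a bounded polygonal (polyhedral) Lipschitz domain, $\partial\Omega=\overline\Gamma_D\cup\overline\Gamma_N$, $\Gamma_D\cap\Gamma_N=\emptyset$, $\mathrm{meas}_{d-1}(\Gamma_D)\ne0$. The model problem is $-\nabla\cdot(A\nabla u)=f$ in $\Omega$, $u=0$ on $\Gamma_D$, $-A\nabla u\cdot\mathbf n=g$ on $\Gamma_N$, with $f\in L^2(\Omega)$, $g\in L^2(\Gamma_N)$. $\mathcal T_h$ is a regular (conforming) simplicial partition of $\Omega$ resolving $\Gamma_D,\Gamma_N$; $A$ is a symmetric positive definite matrix, constant on each $K\in\mathcal T_h$. $(\cdot,\cdot)_\omega$ is the $L^2(\omega)$ inner product and $\langle\cdot,\cdot\rangle_S$ the $L^2$ pairing on a boundary piece $S$. Facets. $\mathcal E=\mathcal E_I\cup\mathcal E_D\cup\mathcal E_N$ is the set of all facets ($(d-1)$-dimensional faces): interior ones, those on $\Gamma_D$, those on $\Gamma_N$. $\mathcal E_K$ is the set of facets of $K$. $h_F$ is the diameter (length) of $F$ and $\mathbf n_F$ a fixed unit normal. For $F\in\mathcal E_I$, $K_F^+,K_F^-$ are the two elements sharing $F$, with $\mathbf n_F$ the outward normal of $K_F^-$; for boundary $F$, $\mathbf n_F$ is outward to $\partial\Omega$ and $K_F^-$ is the element containing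 $F$. $v_F^\pm$ is the trace on $F$ of $v|_{K_F^\pm}$. It is assumed that $g|_F\in\mathbb P_{k-1}(F)$ for every $F\in\mathcal E_N$. Weights. $\alpha_F^\pm$ is the maximal eigenvalue of $A|_{K_F^\pm}$; $\alpha_{F,min}=\min(\alpha_F^+,\alpha_F^-)$ for $F\in\mathcal E_I$ and $\alpha_{F,min}=\alpha_F^-$ for boundary $F$; $w_F^\pm=\alpha_F^\mp/(\alpha_F^-+\alpha_F^+)$. Weighted average: $\{v\}_w^F=w_F^+v_F^++w_F^-v_F^-$ for $F\in\mathcal E_I$, $\{v\}_w^F=v_F^-$ for boundary $F$. Jump: $[\![v]\!]|_F=v_F^--v_F^+$ for $F\in\mathcal E_I$, $[\![v]\!]|_F=v_F^-$ for boundary $F$. Spaces. $DG(\mathcal T_h,k)=\{v\in L^2(\Omega):v|_K\in\mathbb P_k(K)\ \forall K\in\mathcal T_h\}$. $RT(\mathcal T_h,s)=\{\boldsymbol\tau\in H(\mathrm{div};\Omega):\boldsymbol\tau|_K\in\mathbb P_s(K)^d+\boldsymbol x\,\mathbb P_s(K)\ \forall K\in\mathcal T_h\}$. $RT_f(\mathcal T_h,s)=\{\boldsymbol\tau\in RT(\mathcal T_h,s):\nabla\cdot\boldsymbol\tau=f_s\text{ in }\Omega,\ \boldsymbol\tau\cdot\mathbf n_F=g_{s,F}\text{ on each }F\in\mathcal E_N\}$, where $f_s$ is the $L^2$ projection of $f$ onto $DG(\mathcal T_h,s)$ and $g_{s,F}$ the $L^2$ projection of $g|_F$ onto $\mathbb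 P_s(F)$. DG form. With $\nabla_h$ the elementwise gradient, $$a_{dg}(u,v)=(A\nabla_hu,\nabla_hv)+\sum_{F\in\mathcal E\setminus\mathcal E_N}\int_F\gamma\frac{\alpha_{F,min}}{h_F}[\![u]\!][\![v]\!]ds-\sum_{F\in\mathcal E\setminus\mathcal E_N}\int_F\{A\nabla u\cdot\mathbf n_F\}_w^F[\![v]\!]ds+\delta\sum_{F\in\mathcal E\setminus\mathcal E_N}\int_F\{A\nabla v\cdot\mathbf n_F\}_w^F[\![u]\!]ds.$$ Averaging numerical flux. For $u_h\in DG(\mathcal T_h,k)$ and $0\le s\le k$, $\tilde{\boldsymbol\sigma}_s(u_h)\in RT(\mathcal T_h,s)$ is defined by: for all $\phi\in\mathbb P_s(F)$, $\int_F\tilde{\boldsymbol\sigma}_s(u_h)\cdot\mathbf n_F\phi\,ds=-\int_F\{A\nabla u_h\cdot\mathbf n_F\}_w^F\phi\,ds$ if $F\in\mathcal E\setminus\mathcal E_N$ and $=\int_Fg\phi\,ds$ if $F\in\mathcal E_N$; and, if $s\ge1$, $(\tilde{\boldsymbol\sigma}_s(u_h),\boldsymbol\psi)_K=-(A\nabla u_h,\boldsymbol\psi)_K$ for all $K\in\mathcal T_h$, $\boldsymbol\psi\in\mathbb P_{s-1}(K)^d$. *)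

theory Defs
  imports "HOL-Analysis.Analysis"
begin

section \<open>Polynomials, square integrability, weak divergence\<close>

text \<open>
  Polynomials of total degree at most \<open>m\<close> in the \<open>d = CARD('n)\<close> coordinates, as functions on the
  whole space.  \<open>P_m(K)\<close> and, for a facet \<open>F\<close>, \<open>P_m(F)\<close> consist of their restrictions.
\<close>

definition poly_le :: "nat \<Rightarrow> (real^'n \<Rightarrow> real) set" where
  "poly_le m = {p. \<exists>c :: ('n \<Rightarrow> nat) \<Rightarrow> real.
     p = (\<lambda>x. \<Sum>\<alpha>\<in>{\<alpha>. (\<Sum>i\<in>UNIV. \<alpha> i) \<le> m}. c \<alpha> * (\<Prod>i\<in>UNIV. (x $ i) ^ \<alpha> i))}"

definition vpoly_le :: "nat \<Rightarrow> (real^'n \<Rightarrow> real^'n) set" where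
  "vpoly_le m = {p. \<forall>i. (\<lambda>x. p x $ i) \<in> poly_le m}"

definition grad :: "(real^'n \<Rightarrow> real) \<Rightarrow> real^'n \<Rightarrow> real^'n" where
  "grad f x = (\<chi> i. frechet_derivative f (at x) (axis i 1))"

definition square_integrable :: "'a measure \<Rightarrow> 'a set \<Rightarrow> ('a \<Rightarrow> 'b::euclidean_space) \<Rightarrow> bool" where
  "square_integrable M S f \<longleftrightarrow>
     set_borel_measurable M S f \<and> set_integrable M S (\<lambda>x. (norm (f x))\<^sup>2)"

fun C_diff :: "nat \<Rightarrow> (real^'n \<Rightarrow> real) \<Rightarrow> bool" where
  "C_diff 0 f \<longleftrightarrow> continuous_on UNIV f"
| "C_diff (Suc m) f \<longleftrightarrow> (\<forall>x. f differentiable (at x)) \<and> (\<forall>i. C_diff m (\<lambda>x. grad f x $ i))"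

text \<open>The space of infinitely differentiable functions with compact support in \<open>\<Omega>\<close>.\<close>

definition test_functions :: "(real^'n) set \<Rightarrow> (real^'n \<Rightarrow> real) set" where
  "test_functions \<Omega> = {\<phi>. (\<forall>m. C_diff m \<phi>) \<and>
     compact (closure {x. \<phi> x \<noteq> 0}) \<and> closure {x. \<phi> x \<noteq> 0} \<subseteq> \<Omega>}"

definition has_weak_div :: "(real^'n) set \<Rightarrow> (real^'n \<Rightarrow> real^'n) \<Rightarrow> (real^'n \<Rightarrow> real) \<Rightarrow> bool" where
  "has_weak_div \<Omega> \<tau> w \<longleftrightarrow> (\<forall>\<phi>\<in>test_functions \<Omega>.
     (LINT x:\<Omega>|lebesgue. \<tau> x \<bullet> grad \<phi> x) = - (LINT x:\<Omega>|lebesgue. w x * \<phi> x))"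

definition Hdiv :: "(real^'n) set \<Rightarrow> (real^'n \<Rightarrow> real^'n) set" where
  "Hdiv \<Omega> = {\<tau>. square_integrable lebesgue \<Omega> \<tau> \<and>
     (\<exists>w. square_integrable lebesgue \<Omega> w \<and> has_weak_div \<Omega> \<tau> w)}"

text \<open>
  Elements of \<open>L\<^sup>2(\<Omega>)\<close> are represented by functions defined up to null sets.  For \<open>v\<close> that is (a.e.)
  polynomial on the simplex \<open>K\<close>, \<open>restr K v\<close> is the polynomial representing \<open>v|\<^sub>K\<close>; it is unique since
  \<open>K\<close> has nonempty interior.  The trace of \<open>v|\<^sub>K\<close> on a facet is the restriction of \<open>restr K v\<close>.
\<close>

definition restr :: "(real^'n) set \<Rightarrow> (real^'n \<Rightarrow> 'b::euclidean_space) \<Rightarrow> real^'n \<Rightarrow> 'b" where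
  "restr K v = (SOME p. polynomial_function p \<and> (AE x in lebesgue. x \<in> K \<longrightarrow> v x = p x))"

text \<open>
  The \<open>(d-1)\<close>-dimensional Lebesgue measure on the hyperplane \<open>H\<close> spanned by the facet \<open>F\<close>.  By Fubini
  it is the image, under the orthogonal projection onto \<open>H\<close>, of Lebesgue measure on the slab of
  thickness 1 around \<open>H\<close>.
\<close>

definition surf :: "(real^'n) set \<Rightarrow> (real^'n) measure" where
  "surf F = completion (distr
     (restrict_space lborel {x. infdist x (affine hull F) \<le> 1 / 2}) borel
     (closest_point (affine hull F)))"

definition max_eigenvalue :: "real^'n^'n \<Rightarrow> real" where
  "max_eigenvalue B = Max {e. \<exists>v. v \<noteq> 0 \<and> B *v v = e *\<^sub>R v}"

definition sym_pos_def :: "real^'n^'n \<Rightarrow> bool" where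
  "sym_pos_def B \<longleftrightarrow> transpose B = B \<and> (\<forall>x. x \<noteq> 0 \<longrightarrow> 0 < x \<bullet> (B *v x))"

text \<open>
  Near each boundary point the open set is the strict subgraph, in some direction \<open>\<nu>\<close>, of a Lipschitz
  function of the coordinates orthogonal to \<open>\<nu>\<close>.
\<close>

definition lipschitz_boundary :: "(real^'n) set \<Rightarrow> bool" where
  "lipschitz_boundary \<Omega> \<longleftrightarrow> (\<forall>x\<in>frontier \<Omega>. \<exists>r>0. \<exists>\<nu> L. \<exists>\<zeta> :: real^'n \<Rightarrow> real.
     norm \<nu> = 1 \<and> L-lipschitz_on {z. \<nu> \<bullet> z = 0} \<zeta> \<and>
     (\<forall>y\<in>ball x r. y \<in> \<Omega> \<longleftrightarrow> \<nu> \<bullet> y < \<zeta> (y - (\<nu> \<bullet> y) *\<^sub>R \<nu>)))"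

definition polyhedral_lipschitz_domain :: "(real^'n) set \<Rightarrow> bool" where
  "polyhedral_lipschitz_domain \<Omega> \<longleftrightarrow> open \<Omega> \<and> connected \<Omega> \<and> \<Omega> \<noteq> {} \<and> bounded \<Omega> \<and>
     (\<exists>Q. finite Q \<and> (\<forall>P\<in>Q. polytope P) \<and> closure \<Omega> = \<Union>Q) \<and> lipschitz_boundary \<Omega>"


section \<open>Domain, partition and coefficient\<close>

text \<open>
  \<open>coef M K\<close> is the constant value of \<open>A\<close> on \<open>K\<close>.  \<open>Kplus M F\<close>, \<open>Kminus M F\<close> and \<open>nrml M F\<close> are
  \<open>K\<^sub>F\<^sup>+\<close>, \<open>K\<^sub>F\<^sup>-\<close> and \<open>n\<^sub>F\<close>; \<open>Kplus M F\<close> has no meaning for boundary facets.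
\<close>

record ('n::finite) dg_setting =
  domain :: "(real^'n) set"
  GammaD :: "(real^'n) set"
  GammaN :: "(real^'n) set"
  mesh :: "(real^'n) set set"
  coef :: "(real^'n) set \<Rightarrow> real^'n^'n"
  Kplus :: "(real^'n) set \<Rightarrow> (real^'n) set"
  Kminus :: "(real^'n) set \<Rightarrow> (real^'n) set"
  nrml :: "(real^'n) set \<Rightarrow> real^'n"

definition elem_facets :: "(real^'n) set \<Rightarrow> (real^'n) set set" where
  "elem_facets K = {F. F facet_of K}"

definition facets :: "('n::finite) dg_setting \<Rightarrow> (real^'n) set set" where
  "facets M = (\<Union>K\<in>mesh M. elem_facets K)"

definition bdry_facets :: "('n::finite) dg_setting \<Rightarrow> (real^'n) set set" where
  "bdry_facets M = {F\<in>facets M. F \<subseteq> frontier (domain M)}"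

definition facets_I :: "('n::finite) dg_setting \<Rightarrow> (real^'n) set set" where
  "facets_I M = facets M - bdry_facets M"

definition facets_D :: "('n::finite) dg_setting \<Rightarrow> (real^'n) set set" where
  "facets_D M = {F\<in>bdry_facets M. rel_interior F \<subseteq> GammaD M}"

definition facets_N :: "('n::finite) dg_setting \<Rightarrow> (real^'n) set set" where
  "facets_N M = {F\<in>bdry_facets M. rel_interior F \<subseteq> GammaN M}"

text \<open>\<open>\<nu>\<close> is the outward unit normal of \<open>K\<close> on its facet \<open>F\<close>.\<close>

definition outward_normal :: "(real^'n) set \<Rightarrow> (real^'n) set \<Rightarrow> real^'n \<Rightarrow> bool" where
  "outward_normal K F \<nu> \<longleftrightarrow> norm \<nu> = 1 \<and> (\<forall>x\<in>K. \<forall>y\<in>F. \<nu> \<bullet> (x - y) \<le> 0)"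

text \<open>
  The partition resolves \<open>\<Gamma>\<^sub>D\<close> and \<open>\<Gamma>\<^sub>N\<close>: the relative interior of each boundary facet lies in one
  of them.  Surface measures of subsets of \<open>\<partial>\<Omega>\<close> are computed facet by facet.
\<close>

definition valid_setting :: "('n::finite) dg_setting \<Rightarrow> bool" where
  "valid_setting M \<longleftrightarrow>
     (CARD('n) = 2 \<or> CARD('n) = 3) \<and>
     polyhedral_lipschitz_domain (domain M) \<and>
     GammaD M \<in> sets borel \<and> GammaN M \<in> sets borel \<and>
     frontier (domain M) = closure (GammaD M) \<union> closure (GammaN M) \<and>
     GammaD M \<inter> GammaN M = {} \<and>
     (\<Sum>F\<in>bdry_facets M. emeasure (surf F) (F \<inter> GammaD M)) \<noteq> 0 \<and>
     triangulation (mesh M) \<and> (\<forall>K\<in>mesh M. int CARD('n) simplex K) \<and>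
     \<Union>(mesh M) = closure (domain M) \<and>
     bdry_facets M = facets_D M \<union> facets_N M \<and>
     (\<forall>K\<in>mesh M. sym_pos_def (coef M K)) \<and>
     (\<forall>F\<in>facets_I M. Kplus M F \<noteq> Kminus M F \<and>
        {K\<in>mesh M. F facet_of K} = {Kplus M F, Kminus M F}) \<and>
     (\<forall>F\<in>bdry_facets M. {K\<in>mesh M. F facet_of K} = {Kminus M F}) \<and>
     (\<forall>F\<in>facets M. outward_normal (Kminus M F) F (nrml M F))"


section \<open>Weights, averages, jumps\<close>

definition alpha_plus :: "('n::finite) dg_setting \<Rightarrow> (real^'n) set \<Rightarrow> real" where
  "alpha_plus M F = max_eigenvalue (coef M (Kplus M F))"

definition alpha_minus :: "('n::finite) dg_setting \<Rightarrow> (real^'n) set \<Rightarrow> real" where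
  "alpha_minus M F = max_eigenvalue (coef M (Kminus M F))"

definition alpha_min :: "('n::finite) dg_setting \<Rightarrow> (real^'n) set \<Rightarrow> real" where
  "alpha_min M F =
     (if F \<in> facets_I M then min (alpha_plus M F) (alpha_minus M F) else alpha_minus M F)"

definition w_plus :: "('n::finite) dg_setting \<Rightarrow> (real^'n) set \<Rightarrow> real" where
  "w_plus M F = alpha_minus M F / (alpha_minus M F + alpha_plus M F)"

definition w_minus :: "('n::finite) dg_setting \<Rightarrow> (real^'n) set \<Rightarrow> real" where
  "w_minus M F = alpha_plus M F / (alpha_minus M F + alpha_plus M F)"

text \<open>Here \<open>V K\<close> is the restriction to \<open>K\<close> of the piecewise defined function being averaged.\<close>

definition wavg :: "('n::finite) dg_setting \<Rightarrow> (real^'n) set \<Rightarrow>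
    ((real^'n) set \<Rightarrow> real^'n \<Rightarrow> real) \<Rightarrow> real^'n \<Rightarrow> real" where
  "wavg M F V x =
     (if F \<in> facets_I M then w_plus M F * V (Kplus M F) x + w_minus M F * V (Kminus M F) x
      else V (Kminus M F) x)"

text \<open>\<open>{A \<psi> \<cdot> n\<^sub>F}\<^sub>w\<close> and \<open>{A \<nabla>v \<cdot> n\<^sub>F}\<^sub>w\<close> on \<open>F\<close>.\<close>

definition avg_flux :: "('n::finite) dg_setting \<Rightarrow> (real^'n) set \<Rightarrow> (real^'n \<Rightarrow> real^'n) \<Rightarrow> real^'n \<Rightarrow> real" where
  "avg_flux M F \<psi> = wavg M F (\<lambda>K x. (coef M K *v restr K \<psi> x) \<bullet> nrml M F)"

definition avg_grad_flux :: "('n::finite) dg_setting \<Rightarrow> (real^'n) set \<Rightarrow> (real^'n \<Rightarrow> real) \<Rightarrow> real^'n \<Rightarrow> real" where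
  "avg_grad_flux M F v = wavg M F (\<lambda>K x. (coef M K *v grad (restr K v) x) \<bullet> nrml M F)"

definition jump :: "('n::finite) dg_setting \<Rightarrow> (real^'n) set \<Rightarrow> (real^'n \<Rightarrow> real) \<Rightarrow> real^'n \<Rightarrow> real" where
  "jump M F v x =
     (if F \<in> facets_I M then restr (Kminus M F) v x - restr (Kplus M F) v x
      else restr (Kminus M F) v x)"


section \<open>Discrete spaces and forms\<close>

definition DG :: "('n::finite) dg_setting \<Rightarrow> nat \<Rightarrow> (real^'n \<Rightarrow> real) set" where
  "DG M k = {v. square_integrable lebesgue (domain M) v \<and>
     (\<forall>K\<in>mesh M. \<exists>p\<in>poly_le k. AE x in lebesgue. x \<in> K \<longrightarrow> v x = p x)}"

definition RT :: "('n::finite) dg_setting \<Rightarrow> nat \<Rightarrow> (real^'n \<Rightarrow> real^'n) set" where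
  "RT M s = {\<tau>\<in>Hdiv (domain M). \<forall>K\<in>mesh M. \<exists>p\<in>vpoly_le s. \<exists>q\<in>poly_le s.
     AE x in lebesgue. x \<in> K \<longrightarrow> \<tau> x = p x + q x *\<^sub>R x}"

text \<open>
  \<open>\<tau> \<cdot> n\<^sub>F\<close>, taken from \<open>K\<^sub>F\<^sup>-\<close>; for \<open>\<tau> \<in> RT M s\<close> the trace from \<open>K\<^sub>F\<^sup>+\<close> is the same.
\<close>

definition normal_trace :: "('n::finite) dg_setting \<Rightarrow> (real^'n) set \<Rightarrow> (real^'n \<Rightarrow> real^'n) \<Rightarrow> real^'n \<Rightarrow> real" where
  "normal_trace M F \<tau> x = restr (Kminus M F) \<tau> x \<bullet> nrml M F"

definition is_L2_proj_DG :: "('n::finite) dg_setting \<Rightarrow> nat \<Rightarrow> (real^'n \<Rightarrow> real) \<Rightarrow> (real^'n \<Rightarrow> real) \<Rightarrow> bool" where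
  "is_L2_proj_DG M s f fs \<longleftrightarrow> fs \<in> DG M s \<and>
     (\<forall>v\<in>DG M s. (LINT x:domain M|lebesgue. (f x - fs x) * v x) = 0)"

definition is_L2_proj_facet :: "(real^'n) set \<Rightarrow> nat \<Rightarrow> (real^'n \<Rightarrow> real) \<Rightarrow> (real^'n \<Rightarrow> real) \<Rightarrow> bool" where
  "is_L2_proj_facet F s g gs \<longleftrightarrow> gs \<in> poly_le s \<and>
     (\<forall>\<phi>\<in>poly_le s. (LINT x:F|surf F. (g x - gs x) * \<phi> x) = 0)"

definition RT_data :: "('n::finite) dg_setting \<Rightarrow> (real^'n \<Rightarrow> real) \<Rightarrow> (real^'n \<Rightarrow> real) \<Rightarrow> nat \<Rightarrow>
    (real^'n \<Rightarrow> real^'n) set" where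
  "RT_data M f g s = {\<tau>\<in>RT M s.
     (\<exists>fs. is_L2_proj_DG M s f fs \<and> has_weak_div (domain M) \<tau> fs) \<and>
     (\<forall>F\<in>facets_N M. \<exists>gs. is_L2_proj_facet F s g gs \<and> (\<forall>x\<in>F. normal_trace M F \<tau> x = gs x))}"

text \<open>\<open>g \<in> L\<^sup>2(\<Gamma>\<^sub>N)\<close>, and the pairing of \<open>g\<close> with the trace of a piecewise polynomial \<open>v\<close> on \<open>\<Gamma>\<^sub>N\<close>.\<close>

definition L2_GammaN :: "('n::finite) dg_setting \<Rightarrow> (real^'n \<Rightarrow> real) set" where
  "L2_GammaN M = {g. \<forall>F\<in>bdry_facets M. square_integrable (surf F) (F \<inter> GammaN M) g}"

definition pairing_GammaN :: "('n::finite) dg_setting \<Rightarrow> (real^'n \<Rightarrow> real) \<Rightarrow> (real^'n \<Rightarrow> real) \<Rightarrow> real" where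
  "pairing_GammaN M g v =
     (\<Sum>F\<in>bdry_facets M. LINT x:(F \<inter> GammaN M)|surf F. g x * restr (Kminus M F) v x)"

definition a_dg :: "('n::finite) dg_setting \<Rightarrow> real \<Rightarrow> real \<Rightarrow> (real^'n \<Rightarrow> real) \<Rightarrow> (real^'n \<Rightarrow> real) \<Rightarrow> real" where
  "a_dg M \<gamma> \<delta> u v =
     (\<Sum>K\<in>mesh M. LINT x:K|lebesgue. (coef M K *v grad (restr K u) x) \<bullet> grad (restr K v) x)
   + (\<Sum>F\<in>facets M - facets_N M.
        LINT x:F|surf F. \<gamma> * (alpha_min M F / diameter F) * jump M F u x * jump M F v x)
   - (\<Sum>F\<in>facets M - facets_N M. LINT x:F|surf F. avg_grad_flux M F u x * jump M F v x)
   + \<delta> * (\<Sum>F\<in>facets M - facets_N M. LINT x:F|surf F. avg_grad_flux M F v x * jump M F u x)"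

text \<open>\<open>\<sigma> = \<sigma>\<^sub>s(u)\<close>, the averaging numerical flux of \<open>u\<close>.\<close>

definition is_averaging_flux :: "('n::finite) dg_setting \<Rightarrow> (real^'n \<Rightarrow> real) \<Rightarrow> nat \<Rightarrow> (real^'n \<Rightarrow> real) \<Rightarrow>
    (real^'n \<Rightarrow> real^'n) \<Rightarrow> bool" where
  "is_averaging_flux M g s u \<sigma> \<longleftrightarrow> \<sigma> \<in> RT M s \<and>
     (\<forall>F\<in>facets M - facets_N M. \<forall>\<phi>\<in>poly_le s.
        (LINT x:F|surf F. normal_trace M F \<sigma> x * \<phi> x)
          = - (LINT x:F|surf F. avg_grad_flux M F u x * \<phi> x)) \<and>
     (\<forall>F\<in>facets_N M. \<forall>\<phi>\<in>poly_le s.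
        (LINT x:F|surf F. normal_trace M F \<sigma> x * \<phi> x) = (LINT x:F|surf F. g x * \<phi> x)) \<and>
     (1 \<le> s \<longrightarrow> (\<forall>K\<in>mesh M. \<forall>\<psi>\<in>vpoly_le (s - 1).
        (LINT x:K|lebesgue. \<sigma> x \<bullet> \<psi> x)
          = - (LINT x:K|lebesgue. (coef M K *v grad (restr K u) x) \<bullet> \<psi> x)))"

text \<open>\<open>\<sigma> = \<sigma>\<^sub>s\<^sup>\<Delta>\<close>, the correction built from the jumps of \<open>u\<close>.\<close>

definition is_correction_flux :: "('n::finite) dg_setting \<Rightarrow> real \<Rightarrow> real \<Rightarrow> nat \<Rightarrow> (real^'n \<Rightarrow> real) \<Rightarrow>
    (real^'n \<Rightarrow> real^'n) \<Rightarrow> bool" where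
  "is_correction_flux M \<gamma> \<delta> s u \<sigma> \<longleftrightarrow> \<sigma> \<in> RT M s \<and>
     (\<forall>F\<in>facets M - facets_N M. \<forall>\<phi>\<in>poly_le s.
        (LINT x:F|surf F. normal_trace M F \<sigma> x * \<phi> x)
          = \<gamma> * (alpha_min M F / diameter F) * (LINT x:F|surf F. jump M F u x * \<phi> x)) \<and>
     (\<forall>F\<in>facets_N M. \<forall>\<phi>\<in>poly_le s. (LINT x:F|surf F. normal_trace M F \<sigma> x * \<phi> x) = 0) \<and>
     (1 \<le> s \<longrightarrow> (\<forall>K\<in>mesh M. \<forall>\<psi>\<in>vpoly_le (s - 1).
        (LINT x:K|lebesgue. \<sigma> x \<bullet> \<psi> x)
          = - \<delta> * (\<Sum>F\<in>elem_facets K - facets_N M.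
              LINT x:F|surf F. avg_flux M F (\<lambda>y. if y \<in> K then \<psi> y else 0) x * jump M F u x)))"

end

theory Submission
  imports Defs
begin

text \<open>
  The argument is the classical one of local conservation.  Fix an element \<open>K\<close> and a polynomial
  \<open>\<phi>\<close> of degree at most \<open>s\<close>.  Since \<open>s \<le> k\<close>, the function \<open>v\<close> equal to \<open>\<phi>\<close> on \<open>K\<close> and to
  zero elsewhere is an admissible test function for the discontinuous Galerkin equation.  Its jump on
  a facet of \<open>K\<close> is \<open>\<plusminus>\<phi>\<close>, and \<open>\<nabla>\<phi>\<close> has degree at most \<open>s - 1\<close>.  So each term of
  \<open>a_dg(u, v)\<close> is a moment that enters the definition of one of the two fluxes: the diffusion term and
  the consistency term are moments of the averaging flux, the penalty term and the symmetrisation term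
  are moments of the correction flux.  Writing \<open>\<sigma>\<close> for the sum of the fluxes, the equation becomes
  \<open>- (\<sigma>, \<nabla>\<phi>)\<^sub>K + \<Sum>\<^sub>F \<langle>\<sigma> \<bullet> n\<^sub>K, \<phi>\<rangle>\<^sub>F = (f, \<phi>)\<^sub>K\<close>, the sum extending over the facets of \<open>K\<close>,
  where the data \<open>g\<close> supplies the Neumann facets.  By the divergence theorem the left-hand side is
  \<open>(div \<sigma>, \<phi>)\<close> on \<open>K\<close> (\<open>element_conservation\<close>).  As \<open>div \<sigma>\<close> is piecewise polynomial of degree at
  most \<open>s\<close>, it is the projection of \<open>f\<close>.  On a Neumann facet the normal trace is a polynomial of
  degree at most \<open>s\<close> with the same moments as \<open>g\<close>, hence the projection of \<open>g\<close>.

  Two analytic facts carry this computation.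

  The first is the divergence theorem on a simplex, for the surface measure defined by thickening a
  hyperplane (\<open>green_simplex\<close>).  For a derivative in the direction \<open>i - j\<close> of an edge only the two
  facets opposite to \<open>i\<close> and \<open>j\<close> are met transversally, and every line in that direction enters
  through one of them and leaves through the other.  The theorem is then the fundamental theorem of
  calculus on these lines, together with a form of Fubini's theorem for a hyperplane and a transversal
  direction (\<open>integral_lborel_plane\<close>), which follows from translation invariance alone.  The edge
  directions span the space.

  The second is that a Raviart--Thomas field has a single-valued normal trace
  (\<open>RT_normal_continuous\<close>).  It is needed because the moments in the definition of the fluxes are
  taken from one side of each facet.  Test functions concentrating on the facet make all volume terms
  of the weak divergence vanish in the limit and leave only the jump of the normal trace.  Conversely,
  normal continuity makes the piecewise divergence the weak one (\<open>weak_div_broken_div\<close>).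
\<close>

section \<open>Integration over hyperplanes\<close>

text \<open>
  For a unit vector \<open>n\<close> this is the surface measure of the hyperplane \<open>n \<bullet> x = c\<close>, regarded as a
  measure on the whole space.  Having \<open>n\<close> and \<open>c\<close> explicit makes it accessible to Fubini's theorem.
\<close>

definition plane_measure :: "'a::euclidean_space \<Rightarrow> real \<Rightarrow> 'a measure" where
  "plane_measure n c = distr (restrict_space lborel {x. \<bar>n \<bullet> x - c\<bar> \<le> 1 / 2}) borel
     (\<lambda>x. x - (n \<bullet> x - c) *\<^sub>R n)"

lemma sets_plane_measure [simp, measurable_cong]: "sets (plane_measure n c) = sets borel"
  by (simp add: plane_measure_def)

lemma space_plane_measure [simp]: "space (plane_measure n c) = UNIV"
  by (simp add: plane_measure_def)

lemma slab_measurable [measurable]: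
  "{x :: 'a::euclidean_space. \<bar>n \<bullet> x - c\<bar> \<le> 1 / 2} \<in> sets borel"
  by measurable

lemma nn_integral_plane_measure:
  fixes g :: "'a::euclidean_space \<Rightarrow> ennreal"
  assumes [measurable]: "g \<in> borel_measurable borel"
  shows "(\<integral>\<^sup>+y. g y \<partial>plane_measure n c)
       = (\<integral>\<^sup>+x. indicator {x. \<bar>n \<bullet> x - c\<bar> \<le> 1 / 2} x * g (x - (n \<bullet> x - c) *\<^sub>R n) \<partial>lborel)"
proof -
  have [measurable]: "(\<lambda>x::'a. x - (n \<bullet> x - c) *\<^sub>R n) \<in> borel_measurable borel"
    by measurable
  show ?thesis
    unfolding plane_measure_def
    by (subst nn_integral_distr)
       (auto simp: nn_integral_restrict_space measurable_restrict_space1 ac_simps)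
qed

lemma nn_integral_lborel_translate:
  fixes G :: "'a::euclidean_space \<Rightarrow> ennreal"
  assumes [measurable]: "G \<in> borel_measurable borel"
  shows "(\<integral>\<^sup>+x. G (x + a) \<partial>lborel) = (\<integral>\<^sup>+x. G x \<partial>lborel)"
  by (subst lborel_distr_plus [of a, symmetric], subst nn_integral_distr) (auto simp: add.commute)

lemma nn_integral_interval_abs:
  fixes a b :: real
  assumes "a \<noteq> 0"
  shows "(\<integral>\<^sup>+r. indicator {r. \<bar>b + r * a\<bar> \<le> 1 / 2} r \<partial>lborel) = ennreal (1 / \<bar>a\<bar>)"
proof -
  have iff: "\<bar>b + r * a\<bar> \<le> 1 / 2 \<longleftrightarrow> - (1 / 2) - b \<le> r * a \<and> r * a \<le> 1 / 2 - b" for r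
    by linarith
  show ?thesis
  proof (cases "a > 0")
    case True
    then have "{r. \<bar>b + r * a\<bar> \<le> 1 / 2} = {(- (1 / 2) - b) / a..(1 / 2 - b) / a}"
      unfolding iff by (simp add: set_eq_iff pos_divide_le_eq pos_le_divide_eq)
    moreover have "(1 / 2 - b) / a - (- (1 / 2) - b) / a = 1 / a"
      by (simp flip: diff_divide_distrib)
    ultimately show ?thesis
      using True by (simp add: divide_right_mono)
  next
    case False
    with assms have a: "a < 0" by simp
    then have "{r. \<bar>b + r * a\<bar> \<le> 1 / 2} = {(1 / 2 - b) / a..(- (1 / 2) - b) / a}"
      unfolding iff by (auto simp: set_eq_iff neg_divide_le_eq neg_le_divide_eq)
    moreover have "(- (1 / 2) - b) / a - (1 / 2 - b) / a = 1 / - a"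
      by (simp flip: diff_divide_distrib)
    ultimately show ?thesis
      using a by (simp add: divide_right_mono_neg)
  qed
qed

text \<open>
  Every line in a transversal direction \<open>d\<close> spends the same time \<open>1 / \<bar>n \<bullet> d\<bar>\<close> in the slab of
  thickness 1.  Exchanging the integrals and translating by \<open>- r *\<^sub>R d\<close> replaces the average of \<open>G\<close>
  along the line through \<open>x\<close> by this sojourn time.
\<close>

lemma nn_integral_along_slab:
  fixes G :: "'a::euclidean_space \<Rightarrow> ennreal"
  assumes [measurable]: "G \<in> borel_measurable borel" and nd: "n \<bullet> d \<noteq> 0"
  shows "(\<integral>\<^sup>+x. G x \<partial>lborel)
       = ennreal \<bar>n \<bullet> d\<bar> * (\<integral>\<^sup>+x. \<integral>\<^sup>+r. indicator {x. \<bar>n \<bullet> x - c\<bar> \<le> 1 / 2} x * G (x + r *\<^sub>R d) \<partial>lborel \<partial>lborel)"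
proof -
  let ?S = "{x. \<bar>n \<bullet> x - c\<bar> \<le> 1 / 2}"
  have "(\<integral>\<^sup>+x. \<integral>\<^sup>+r. indicator ?S x * G (x + r *\<^sub>R d) \<partial>lborel \<partial>lborel)
      = (\<integral>\<^sup>+(r::real). \<integral>\<^sup>+x. indicator ?S x * G (x + r *\<^sub>R d) \<partial>lborel \<partial>lborel)"
    by (rule lborel_pair.Fubini') measurable
  also have "\<dots> = (\<integral>\<^sup>+(r::real). \<integral>\<^sup>+x. indicator ?S (x + (- r) *\<^sub>R d) * G x \<partial>lborel \<partial>lborel)"
  proof (rule nn_integral_cong)
    fix r :: real
    show "(\<integral>\<^sup>+x. indicator ?S x * G (x + r *\<^sub>R d) \<partial>lborel)
        = (\<integral>\<^sup>+x. indicator ?S (x + (- r) *\<^sub>R d) * G x \<partial>lborel)"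
      by (subst nn_integral_lborel_translate [of "\<lambda>x. indicator ?S x * G (x + r *\<^sub>R d)" "(- r) *\<^sub>R d", symmetric])
         (auto intro!: nn_integral_cong)
  qed
  also have "\<dots> = (\<integral>\<^sup>+x. \<integral>\<^sup>+(r::real). indicator ?S (x + (- r) *\<^sub>R d) * G x \<partial>lborel \<partial>lborel)"
    by (rule lborel_pair.Fubini') measurable
  also have "\<dots> = (\<integral>\<^sup>+x. ennreal (1 / \<bar>n \<bullet> d\<bar>) * G x \<partial>lborel)"
  proof (rule nn_integral_cong)
    fix x
    have "(\<integral>\<^sup>+(r::real). indicator ?S (x + (- r) *\<^sub>R d) * G x \<partial>lborel)
        = (\<integral>\<^sup>+r. indicator {r. \<bar>(n \<bullet> x - c) + r * (- (n \<bullet> d))\<bar> \<le> 1 / 2} r \<partial>lborel) * G x"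
      by (subst nn_integral_multc [symmetric])
         (auto intro!: nn_integral_cong split: split_indicator simp: inner_diff_right algebra_simps)
    then show "(\<integral>\<^sup>+(r::real). indicator ?S (x + (- r) *\<^sub>R d) * G x \<partial>lborel) = ennreal (1 / \<bar>n \<bullet> d\<bar>) * G x"
      using nn_integral_interval_abs [of "- (n \<bullet> d)" "n \<bullet> x - c"] nd by simp
  qed
  also have "\<dots> = ennreal (1 / \<bar>n \<bullet> d\<bar>) * (\<integral>\<^sup>+x. G x \<partial>lborel)"
    by (simp add: nn_integral_cmult)
  finally show ?thesis
    using nd by (simp add: mult.assoc [symmetric] ennreal_mult'[symmetric])
qed

text \<open>
  The slab may be projected along any transversal direction instead of the normal one: the two
  projections differ by a shear parallel to the hyperplane, which preserves volume.  The shear is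
  avoided by slicing the slab along \<open>n\<close>; each slice is merely translated by a multiple of
  \<open>m = n - d / (n \<bullet> d)\<close>, a vector parallel to the hyperplane.
\<close>

lemma nn_integral_plane_oblique:
  fixes g :: "'a::euclidean_space \<Rightarrow> ennreal"
  assumes g [measurable]: "g \<in> borel_measurable borel" and n: "norm n = 1" and nd: "n \<bullet> d \<noteq> 0"
  shows "(\<integral>\<^sup>+y. g y \<partial>plane_measure n c)
       = (\<integral>\<^sup>+x. indicator {x. \<bar>n \<bullet> x - c\<bar> \<le> 1 / 2} x * g (x - ((n \<bullet> x - c) / (n \<bullet> d)) *\<^sub>R d) \<partial>lborel)"
proof -
  let ?S = "{x. \<bar>n \<bullet> x - c\<bar> \<le> 1 / 2}"
  define P where "P = (\<lambda>x. x - (n \<bullet> x - c) *\<^sub>R n)"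
  define Q where "Q = (\<lambda>x. x - ((n \<bullet> x - c) / (n \<bullet> d)) *\<^sub>R d)"
  define m where "m = n - (1 / (n \<bullet> d)) *\<^sub>R d"
  have nn: "n \<bullet> n = 1"
    using n by (simp add: dot_square_norm)
  have nm: "n \<bullet> m = 0"
    using nd nn by (simp add: m_def inner_diff_right)
  have [measurable]: "P \<in> borel_measurable borel" "Q \<in> borel_measurable borel"
    unfolding P_def Q_def by measurable
  have "(\<integral>\<^sup>+x. indicator ?S x * g (Q x) \<partial>lborel)
      = (\<integral>\<^sup>+x. \<integral>\<^sup>+r. indicator ?S x * (indicator ?S (x + r *\<^sub>R n) * g (Q (x + r *\<^sub>R n))) \<partial>lborel \<partial>lborel)"
    using nn by (subst nn_integral_along_slab [of _ n n c]) auto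
  also have "\<dots> = (\<integral>\<^sup>+x. \<integral>\<^sup>+r. indicator {- (1/2)..1/2} r * (indicator ?S x * g (P (x + r *\<^sub>R m))) \<partial>lborel \<partial>lborel)"
  proof (rule nn_integral_cong)
    fix x
    have *: "indicator ?S (P x + r *\<^sub>R n) * g (Q (P x + r *\<^sub>R n))
        = indicator {- (1/2)..1/2::real} r * g (P (x + r *\<^sub>R m))" for r
    proof -
      have "n \<bullet> (P x + r *\<^sub>R n) - c = r"
        using nn by (simp add: P_def inner_diff_right inner_add_right)
      moreover have "Q (P x + r *\<^sub>R n) = P (x + r *\<^sub>R m)"
        using nn nm by (simp add: P_def Q_def m_def inner_diff_right inner_add_right scaleR_diff_right nd)
      ultimately show ?thesis
        by (auto split: split_indicator)
    qed
    have "(\<integral>\<^sup>+r. indicator ?S (x + r *\<^sub>R n) * g (Q (x + r *\<^sub>R n)) \<partial>lborel)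
        = (\<integral>\<^sup>+r. indicator ?S (P x + r *\<^sub>R n) * g (Q (P x + r *\<^sub>R n)) \<partial>lborel)"
      by (subst nn_integral_lborel_translate [of "\<lambda>r. indicator ?S (x + r *\<^sub>R n) * g (Q (x + r *\<^sub>R n))" "- (n \<bullet> x - c)", symmetric])
         (auto intro!: nn_integral_cong simp: P_def algebra_simps)
    then show "(\<integral>\<^sup>+r. indicator ?S x * (indicator ?S (x + r *\<^sub>R n) * g (Q (x + r *\<^sub>R n))) \<partial>lborel)
        = (\<integral>\<^sup>+r. indicator {- (1/2)..1/2} r * (indicator ?S x * g (P (x + r *\<^sub>R m))) \<partial>lborel)"
      unfolding * by (subst nn_integral_cmult, simp) (subst mult.left_commute, subst nn_integral_cmult, auto)
  qed
  also have "\<dots> = (\<integral>\<^sup>+(r::real). \<integral>\<^sup>+x. indicator {- (1/2)..1/2} r * (indicator ?S x * g (P (x + r *\<^sub>R m))) \<partial>lborel \<partial>lborel)"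
    by (rule lborel_pair.Fubini') measurable
  also have "\<dots> = (\<integral>\<^sup>+(r::real). indicator {- (1/2)..1/2} r * (\<integral>\<^sup>+x. indicator ?S x * g (P x) \<partial>lborel) \<partial>lborel)"
  proof (rule nn_integral_cong)
    fix r :: real
    have "(\<integral>\<^sup>+x. indicator ?S x * g (P (x + r *\<^sub>R m)) \<partial>lborel)
        = (\<integral>\<^sup>+x. indicator ?S (x + r *\<^sub>R m) * g (P (x + r *\<^sub>R m)) \<partial>lborel)"
      using nm by (intro nn_integral_cong) (auto simp: inner_add_right split: split_indicator)
    also have "\<dots> = (\<integral>\<^sup>+x. indicator ?S x * g (P x) \<partial>lborel)"
      by (rule nn_integral_lborel_translate) simp
    finally show "(\<integral>\<^sup>+x. indicator {- (1/2)..1/2} r * (indicator ?S x * g (P (x + r *\<^sub>R m))) \<partial>lborel)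
        = indicator {- (1/2)..1/2} r * (\<integral>\<^sup>+x. indicator ?S x * g (P x) \<partial>lborel)"
      by (simp add: nn_integral_cmult)
  qed
  also have "\<dots> = (\<integral>\<^sup>+x. indicator ?S x * g (P x) \<partial>lborel)"
    by (simp add: nn_integral_multc)
  finally show ?thesis
    by (simp add: nn_integral_plane_measure P_def Q_def)
qed

text \<open>
  Fubini's theorem for the splitting of space into a hyperplane and a transversal line.
\<close>

lemma nn_integral_lborel_plane:
  fixes G :: "'a::euclidean_space \<Rightarrow> ennreal"
  assumes [measurable]: "G \<in> borel_measurable borel" and n: "norm n = 1" and nd: "n \<bullet> d \<noteq> 0"
  shows "(\<integral>\<^sup>+x. G x \<partial>lborel)
       = ennreal \<bar>n \<bullet> d\<bar> * (\<integral>\<^sup>+y. \<integral>\<^sup>+r. G (y + r *\<^sub>R d) \<partial>lborel \<partial>plane_measure n c)"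
proof -
  let ?S = "{x. \<bar>n \<bullet> x - c\<bar> \<le> 1 / 2}"
  let ?Q = "\<lambda>x. x - ((n \<bullet> x - c) / (n \<bullet> d)) *\<^sub>R d"
  have "(\<integral>\<^sup>+x. G x \<partial>lborel) = ennreal \<bar>n \<bullet> d\<bar> * (\<integral>\<^sup>+x. indicator ?S x * (\<integral>\<^sup>+r. G (x + r *\<^sub>R d) \<partial>lborel) \<partial>lborel)"
    using nd by (subst nn_integral_along_slab [of _ n d c]) (auto simp: nn_integral_cmult)
  also have "(\<integral>\<^sup>+x. indicator ?S x * (\<integral>\<^sup>+r. G (x + r *\<^sub>R d) \<partial>lborel) \<partial>lborel)
      = (\<integral>\<^sup>+x. indicator ?S x * (\<integral>\<^sup>+r. G (?Q x + r *\<^sub>R d) \<partial>lborel) \<partial>lborel)"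
  proof (rule nn_integral_cong)
    fix x
    have "(\<integral>\<^sup>+r. G (x + r *\<^sub>R d) \<partial>lborel) = (\<integral>\<^sup>+r. G (?Q x + r *\<^sub>R d) \<partial>lborel)"
      by (subst nn_integral_lborel_translate [of "\<lambda>r. G (x + r *\<^sub>R d)" "- ((n \<bullet> x - c) / (n \<bullet> d))", symmetric])
         (auto intro!: nn_integral_cong simp: algebra_simps)
    then show "indicator ?S x * (\<integral>\<^sup>+r. G (x + r *\<^sub>R d) \<partial>lborel) = indicator ?S x * (\<integral>\<^sup>+r. G (?Q x + r *\<^sub>R d) \<partial>lborel)"
      by simp
  qed
  also have "\<dots> = (\<integral>\<^sup>+y. \<integral>\<^sup>+r. G (y + r *\<^sub>R d) \<partial>lborel \<partial>plane_measure n c)"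
    using n nd by (subst nn_integral_plane_oblique [of _ n d c]) auto
  finally show ?thesis .
qed

lemma emeasure_plane_measure_bounded:
  fixes n :: "'a::euclidean_space"
  assumes n: "norm n = 1" and B: "bounded B" "B \<in> sets borel"
  shows "emeasure (plane_measure n c) B < \<infinity>"
proof -
  obtain R where R: "\<And>x. x \<in> B \<Longrightarrow> norm x \<le> R"
    using B(1) by (auto simp: bounded_iff)
  have "emeasure (plane_measure n c) B = (\<integral>\<^sup>+y. indicator B y \<partial>plane_measure n c)"
    using B by simp
  also have "\<dots> \<le> (\<integral>\<^sup>+(x::'a). indicator (cball 0 (R + 1)) x \<partial>lborel)"
  proof (subst nn_integral_plane_measure)
    show "(\<integral>\<^sup>+x. indicator {x. \<bar>n \<bullet> x - c\<bar> \<le> 1 / 2} x * indicator B (x - (n \<bullet> x - c) *\<^sub>R n) \<partial>lborel)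
      \<le> integral\<^sup>N lborel (indicator (cball (0::'a) (R + 1)))"
    proof (rule nn_integral_mono)
      fix x
      have "norm x \<le> R + 1" if "\<bar>n \<bullet> x - c\<bar> \<le> 1 / 2" "x - (n \<bullet> x - c) *\<^sub>R n \<in> B"
        using R [OF that(2)] that(1) n norm_triangle_ineq2 [of x "(n \<bullet> x - c) *\<^sub>R n"] by simp
      then show "indicator {x. \<bar>n \<bullet> x - c\<bar> \<le> 1 / 2} x * indicator B (x - (n \<bullet> x - c) *\<^sub>R n)
          \<le> (indicator (cball 0 (R + 1)) x :: ennreal)"
        by (auto split: split_indicator)
    qed
  qed (use B in auto)
  also have "\<dots> < \<infinity>"
    using emeasure_lborel_cball_finite [of "0::'a" "R + 1"] by simp
  finally show ?thesis .
qed

lemma sigma_finite_plane_measure: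
  fixes n :: "'a::euclidean_space"
  assumes n: "norm n = 1"
  shows "sigma_finite_measure (plane_measure n c)"
proof
  show "\<exists>A. countable A \<and> A \<subseteq> sets (plane_measure n c) \<and> \<Union> A = space (plane_measure n c) \<and>
      (\<forall>a\<in>A. emeasure (plane_measure n c) a \<noteq> \<infinity>)"
  proof (intro exI conjI ballI)
    show "countable (range (\<lambda>i::nat. cball (0::'a) (real i)))"
      by simp
    show "\<Union> (range (\<lambda>i::nat. cball (0::'a) (real i))) = space (plane_measure n c)"
      by (auto simp: real_arch_simple)
    fix a :: "'a set" assume "a \<in> range (\<lambda>i::nat. cball (0::'a) (real i))"
    then show "emeasure (plane_measure n c) a \<noteq> \<infinity>"
      using emeasure_plane_measure_bounded [OF n, of a c] by force
  qed auto
qed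

lemma lborel_eq_plane_product:
  fixes n :: "'a::euclidean_space"
  assumes n: "norm n = 1" and nd: "n \<bullet> d \<noteq> 0"
  shows "(lborel :: 'a measure) = density (distr (plane_measure n c \<Otimes>\<^sub>M lborel) borel (\<lambda>(y, r). y + r *\<^sub>R d))
           (\<lambda>_. ennreal \<bar>n \<bullet> d\<bar>)"
proof (rule measure_eqI)
  fix A :: "'a set" assume "A \<in> sets lborel"
  then have A [measurable]: "A \<in> sets borel" by simp
  interpret sigma_finite_measure "plane_measure n c"
    by (rule sigma_finite_plane_measure [OF n])
  interpret pair_sigma_finite "plane_measure n c" "lborel :: real measure"
    by standard
  have [measurable]: "(\<lambda>(y, r). y + r *\<^sub>R d) \<in> borel_measurable (plane_measure n c \<Otimes>\<^sub>M (lborel :: real measure))"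
    by measurable
  have "emeasure lborel A = ennreal \<bar>n \<bullet> d\<bar> * (\<integral>\<^sup>+y. \<integral>\<^sup>+r. indicator A (y + r *\<^sub>R d) \<partial>lborel \<partial>plane_measure n c)"
    using nn_integral_lborel_plane [of "indicator A" n d c] n nd by simp
  also have "(\<integral>\<^sup>+y. \<integral>\<^sup>+r. indicator A (y + r *\<^sub>R d) \<partial>lborel \<partial>plane_measure n c)
      = (\<integral>\<^sup>+z. indicator A (case z of (y, r) \<Rightarrow> y + r *\<^sub>R d) \<partial>(plane_measure n c \<Otimes>\<^sub>M lborel))"
    by (subst lborel.nn_integral_fst [symmetric]) (auto simp: split_beta')
  also have "\<dots> = (\<integral>\<^sup>+x. indicator A x \<partial>distr (plane_measure n c \<Otimes>\<^sub>M lborel) borel (\<lambda>(y, r). y + r *\<^sub>R d))"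
    by (subst nn_integral_distr) auto
  finally show "emeasure lborel A = emeasure (density (distr (plane_measure n c \<Otimes>\<^sub>M lborel) borel (\<lambda>(y, r). y + r *\<^sub>R d))
           (\<lambda>_. ennreal \<bar>n \<bullet> d\<bar>)) A"
    by (simp add: emeasure_density nn_integral_cmult)
qed simp

text \<open>
  Expressing Lebesgue measure as an image of the product measure transfers the previous identity from
  nonnegative to integrable functions without splitting into positive and negative parts.
\<close>

lemma integral_lborel_plane:
  fixes G :: "'a::euclidean_space \<Rightarrow> real"
  assumes n: "norm n = 1" and nd: "n \<bullet> d \<noteq> 0" and G: "integrable lborel G"
  shows "integral\<^sup>L lborel G = \<bar>n \<bullet> d\<bar> * (\<integral>y. (\<integral>r. G (y + r *\<^sub>R d) \<partial>lborel) \<partial>plane_measure n c)"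
proof -
  interpret sigma_finite_measure "plane_measure n c"
    by (rule sigma_finite_plane_measure [OF n])
  interpret pair_sigma_finite "plane_measure n c" "lborel :: real measure"
    by standard
  let ?N = "plane_measure n c \<Otimes>\<^sub>M (lborel :: real measure)"
  let ?h = "\<lambda>(y, r). y + r *\<^sub>R d"
  have [measurable]: "?h \<in> borel_measurable ?N"
    by measurable
  have [measurable]: "G \<in> borel_measurable borel"
    using G by auto
  have "integrable (density (distr ?N borel ?h) (\<lambda>_. ennreal \<bar>n \<bullet> d\<bar>)) G"
    using G lborel_eq_plane_product [OF n nd, of c] by simp
  then have "integrable (distr ?N borel ?h) (\<lambda>x. \<bar>n \<bullet> d\<bar> *\<^sub>R G x)"
    by (subst (asm) integrable_density) auto
  then have "integrable (distr ?N borel ?h) G"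
    using nd by simp
  then have int: "integrable ?N (\<lambda>z. G (?h z))"
    by (subst (asm) integrable_distr_eq) auto
  have "integral\<^sup>L lborel G = integral\<^sup>L (density (distr ?N borel ?h) (\<lambda>_. ennreal \<bar>n \<bullet> d\<bar>)) G"
    using lborel_eq_plane_product [OF n nd, of c] by simp
  also have "\<dots> = \<bar>n \<bullet> d\<bar> * integral\<^sup>L (distr ?N borel ?h) G"
    by (subst integral_density) auto
  also have "integral\<^sup>L (distr ?N borel ?h) G = (\<integral>z. G (?h z) \<partial>?N)"
    by (subst integral_distr) auto
  also have "\<dots> = (\<integral>y. (\<integral>r. G (y + r *\<^sub>R d) \<partial>lborel) \<partial>plane_measure n c)"
    using int by (subst integral_fst' [symmetric]) (auto simp: split_beta')
  finally show ?thesis .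
qed

lemma AE_plane_measure:
  fixes n :: "'a::euclidean_space"
  assumes n: "norm n = 1"
  shows "AE y in plane_measure n c. n \<bullet> y = c"
proof -
  have [measurable]: "(\<lambda>x::'a. x - (n \<bullet> x - c) *\<^sub>R n) \<in> borel_measurable borel"
    by measurable
  have "(\<lambda>x. x - (n \<bullet> x - c) *\<^sub>R n) \<in> borel_measurable (restrict_space lborel {x. \<bar>n \<bullet> x - c\<bar> \<le> 1 / 2})"
    by (auto intro!: measurable_restrict_space1)
  then show ?thesis
    unfolding plane_measure_def
    using n by (subst AE_distr_iff) (auto simp: inner_diff_right dot_square_norm)
qed

text \<open>
  A projection in the direction \<open>d\<close> from one hyperplane to another multiplies areas by the quotient
  of the factors \<open>\<bar>n \<bullet> d\<bar>\<close>.  To see this, weight the cylinder over \<open>A\<close> by the indicator of the first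
  slab and compute its integral with Fubini's theorem from either hyperplane: the integral along a
  line in the direction \<open>d\<close> is the same for both.
\<close>

lemma plane_measure_oblique_projection:
  fixes n n' :: "'a::euclidean_space"
  assumes n: "norm n = 1" and nd: "n \<bullet> d \<noteq> 0" and n': "norm n' = 1" and nd': "n' \<bullet> d \<noteq> 0"
  shows "density (distr (plane_measure n c) borel (\<lambda>y. y - ((n' \<bullet> y - c') / (n' \<bullet> d)) *\<^sub>R d)) (\<lambda>_. ennreal \<bar>n \<bullet> d\<bar>)
       = density (plane_measure n' c') (\<lambda>_. ennreal \<bar>n' \<bullet> d\<bar>)"
proof (rule measure_eqI)
  let ?Q = "\<lambda>y. y - ((n' \<bullet> y - c') / (n' \<bullet> d)) *\<^sub>R d"
  fix A assume "A \<in> sets (density (distr (plane_measure n c) borel ?Q) (\<lambda>_. ennreal \<bar>n \<bullet> d\<bar>))"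
  then have [measurable]: "A \<in> sets borel" by simp
  let ?S = "{x. \<bar>n \<bullet> x - c\<bar> \<le> 1 / 2}"
  define G :: "'a \<Rightarrow> ennreal" where "G x = indicator A (?Q x) * indicator ?S x" for x
  have [measurable]: "?Q \<in> borel_measurable borel" "?Q \<in> borel_measurable (plane_measure n c)"
    by measurable
  have [measurable]: "G \<in> borel_measurable borel"
    unfolding G_def by measurable
  have line: "(\<integral>\<^sup>+r. G (y + r *\<^sub>R d) \<partial>lborel) = indicator A (?Q y) * ennreal (1 / \<bar>n \<bullet> d\<bar>)" for y
  proof -
    have "?Q (y + r *\<^sub>R d) = ?Q y" for r
    proof -
      have "(n' \<bullet> (y + r *\<^sub>R d) - c') / (n' \<bullet> d) = (n' \<bullet> y - c') / (n' \<bullet> d) + r"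
        using nd' by (simp add: inner_add_right field_simps)
      then show ?thesis
        by (simp only:) (simp add: scaleR_add_left)
    qed
    then have "G (y + r *\<^sub>R d) = indicator A (?Q y) * indicator ?S (y + r *\<^sub>R d)" for r
      unfolding G_def by (simp only:)
    moreover have "indicator ?S (y + r *\<^sub>R d) = (indicator {r. \<bar>(n \<bullet> y - c) + r * (n \<bullet> d)\<bar> \<le> 1 / 2} r :: ennreal)" for r
      by (simp add: indicator_def inner_add_right algebra_simps)
    ultimately have "(\<integral>\<^sup>+r. G (y + r *\<^sub>R d) \<partial>lborel)
        = (\<integral>\<^sup>+r. indicator A (?Q y) * indicator {r. \<bar>(n \<bullet> y - c) + r * (n \<bullet> d)\<bar> \<le> 1 / 2} r \<partial>lborel)"
      by (simp only:)
    also have "\<dots> = indicator A (?Q y) * ennreal (1 / \<bar>n \<bullet> d\<bar>)"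
      using nn_integral_interval_abs [OF nd, of "n \<bullet> y - c"] by (simp add: nn_integral_cmult)
    finally show ?thesis .
  qed
  have "(\<integral>\<^sup>+x. G x \<partial>lborel) = ennreal \<bar>n \<bullet> d\<bar> * ((\<integral>\<^sup>+y. indicator A (?Q y) \<partial>plane_measure n c) * ennreal (1 / \<bar>n \<bullet> d\<bar>))"
    using n nd by (subst nn_integral_lborel_plane [of _ n d c]) (auto simp: line nn_integral_multc)
  moreover have "(\<integral>\<^sup>+x. G x \<partial>lborel) = ennreal \<bar>n' \<bullet> d\<bar> * ((\<integral>\<^sup>+y. indicator A (?Q y) \<partial>plane_measure n' c') * ennreal (1 / \<bar>n \<bullet> d\<bar>))"
    using n' nd' by (subst nn_integral_lborel_plane [of _ n' d c']) (auto simp: line nn_integral_multc)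
  moreover have "(\<integral>\<^sup>+y. indicator A (?Q y) \<partial>plane_measure n' c') = (\<integral>\<^sup>+y. indicator A y \<partial>plane_measure n' c')"
    by (intro nn_integral_cong_AE, rule eventually_mono [OF AE_plane_measure [OF n', of c']]) auto
  moreover have "a = b" if "a * ennreal (1 / \<bar>n \<bullet> d\<bar>) = b * ennreal (1 / \<bar>n \<bullet> d\<bar>)" for a b
  proof -
    have "a * ennreal (1 / \<bar>n \<bullet> d\<bar>) * ennreal \<bar>n \<bullet> d\<bar> = b * ennreal (1 / \<bar>n \<bullet> d\<bar>) * ennreal \<bar>n \<bullet> d\<bar>"
      using that by simp
    then show ?thesis
      using nd by (simp add: mult.assoc ennreal_mult' [symmetric])
  qed
  ultimately have "ennreal \<bar>n \<bullet> d\<bar> * (\<integral>\<^sup>+y. indicator A (?Q y) \<partial>plane_measure n c)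
      = ennreal \<bar>n' \<bullet> d\<bar> * (\<integral>\<^sup>+y. indicator A y \<partial>plane_measure n' c')"
    by (metis (no_types, lifting) mult.assoc)
  moreover have "(\<integral>\<^sup>+y. indicator A (?Q y) \<partial>plane_measure n c) = (\<integral>\<^sup>+y. indicator A y \<partial>distr (plane_measure n c) borel ?Q)"
    by (subst nn_integral_distr) auto
  ultimately show "emeasure (density (distr (plane_measure n c) borel ?Q) (\<lambda>_. ennreal \<bar>n \<bullet> d\<bar>)) A
      = emeasure (density (plane_measure n' c') (\<lambda>_. ennreal \<bar>n' \<bullet> d\<bar>)) A"
    by (simp add: emeasure_density nn_integral_cmult)
qed simp

lemma integral_plane_measure_oblique:
  fixes g :: "'a::euclidean_space \<Rightarrow> real"
  assumes n: "norm n = 1" and nd: "n \<bullet> d \<noteq> 0" and n': "norm n' = 1" and nd': "n' \<bullet> d \<noteq> 0"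
    and [measurable]: "g \<in> borel_measurable borel"
  shows "\<bar>n \<bullet> d\<bar> * (\<integral>y. g (y - ((n' \<bullet> y - c') / (n' \<bullet> d)) *\<^sub>R d) \<partial>plane_measure n c)
       = \<bar>n' \<bullet> d\<bar> * (\<integral>y. g y \<partial>plane_measure n' c')"
proof -
  let ?Q = "\<lambda>y. y - ((n' \<bullet> y - c') / (n' \<bullet> d)) *\<^sub>R d"
  have [measurable]: "?Q \<in> borel_measurable (plane_measure n c)"
    by measurable
  have "\<bar>n \<bullet> d\<bar> * (\<integral>y. g (?Q y) \<partial>plane_measure n c)
      = integral\<^sup>L (density (distr (plane_measure n c) borel ?Q) (\<lambda>_. ennreal \<bar>n \<bullet> d\<bar>)) g"
    by (subst integral_density) (auto simp: integral_distr)
  also have "\<dots> = \<bar>n' \<bullet> d\<bar> * (\<integral>y. g y \<partial>plane_measure n' c')"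
    unfolding plane_measure_oblique_projection [OF n nd n' nd']
    by (subst integral_density) auto
  finally show ?thesis .
qed

lemma closest_point_hyperplane:
  fixes n :: "'a::euclidean_space"
  assumes n: "norm n = 1"
  shows "closest_point {x. n \<bullet> x = c} x = x - (n \<bullet> x - c) *\<^sub>R n"
proof -
  have nn: "n \<bullet> n = 1" using n by (simp add: dot_square_norm)
  let ?p = "x - (n \<bullet> x - c) *\<^sub>R n"
  have "?p = closest_point {x. n \<bullet> x = c} x"
  proof (rule closest_point_unique)
    show "?p \<in> {x. n \<bullet> x = c}"
      using nn by (simp add: inner_diff_right)
    show "\<forall>z\<in>{x. n \<bullet> x = c}. dist x ?p \<le> dist x z"
    proof
      fix z assume "z \<in> {x. n \<bullet> x = c}"
      then have "n \<bullet> x - c = n \<bullet> (x - z)" by (simp add: inner_diff_right)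
      then show "dist x ?p \<le> dist x z"
        using n Cauchy_Schwarz_ineq2 [of n "x - z"] by (simp add: dist_norm)
    qed
  qed (auto simp: convex_hyperplane closed_hyperplane)
  then show ?thesis ..
qed

lemma surf_eq_plane_measure:
  fixes n :: "real^'n"
  assumes n: "norm n = 1" and F: "affine hull F = {x. n \<bullet> x = c}"
  shows "surf F = completion (plane_measure n c)"
proof -
  have nn: "n \<bullet> n = 1" using n by (simp add: dot_square_norm)
  have ne: "{x. n \<bullet> x = c} \<noteq> {}"
    using nn by (auto intro!: exI [of _ "c *\<^sub>R n"])
  have "infdist x {x. n \<bullet> x = c} = \<bar>n \<bullet> x - c\<bar>" for x
  proof -
    have "infdist x {x. n \<bullet> x = c} = dist x (closest_point {x. n \<bullet> x = c} x)"
      using ne infdist_eq_setdist setdist_closest_point [OF closed_hyperplane ne, of x] by metis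
    then show ?thesis
      using n by (simp add: closest_point_hyperplane dist_norm)
  qed
  moreover have "closest_point {x. n \<bullet> x = c} = (\<lambda>x. x - (n \<bullet> x - c) *\<^sub>R n)"
    using closest_point_hyperplane [OF n, of c] by auto
  ultimately show ?thesis
    unfolding surf_def plane_measure_def F by simp
qed

section \<open>The divergence theorem on a simplex\<close>

lemma integrable_plane_measure_compact:
  fixes n :: "'a::euclidean_space" and h :: "'a \<Rightarrow> real"
  assumes n: "norm n = 1" and F: "compact F" and h: "continuous_on UNIV h"
  shows "set_integrable (plane_measure n c) F h"
proof -
  have [measurable]: "h \<in> borel_measurable borel" "F \<in> sets borel"
    using h F by (auto simp: borel_measurable_continuous_onI borel_compact)
  have "compact (h ` F)"
    using F h by (meson compact_continuous_image continuous_on_subset subset_UNIV)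
  then obtain B where B: "\<And>x. x \<in> F \<Longrightarrow> norm (h x) \<le> B"
    by (meson bounded_iff compact_imp_bounded imageI)
  show ?thesis
    unfolding set_integrable_def
    by (rule integrableI_bounded_set [where A = F and B = B])
       (use B emeasure_plane_measure_bounded [OF n compact_imp_bounded [OF F]] in \<open>auto split: split_indicator\<close>)
qed

lemma affine_hull_eq_UNIV:
  fixes C :: "'a::euclidean_space set"
  assumes "\<not> affine_dependent C" "card C = DIM('a) + 1"
  shows "affine hull C = UNIV"
  using assms by (metis aff_dim_affine_independent aff_dim_eq_full diff_add_cancel add_diff_cancel_right' of_nat_1 of_nat_add)

text \<open>
  The normal is constant on a facet because differences of its points occur with both signs; it cannot
  take this value at the opposite vertex too, since the vertices span the space affinely.
\<close>

lemma facet_normal_vertices: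
  fixes C :: "'a::euclidean_space set"
  assumes C: "\<not> affine_dependent C" "card C = DIM('a) + 1" and a: "a \<in> C"
    and n: "norm n = 1" and out: "\<And>x y. x \<in> convex hull C \<Longrightarrow> y \<in> convex hull (C - {a}) \<Longrightarrow> n \<bullet> (x - y) \<le> 0"
  obtains c where "\<And>b. b \<in> C - {a} \<Longrightarrow> n \<bullet> b = c" "n \<bullet> a < c"
proof -
  have "finite C" using C aff_independent_finite by blast
  then have "card (C - {a}) \<ge> 1"
    using C a by (simp add: DIM_positive Suc_leI)
  then obtain b0 where b0: "b0 \<in> C - {a}"
    by (metis all_not_in_conv card.empty not_one_le_zero)
  have eq: "n \<bullet> b = n \<bullet> b0" if "b \<in> C - {a}" for b
  proof -
    have "b \<in> convex hull (C - {a})" "b0 \<in> convex hull (C - {a})" "b \<in> convex hull C" "b0 \<in> convex hull C"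
      using that b0 by (auto intro: hull_inc)
    then show ?thesis
      using out [of b b0] out [of b0 b] by (simp add: inner_diff_right)
  qed
  have le: "n \<bullet> a \<le> n \<bullet> b0"
    using out [OF hull_inc [of a] hull_inc [of b0]] a b0 by (simp add: inner_diff_right)
  have "n \<bullet> a \<noteq> n \<bullet> b0"
  proof
    assume "n \<bullet> a = n \<bullet> b0"
    with eq have "C \<subseteq> {x. n \<bullet> x = n \<bullet> b0}"
      by auto
    then have "affine hull C \<subseteq> {x. n \<bullet> x = n \<bullet> b0}"
      by (simp add: hull_minimal affine_hyperplane)
    then have "n \<bullet> (b0 + n) = n \<bullet> b0"
      using affine_hull_eq_UNIV [OF C] by blast
    then show False
      using n by (simp add: inner_add_right)
  qed
  with le eq that show ?thesis
    by (metis less_eq_real_def)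
qed

lemma set_lebesgue_integral_finite_sum:
  fixes f :: "'i \<Rightarrow> 'a \<Rightarrow> 'b::{banach, second_countable_topology}"
  assumes "\<And>i. i \<in> I \<Longrightarrow> set_integrable M A (f i)"
  shows "(LINT x:A|M. (\<Sum>i\<in>I. f i x)) = (\<Sum>i\<in>I. LINT x:A|M. f i x)"
  using assms by (simp add: set_lebesgue_integral_def set_integrable_def scaleR_sum_right)

text \<open>
  The full-dimensional simplex with vertex set \<open>C\<close> and its facet opposite to the vertex \<open>a\<close>, which lies
  on the hyperplane \<open>n \<bullet> x = c\<close> with \<open>n\<close> pointing out of the simplex.
\<close>

locale simplex_facet =
  fixes C :: "'a::euclidean_space set" and a :: 'a and n :: 'a and c :: real
  assumes indep: "\<not> affine_dependent C" and card: "card C = DIM('a) + 1" and vertex: "a \<in> C"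
    and unit: "norm n = 1"
    and on_facet: "b \<in> C - {a} \<Longrightarrow> n \<bullet> b = c"
    and opposite: "n \<bullet> a < c"
begin

lemma finite_C: "finite C"
  using indep aff_independent_finite by blast

text \<open>
  The signed distance to a facet is a negative multiple of the barycentric coordinate of the opposite
  vertex.  All facts on half-spaces below are read off from this.
\<close>

lemma inner_affine_combination:
  assumes u: "sum u C = 1"
  shows "n \<bullet> (\<Sum>b\<in>C. u b *\<^sub>R b) - c = u a * (n \<bullet> a - c)"
proof -
  have "n \<bullet> (\<Sum>b\<in>C. u b *\<^sub>R b) - c = (\<Sum>b\<in>C. u b * (n \<bullet> b - c))"
    using u by (simp add: inner_sum_right right_diff_distrib sum_subtractf flip: sum_distrib_right)
  also have "\<dots> = u a * (n \<bullet> a - c) + (\<Sum>b\<in>C - {a}. u b * (n \<bullet> b - c))"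
    by (rule sum.remove [OF finite_C vertex])
  also have "(\<Sum>b\<in>C - {a}. u b * (n \<bullet> b - c)) = 0"
    using on_facet by (intro sum.neutral) auto
  finally show ?thesis by simp
qed

lemma affine_coordinates:
  obtains u where "sum u C = 1" "(\<Sum>b\<in>C. u b *\<^sub>R b) = x"
proof -
  have "x \<in> affine hull C"
    using affine_hull_eq_UNIV [OF indep card] by simp
  then show ?thesis
    using that by (auto simp: affine_hull_finite [OF finite_C])
qed

lemma coordinate_nonneg_iff:
  assumes u: "sum u C = 1"
  shows "0 \<le> u a \<longleftrightarrow> n \<bullet> (\<Sum>b\<in>C. u b *\<^sub>R b) \<le> c"
proof -
  have "n \<bullet> (\<Sum>b\<in>C. u b *\<^sub>R b) \<le> c \<longleftrightarrow> u a * (n \<bullet> a - c) \<le> 0"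
    unfolding inner_affine_combination [OF u, symmetric] by simp
  then show ?thesis
    using opposite by (simp add: mult_le_0_iff)
qed

lemma simplex_below: "x \<in> convex hull C \<Longrightarrow> n \<bullet> x \<le> c"
  using coordinate_nonneg_iff vertex by (fastforce simp: convex_hull_finite [OF finite_C])

lemma sum_minus_vertex:
  assumes u: "sum u C = 1" and x: "n \<bullet> (\<Sum>b\<in>C. u b *\<^sub>R b) = c"
  shows "sum u (C - {a}) = 1" "(\<Sum>b\<in>C - {a}. u b *\<^sub>R b) = (\<Sum>b\<in>C. u b *\<^sub>R b)"
proof -
  have "u a = 0"
    using inner_affine_combination [OF u] x opposite by simp
  then show "sum u (C - {a}) = 1" "(\<Sum>b\<in>C - {a}. u b *\<^sub>R b) = (\<Sum>b\<in>C. u b *\<^sub>R b)"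
    using u by (simp_all add: sum.remove [OF finite_C vertex])
qed

lemma facet_eq: "convex hull (C - {a}) = {x \<in> convex hull C. n \<bullet> x = c}"
proof (intro equalityI subsetI)
  fix x assume x: "x \<in> convex hull (C - {a})"
  have "convex hull (C - {a}) \<subseteq> {x. n \<bullet> x = c}"
    using on_facet by (intro hull_minimal) (auto simp: convex_hyperplane)
  then show "x \<in> {x \<in> convex hull C. n \<bullet> x = c}"
    using x hull_mono [of "C - {a}" C convex] by auto
next
  fix x assume x: "x \<in> {x \<in> convex hull C. n \<bullet> x = c}"
  then obtain u where u: "\<forall>x\<in>C. 0 \<le> u x" "sum u C = 1" "(\<Sum>x\<in>C. u x *\<^sub>R x) = x"
    by (auto simp: convex_hull_finite [OF finite_C])
  then show "x \<in> convex hull (C - {a})"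
    using sum_minus_vertex [OF u(2)] x
    by (auto simp: convex_hull_finite finite_C intro!: exI [of _ u])
qed

lemma affine_hull_facet: "affine hull (convex hull (C - {a})) = {x. n \<bullet> x = c}"
proof (intro equalityI subsetI)
  fix x assume x: "x \<in> affine hull (convex hull (C - {a}))"
  have "affine hull (convex hull (C - {a})) \<subseteq> {x. n \<bullet> x = c}"
  proof (rule hull_minimal)
    show "convex hull (C - {a}) \<subseteq> {x. n \<bullet> x = c}"
      unfolding facet_eq by blast
  qed (rule affine_hyperplane)
  then show "x \<in> {x. n \<bullet> x = c}"
    using x by auto
next
  fix x assume x: "x \<in> {x. n \<bullet> x = c}"
  obtain u where u: "sum u C = 1" "(\<Sum>b\<in>C. u b *\<^sub>R b) = x"
    by (rule affine_coordinates)
  then show "x \<in> affine hull (convex hull (C - {a}))"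
    using sum_minus_vertex [OF u(1)] x
    by (auto simp: affine_hull_convex_hull affine_hull_finite finite_C intro!: exI [of _ u])
qed

text \<open>
  A point \<open>x\<close> below the hyperplane is a convex combination of the vertex \<open>a\<close> and the point \<open>z x\<close>
  where the ray from \<open>a\<close> through \<open>x\<close> hits the hyperplane.  As \<open>z\<close> is continuous and fixes \<open>y\<close>, the
  point \<open>z x\<close> remains in the facet for \<open>x\<close> near \<open>y\<close>.
\<close>

lemma simplex_eq_halfspace_near_facet:
  assumes y: "y \<in> rel_interior (convex hull (C - {a}))"
  obtains e where "e > 0" "\<And>x. x \<in> ball y e \<Longrightarrow> x \<in> convex hull C \<longleftrightarrow> n \<bullet> x \<le> c"
proof -
  let ?F = "convex hull (C - {a})"
  have ny: "n \<bullet> y = c"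
    using y rel_interior_subset facet_eq by blast
  obtain r where r: "r > 0" "ball y r \<inter> affine hull ?F \<subseteq> ?F"
    using y by (auto simp: mem_rel_interior_ball)
  define t where "t x = (c - n \<bullet> x) / (c - n \<bullet> a)" for x
  define z where "z x = (1 / (1 - t x)) *\<^sub>R (x - t x *\<^sub>R a)" for x
  have ty: "t y = 0"
    by (simp add: t_def ny)
  have tcont: "(t \<longlongrightarrow> t y) (nhds y)"
    using opposite unfolding t_def by (intro tendsto_intros filterlim_ident) auto
  have zcont: "(z \<longlongrightarrow> z y) (nhds y)"
    unfolding z_def using ty by (intro tendsto_intros filterlim_ident tcont) auto
  have zy: "z y = y"
    by (simp add: z_def ty)
  have "\<forall>\<^sub>F x in nhds y. t x < 1"
    using tcont by (rule order_tendstoD) (simp add: ty)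
  moreover have "\<forall>\<^sub>F x in nhds y. dist (z x) y < r"
    using tendstoD [OF zcont r(1)] by (simp add: zy)
  ultimately have "\<forall>\<^sub>F x in nhds y. t x < 1 \<and> dist (z x) y < r"
    by eventually_elim simp
  then obtain e where e: "e > 0" "\<And>x. dist x y < e \<Longrightarrow> t x < 1 \<and> dist (z x) y < r"
    unfolding eventually_nhds_metric by blast
  have "x \<in> convex hull C \<longleftrightarrow> n \<bullet> x \<le> c" if x: "x \<in> ball y e" for x
  proof
    assume below: "n \<bullet> x \<le> c"
    have t: "0 \<le> t x" "t x < 1"
      using below opposite e(2) [of x] x by (auto simp: t_def dist_commute)
    have "t x * (c - n \<bullet> a) = c - n \<bullet> x"
      using opposite by (simp add: t_def)
    then have "n \<bullet> (x - t x *\<^sub>R a) = (1 - t x) * c"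
      by (simp add: inner_diff_right algebra_simps)
    then have "n \<bullet> z x = c"
      using t by (simp add: z_def)
    then have "z x \<in> ?F"
      using r(2) e(2) [of x] x unfolding affine_hull_facet by (auto simp: dist_commute)
    then have "z x \<in> convex hull C"
      using facet_eq by blast
    moreover have "a \<in> convex hull C"
      using vertex by (rule hull_inc)
    ultimately have "t x *\<^sub>R a + (1 - t x) *\<^sub>R z x \<in> convex hull C"
      using t by (intro convexD [OF convex_convex_hull]) auto
    then show "x \<in> convex hull C"
      using t by (simp add: z_def)
  qed (rule simplex_below)
  with e(1) show ?thesis
    by (rule that)
qed

end

locale full_simplex =
  fixes C :: "'a::euclidean_space set" and nu :: "'a \<Rightarrow> 'a" and c :: "'a \<Rightarrow> real"
  assumes indep: "\<not> affine_dependent C" and card: "card C = DIM('a) + 1"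
    and facet: "a \<in> C \<Longrightarrow> simplex_facet C a (nu a) (c a)"
begin

lemma finite_C: "finite C"
  using indep aff_independent_finite by blast

lemmas unit = simplex_facet.unit [OF facet]
lemmas on_facet = simplex_facet.on_facet [OF facet]
lemmas opposite = simplex_facet.opposite [OF facet]
lemmas facet_eq = simplex_facet.facet_eq [OF facet]

lemma simplex_eq_halfspaces: "convex hull C = {x. \<forall>a\<in>C. nu a \<bullet> x \<le> c a}"
proof (intro equalityI subsetI CollectI ballI)
  fix x a assume "x \<in> convex hull C" and a: "a \<in> C"
  then show "nu a \<bullet> x \<le> c a"
    by (intro simplex_facet.simplex_below [OF facet])
next
  fix x assume "x \<in> {x. \<forall>a\<in>C. nu a \<bullet> x \<le> c a}"
  then have x: "\<And>a. a \<in> C \<Longrightarrow> nu a \<bullet> x \<le> c a" by auto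
  have "x \<in> affine hull C"
    using affine_hull_eq_UNIV [OF indep card] by simp
  then obtain u where u: "sum u C = 1" "(\<Sum>b\<in>C. u b *\<^sub>R b) = x"
    by (auto simp: affine_hull_finite [OF finite_C])
  have "0 \<le> u a" if "a \<in> C" for a
    using simplex_facet.coordinate_nonneg_iff [OF facet [OF that] u(1)] u(2) x [OF that] by simp
  with u show "x \<in> convex hull C"
    by (auto simp: convex_hull_finite [OF finite_C])
qed

lemma compact_simplex_facet:
  "compact (convex hull C)" "compact (convex hull (C - {a}))"
  using finite_C by (auto intro: finite_imp_compact_convex_hull)

lemma edge_inner:
  assumes "i \<in> C" "j \<in> C" "i \<noteq> j"
  shows "nu i \<bullet> (i - j) < 0" "0 < nu j \<bullet> (i - j)" "l \<in> C \<Longrightarrow> l \<noteq> i \<Longrightarrow> l \<noteq> j \<Longrightarrow> nu l \<bullet> (i - j) = 0"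
  using assms on_facet opposite by (auto simp: inner_diff_right)

text \<open>
  A line in the direction \<open>i - j\<close> is parallel to all facets except those opposite to \<open>i\<close> and \<open>j\<close>.  So
  it enters the simplex at its point \<open>y\<close> of the first of these facets, and leaves it through the
  second one, at the parameter \<open>\<rho>\<close>.
\<close>

lemma line_in_simplex:
  assumes ij: "i \<in> C" "j \<in> C" "i \<noteq> j" and y: "nu i \<bullet> y = c i"
  defines "\<rho> \<equiv> - ((nu j \<bullet> y - c j) / (nu j \<bullet> (i - j)))"
  shows "y + r *\<^sub>R (i - j) \<in> convex hull C \<longleftrightarrow> y \<in> convex hull (C - {i}) \<and> 0 \<le> r \<and> r \<le> \<rho>"
    and "y + \<rho> *\<^sub>R (i - j) \<in> convex hull (C - {j}) \<longleftrightarrow> y \<in> convex hull (C - {i})"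
    and "y \<in> convex hull (C - {i}) \<Longrightarrow> 0 \<le> \<rho>"
proof -
  note e = edge_inner [OF ij]
  have split: "(\<forall>l\<in>C. P l) \<longleftrightarrow> P i \<and> P j \<and> (\<forall>l\<in>C - {i, j}. P l)" for P
    using ij by auto
  have \<rho>: "nu j \<bullet> y + r * (nu j \<bullet> (i - j)) \<le> c j \<longleftrightarrow> r \<le> \<rho>" for r
    using e(2) by (auto simp: \<rho>_def field_simps)
  have i: "nu i \<bullet> y + r * (nu i \<bullet> (i - j)) \<le> c i \<longleftrightarrow> 0 \<le> r" for r
    using e(1) y by (auto simp: mult_le_0_iff)
  have rest: "(\<forall>l\<in>C - {i, j}. nu l \<bullet> y + r * (nu l \<bullet> (i - j)) \<le> c l) \<longleftrightarrow> (\<forall>l\<in>C - {i, j}. nu l \<bullet> y \<le> c l)" for r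
    using e(3) by auto
  have K: "y + r *\<^sub>R (i - j) \<in> convex hull C \<longleftrightarrow> 0 \<le> r \<and> r \<le> \<rho> \<and> (\<forall>l\<in>C - {i, j}. nu l \<bullet> y \<le> c l)" for r
    unfolding simplex_eq_halfspaces mem_Collect_eq inner_add_right inner_scaleR_right
    using split [of "\<lambda>l. nu l \<bullet> y + r * (nu l \<bullet> (i - j)) \<le> c l"] \<rho> [of r] i [of r] rest [of r] by blast
  have F: "y \<in> convex hull (C - {i}) \<longleftrightarrow> 0 \<le> \<rho> \<and> (\<forall>l\<in>C - {i, j}. nu l \<bullet> y \<le> c l)"
    using K [of 0] y by (simp add: facet_eq [OF ij(1)])
  show "y + r *\<^sub>R (i - j) \<in> convex hull C \<longleftrightarrow> y \<in> convex hull (C - {i}) \<and> 0 \<le> r \<and> r \<le> \<rho>"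
    using K F by auto
  have "nu j \<bullet> (y + \<rho> *\<^sub>R (i - j)) = c j"
    using e(2) unfolding inner_add_right inner_scaleR_right by (auto simp: \<rho>_def)
  then show "y + \<rho> *\<^sub>R (i - j) \<in> convex hull (C - {j}) \<longleftrightarrow> y \<in> convex hull (C - {i})"
    using K [of \<rho>] F by (auto simp: facet_eq [OF ij(2)])
  show "y \<in> convex hull (C - {i}) \<Longrightarrow> 0 \<le> \<rho>"
    using F by simp
qed

text \<open>
  Integrating the derivative along the lines of direction \<open>i - j\<close> leaves the values at the exit points
  minus those at the entry points, both parametrised over the facet of entry.  The oblique projection
  turns the first of these integrals into one over the facet of exit.
\<close>

lemma integral_edge_derivative:
  fixes \<psi> :: "'a \<Rightarrow> real"
  assumes ij: "i \<in> C" "j \<in> C" "i \<noteq> j"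
    and deriv: "\<And>x. (\<psi> has_derivative (\<lambda>h. \<psi>' x \<bullet> h)) (at x)" and cont: "continuous_on UNIV \<psi>'"
  shows "(LINT x:convex hull C|lborel. \<psi>' x \<bullet> (i - j))
       = (nu i \<bullet> (i - j)) * (LINT y:convex hull (C - {i})|plane_measure (nu i) (c i). \<psi> y)
       + (nu j \<bullet> (i - j)) * (LINT y:convex hull (C - {j})|plane_measure (nu j) (c j). \<psi> y)"
proof -
  let ?d = "i - j"
  let ?Fi = "convex hull (C - {i})" and ?Fj = "convex hull (C - {j})"
  let ?Pi = "plane_measure (nu i) (c i)" and ?Pj = "plane_measure (nu j) (c j)"
  let ?\<rho> = "\<lambda>y. - ((nu j \<bullet> y - c j) / (nu j \<bullet> ?d))"
  let ?Q = "\<lambda>y. y + ?\<rho> y *\<^sub>R ?d"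
  \<comment> \<open>\<open>?Q\<close> projects along \<open>?d\<close> onto the hyperplane of the facet opposite to \<open>j\<close>.\<close>
  let ?G = "\<lambda>x. indicator (convex hull C) x *\<^sub>R (\<psi>' x \<bullet> ?d)"
  note e = edge_inner [OF ij]
  have cpsi: "continuous_on UNIV \<psi>"
    by (intro continuous_at_imp_continuous_on ballI has_derivative_continuous [OF deriv])
  have cQ: "continuous_on UNIV ?Q"
    using e(2) by (intro continuous_intros) auto
  have cpsiQ: "continuous_on UNIV (\<lambda>y. \<psi> (?Q y))"
    by (rule continuous_on_compose2 [OF cpsi cQ]) auto
  have [measurable]: "\<psi> \<in> borel_measurable borel" "?Fj \<in> sets borel" "?Fi \<in> sets borel" "?Q \<in> borel_measurable borel"
    using cpsi cQ compact_simplex_facet by (auto simp: borel_measurable_continuous_onI borel_compact)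
  have intG: "integrable lborel ?G"
    by (rule borel_integrable_compact) (auto intro!: continuous_intros compact_simplex_facet continuous_on_subset [OF cont])
  have line: "(\<integral>r. ?G (y + r *\<^sub>R ?d) \<partial>lborel) = indicator ?Fi y * (\<psi> (?Q y) - \<psi> y)"
    if y: "nu i \<bullet> y = c i" for y
  proof (cases "y \<in> ?Fi")
    case False
    then show ?thesis
      using line_in_simplex(1) [OF ij y] by simp
  next
    case True
    have "(\<integral>r. ?G (y + r *\<^sub>R ?d) \<partial>lborel) = (\<integral>r. indicator {0..?\<rho> y} r *\<^sub>R (\<psi>' (y + r *\<^sub>R ?d) \<bullet> ?d) \<partial>lborel)"
      using line_in_simplex(1) [OF ij y] True
      by (intro Bochner_Integration.integral_cong) (auto split: split_indicator)
    also have "\<dots> = \<psi> (y + ?\<rho> y *\<^sub>R ?d) - \<psi> (y + 0 *\<^sub>R ?d)"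
    proof (rule integral_FTC_Icc)
      show "0 \<le> ?\<rho> y" using line_in_simplex(3) [OF ij y True] .
      fix r
      have "((\<lambda>r. \<psi> (y + r *\<^sub>R ?d)) has_derivative (\<lambda>h. \<psi>' (y + r *\<^sub>R ?d) \<bullet> (h *\<^sub>R ?d))) (at r within {0..?\<rho> y})"
        by (rule has_derivative_compose [OF _ deriv]) (auto intro!: derivative_eq_intros)
      then show "((\<lambda>r. \<psi> (y + r *\<^sub>R ?d)) has_vector_derivative (\<psi>' (y + r *\<^sub>R ?d) \<bullet> ?d)) (at r within {0..?\<rho> y})"
        by (simp add: has_vector_derivative_def)
    next
      show "continuous_on {0..?\<rho> y} (\<lambda>r. \<psi>' (y + r *\<^sub>R ?d) \<bullet> ?d)"
        by (intro continuous_intros continuous_on_compose2 [OF cont]) auto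
    qed
    finally show ?thesis
      using True by simp
  qed
  have "(LINT x:convex hull C|lborel. \<psi>' x \<bullet> ?d) = \<bar>nu i \<bullet> ?d\<bar> * (\<integral>y. (\<integral>r. ?G (y + r *\<^sub>R ?d) \<partial>lborel) \<partial>?Pi)"
    unfolding set_lebesgue_integral_def
    using e(1) by (intro integral_lborel_plane unit ij intG) auto
  also have "(\<integral>y. (\<integral>r. ?G (y + r *\<^sub>R ?d) \<partial>lborel) \<partial>?Pi) = (\<integral>y. indicator ?Fi y * (\<psi> (?Q y) - \<psi> y) \<partial>?Pi)"
  proof (rule integral_cong_AE)
    have [measurable]: "?G \<in> borel_measurable borel"
      using intG by auto
    show "(\<lambda>y. \<integral>r. ?G (y + r *\<^sub>R ?d) \<partial>lborel) \<in> borel_measurable ?Pi"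
      by measurable
    show "AE y in ?Pi. (\<integral>r. ?G (y + r *\<^sub>R ?d) \<partial>lborel) = indicator ?Fi y * (\<psi> (?Q y) - \<psi> y)"
      using AE_plane_measure [OF unit [OF ij(1)]] by eventually_elim (rule line)
  qed measurable
  also have "\<dots> = (LINT y:?Fi|?Pi. \<psi> (?Q y)) - (LINT y:?Fi|?Pi. \<psi> y)"
    using integrable_plane_measure_compact [OF unit [OF ij(1)] compact_simplex_facet(2) cpsi]
      integrable_plane_measure_compact [OF unit [OF ij(1)] compact_simplex_facet(2) cpsiQ]
    by (subst set_integral_diff(2) [symmetric]) (auto simp: set_lebesgue_integral_def)
  also have "(LINT y:?Fi|?Pi. \<psi> (?Q y)) = (\<integral>y. indicator ?Fj (?Q y) * \<psi> (?Q y) \<partial>?Pi)"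
    unfolding set_lebesgue_integral_def
  proof (rule integral_cong_AE)
    show "AE y in ?Pi. indicator ?Fi y *\<^sub>R \<psi> (?Q y) = indicator ?Fj (?Q y) * \<psi> (?Q y)"
      using AE_plane_measure [OF unit [OF ij(1)]]
    proof eventually_elim
      case (elim y)
      then show ?case
        using line_in_simplex(2) [OF ij elim] by (auto split: split_indicator)
    qed
  qed measurable
  also have "\<bar>nu i \<bullet> ?d\<bar> * (\<dots> - (LINT y:?Fi|?Pi. \<psi> y))
     = \<bar>nu j \<bullet> ?d\<bar> * (\<integral>y. indicator ?Fj y * \<psi> y \<partial>?Pj) - \<bar>nu i \<bullet> ?d\<bar> * (LINT y:?Fi|?Pi. \<psi> y)"
    using integral_plane_measure_oblique [OF unit [OF ij(1)] _ unit [OF ij(2)], of ?d "\<lambda>y. indicator ?Fj y * \<psi> y" "c i" "c j"] e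
    by (simp add: right_diff_distrib)
  finally show ?thesis
    using e by (simp add: set_lebesgue_integral_def)
qed

text \<open>
  Both sides are linear in the direction, and the edges at one vertex span the space.
\<close>

theorem integral_directional_derivative:
  fixes \<psi> :: "'a \<Rightarrow> real"
  assumes deriv: "\<And>x. (\<psi> has_derivative (\<lambda>h. \<psi>' x \<bullet> h)) (at x)" and cont: "continuous_on UNIV \<psi>'"
  shows "(LINT x:convex hull C|lborel. \<psi>' x \<bullet> e)
       = (\<Sum>a\<in>C. (nu a \<bullet> e) * (LINT y:convex hull (C - {a})|plane_measure (nu a) (c a). \<psi> y))"
proof -
  have int: "set_integrable lborel (convex hull C) (\<lambda>x. \<psi>' x \<bullet> e)" for e
    unfolding set_integrable_def
    by (rule borel_integrable_compact) (auto intro!: continuous_intros compact_simplex_facet continuous_on_subset [OF cont])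
  let ?I = "\<lambda>a. LINT y:convex hull (C - {a})|plane_measure (nu a) (c a). \<psi> y"
  let ?P = "\<lambda>e. (LINT x:convex hull C|lborel. \<psi>' x \<bullet> e) = (\<Sum>a\<in>C. (nu a \<bullet> e) * ?I a)"
  have "C \<noteq> {}"
    using card by auto
  then obtain j where j: "j \<in> C" by auto
  have sub: "subspace (Collect ?P)"
    unfolding subspace_def
  proof (intro conjI ballI allI; unfold mem_Collect_eq)
    fix x y assume "?P x" "?P y"
    then show "?P (x + y)"
      using int by (simp add: inner_add_right set_integral_add distrib_right sum.distrib)
  qed (auto simp: sum_distrib_left mult.assoc)
  have edges: "{x - j |x. x \<in> C - {j}} \<subseteq> Collect ?P"
  proof clarsimp
    fix i assume i: "i \<in> C" "i \<noteq> j"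
    have "(\<Sum>a\<in>C. (nu a \<bullet> (i - j)) * ?I a) = (\<Sum>a\<in>{i, j}. (nu a \<bullet> (i - j)) * ?I a)"
      using finite_C i j edge_inner(3) by (intro sum.mono_neutral_right) auto
    then show "?P (i - j)"
      using integral_edge_derivative [OF i(1) j i(2) deriv cont] i by simp
  qed
  have "UNIV = {j + v |v. v \<in> span {x - j |x. x \<in> C - {j}}}"
    using affine_hull_eq_UNIV [OF indep card] affine_hull_span [OF j] by simp
  then have "j + e \<in> {j + v |v. v \<in> span {x - j |x. x \<in> C - {j}}}"
    by (metis UNIV_I)
  then obtain v where "j + e = j + v" "v \<in> span {x - j |x. x \<in> C - {j}}"
    by blast
  then have "e \<in> span {x - j |x. x \<in> C - {j}}"
    by simp
  then show ?thesis
    using span_minimal [OF edges sub] by auto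
qed

theorem green_formula:
  fixes \<phi> :: "'a \<Rightarrow> real" and \<tau> :: "'a \<Rightarrow> 'a"
  assumes \<phi>: "\<And>x. (\<phi> has_derivative (\<lambda>h. \<phi>' x \<bullet> h)) (at x)" "continuous_on UNIV \<phi>'"
    and \<tau>: "\<And>b x. b \<in> Basis \<Longrightarrow> ((\<lambda>x. \<tau> x \<bullet> b) has_derivative (\<lambda>h. T b x \<bullet> h)) (at x)"
       "\<And>b. b \<in> Basis \<Longrightarrow> continuous_on UNIV (T b)"
  shows "(LINT x:convex hull C|lborel. \<tau> x \<bullet> \<phi>' x)
       = - (LINT x:convex hull C|lborel. (\<Sum>b\<in>Basis. T b x \<bullet> b) * \<phi> x)
       + (\<Sum>a\<in>C. LINT y:convex hull (C - {a})|plane_measure (nu a) (c a). (\<tau> y \<bullet> nu a) * \<phi> y)"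
proof -
  let ?K = "convex hull C"
  have c\<phi>: "continuous_on UNIV \<phi>"
    by (intro continuous_at_imp_continuous_on ballI has_derivative_continuous [OF \<phi>(1)])
  have c\<tau>: "continuous_on UNIV (\<lambda>x. \<tau> x \<bullet> b)" if "b \<in> Basis" for b
    by (intro continuous_at_imp_continuous_on ballI has_derivative_continuous [OF \<tau>(1) [OF that]])
  note cs = c\<phi> c\<tau> \<phi>(2) \<tau>(2)
  have int: "set_integrable lborel ?K h" if "continuous_on UNIV h" for h :: "'a \<Rightarrow> real"
    unfolding set_integrable_def
    by (rule borel_integrable_compact) (auto intro!: compact_simplex_facet continuous_on_subset [OF that])
  have comp: "(LINT x:?K|lborel. (\<tau> x \<bullet> b) * (\<phi>' x \<bullet> b)) + (LINT x:?K|lborel. (T b x \<bullet> b) * \<phi> x)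
      = (\<Sum>a\<in>C. LINT y:convex hull (C - {a})|plane_measure (nu a) (c a). (nu a \<bullet> b) * ((\<tau> y \<bullet> b) * \<phi> y))"
    if b: "b \<in> Basis" for b
  proof -
    have "(LINT x:?K|lborel. (\<phi> x *\<^sub>R T b x + (\<tau> x \<bullet> b) *\<^sub>R \<phi>' x) \<bullet> b)
        = (\<Sum>a\<in>C. (nu a \<bullet> b) * (LINT y:convex hull (C - {a})|plane_measure (nu a) (c a). (\<tau> y \<bullet> b) * \<phi> y))"
    proof (rule integral_directional_derivative)
      fix x
      show "((\<lambda>x. (\<tau> x \<bullet> b) * \<phi> x) has_derivative (\<lambda>h. (\<phi> x *\<^sub>R T b x + (\<tau> x \<bullet> b) *\<^sub>R \<phi>' x) \<bullet> h)) (at x)"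
        by (rule derivative_eq_intros \<tau>(1) [OF b] \<phi>(1) refl | simp add: inner_add_left algebra_simps fun_eq_iff)+
      show "continuous_on UNIV (\<lambda>x. \<phi> x *\<^sub>R T b x + (\<tau> x \<bullet> b) *\<^sub>R \<phi>' x)"
        using b by (intro continuous_intros cs)
    qed
    moreover have "(LINT x:?K|lborel. (\<phi> x *\<^sub>R T b x + (\<tau> x \<bullet> b) *\<^sub>R \<phi>' x) \<bullet> b)
       = (LINT x:?K|lborel. (\<tau> x \<bullet> b) * (\<phi>' x \<bullet> b)) + (LINT x:?K|lborel. (T b x \<bullet> b) * \<phi> x)"
      using b by (subst set_integral_add(2) [symmetric]) (auto intro!: int continuous_intros cs simp: inner_add_left algebra_simps)
    ultimately show ?thesis
      by simp
  qed
  have "(LINT x:?K|lborel. \<tau> x \<bullet> \<phi>' x) + (LINT x:?K|lborel. (\<Sum>b\<in>Basis. T b x \<bullet> b) * \<phi> x)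
      = (\<Sum>b\<in>Basis. (LINT x:?K|lborel. (\<tau> x \<bullet> b) * (\<phi>' x \<bullet> b)) + (LINT x:?K|lborel. (T b x \<bullet> b) * \<phi> x))"
  proof -
    have "(LINT x:?K|lborel. \<tau> x \<bullet> \<phi>' x) = (\<Sum>b\<in>Basis. LINT x:?K|lborel. (\<tau> x \<bullet> b) * (\<phi>' x \<bullet> b))"
      unfolding euclidean_inner [of "\<tau> _" "\<phi>' _"]
      by (rule set_lebesgue_integral_finite_sum) (intro int continuous_intros cs)
    moreover have "(LINT x:?K|lborel. (\<Sum>b\<in>Basis. T b x \<bullet> b) * \<phi> x) = (\<Sum>b\<in>Basis. LINT x:?K|lborel. (T b x \<bullet> b) * \<phi> x)"
      unfolding sum_distrib_right
      by (rule set_lebesgue_integral_finite_sum) (intro int continuous_intros cs)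
    ultimately show ?thesis
      by (simp add: sum.distrib)
  qed
  also have "\<dots> = (\<Sum>a\<in>C. \<Sum>b\<in>Basis. LINT y:convex hull (C - {a})|plane_measure (nu a) (c a). (nu a \<bullet> b) * ((\<tau> y \<bullet> b) * \<phi> y))"
    by (subst sum.swap) (simp add: comp)
  also have "\<dots> = (\<Sum>a\<in>C. LINT y:convex hull (C - {a})|plane_measure (nu a) (c a). (\<tau> y \<bullet> nu a) * \<phi> y)"
  proof (rule sum.cong [OF refl])
    fix a assume a: "a \<in> C"
    show "(\<Sum>b\<in>Basis. LINT y:convex hull (C - {a})|plane_measure (nu a) (c a). (nu a \<bullet> b) * ((\<tau> y \<bullet> b) * \<phi> y))
       = (LINT y:convex hull (C - {a})|plane_measure (nu a) (c a). (\<tau> y \<bullet> nu a) * \<phi> y)"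
    proof -
      have "(\<tau> y \<bullet> nu a) * \<phi> y = (\<Sum>b\<in>Basis. (nu a \<bullet> b) * ((\<tau> y \<bullet> b) * \<phi> y))" for y
        unfolding euclidean_inner [of "\<tau> y" "nu a"] sum_distrib_right by (simp add: algebra_simps)
      moreover have "(LINT y:convex hull (C - {a})|plane_measure (nu a) (c a). (\<Sum>b\<in>Basis. (nu a \<bullet> b) * ((\<tau> y \<bullet> b) * \<phi> y)))
        = (\<Sum>b\<in>Basis. LINT y:convex hull (C - {a})|plane_measure (nu a) (c a). (nu a \<bullet> b) * ((\<tau> y \<bullet> b) * \<phi> y))"
        by (rule set_lebesgue_integral_finite_sum)
           (intro integrable_plane_measure_compact unit a compact_simplex_facet continuous_intros cs)
      ultimately show ?thesis
        by simp
    qed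
  qed
  finally show ?thesis
    by simp
qed

end

section \<open>Polynomials and continuously differentiable functions\<close>

definition C1 :: "(real^'n \<Rightarrow> real) \<Rightarrow> bool" where
  "C1 f \<longleftrightarrow> (\<forall>x. f differentiable (at x)) \<and> continuous_on UNIV (grad f)"

lemma has_derivative_gradI:
  assumes "(f has_derivative (\<lambda>h. v \<bullet> h)) (at x)"
  shows "grad f x = v"
  using frechet_derivative_at [OF assms, symmetric] by (simp add: grad_def vec_eq_iff inner_axis)

lemma differentiable_has_derivative_grad:
  fixes f :: "real^'n \<Rightarrow> real"
  assumes "f differentiable (at x)"
  shows "(f has_derivative (\<lambda>h. grad f x \<bullet> h)) (at x)"
proof -
  let ?D = "frechet_derivative f (at x)"
  have D: "(f has_derivative ?D) (at x)"
    using assms by (simp add: frechet_derivative_works)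
  have "?D h = grad f x \<bullet> h" for h
  proof -
    interpret linear ?D
      using D has_derivative_linear by blast
    have "?D h = ?D (\<Sum>i\<in>UNIV. (h $ i) *\<^sub>R axis i 1)"
      using basis_expansion [of h] by (simp add: scalar_mult_eq_scaleR)
    also have "\<dots> = grad f x \<bullet> h"
      by (simp add: sum scaleR inner_vec_def grad_def mult.commute)
    finally show ?thesis .
  qed
  then have "?D = (\<lambda>h. grad f x \<bullet> h)" ..
  with D show ?thesis
    by simp
qed

lemma C1I:
  assumes "\<And>x. (f has_derivative (\<lambda>h. g x \<bullet> h)) (at x)" "continuous_on UNIV g"
  shows "C1 f" "grad f = g"
proof -
  show "grad f = g"
    using has_derivative_gradI [OF assms(1)] by auto
  then show "C1 f"
    using assms by (auto simp: C1_def differentiable_def)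
qed

lemma C1D:
  assumes "C1 f"
  shows "(f has_derivative (\<lambda>h. grad f x \<bullet> h)) (at x)" "continuous_on UNIV (grad f)" "continuous_on UNIV f"
proof -
  show d: "(f has_derivative (\<lambda>h. grad f x \<bullet> h)) (at x)" for x
    using assms differentiable_has_derivative_grad by (auto simp: C1_def)
  show "continuous_on UNIV (grad f)"
    using assms by (auto simp: C1_def)
  show "continuous_on UNIV f"
    by (intro continuous_at_imp_continuous_on ballI has_derivative_continuous [OF d])
qed

lemma C1_const: "C1 (\<lambda>x. c)" "grad (\<lambda>x. c) = (\<lambda>x. 0)"
  by (auto intro!: C1I [where g = "\<lambda>x. 0"])

lemma grad_add:
  assumes "f differentiable (at x)" "g differentiable (at x)"
  shows "grad (\<lambda>x. f x + g x) x = grad f x + grad g x"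
  by (intro has_derivative_gradI, unfold inner_add_left)
     (intro has_derivative_add differentiable_has_derivative_grad assms)

lemma grad_mult:
  assumes "f differentiable (at x)" "g differentiable (at x)"
  shows "grad (\<lambda>x. f x * g x) x = f x *\<^sub>R grad g x + g x *\<^sub>R grad f x"
proof (rule has_derivative_gradI)
  show "((\<lambda>x. f x * g x) has_derivative (\<lambda>h. (f x *\<^sub>R grad g x + g x *\<^sub>R grad f x) \<bullet> h)) (at x)"
    using has_derivative_mult [OF differentiable_has_derivative_grad [OF assms(1)] differentiable_has_derivative_grad [OF assms(2)]]
    by (rule has_derivative_eq_rhs) (simp add: inner_add_left fun_eq_iff mult.commute)
qed

lemma C1_add:
  assumes "C1 f" "C1 g"
  shows "C1 (\<lambda>x. f x + g x)" "grad (\<lambda>x. f x + g x) = (\<lambda>x. grad f x + grad g x)"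
proof -
  show eq: "grad (\<lambda>x. f x + g x) = (\<lambda>x. grad f x + grad g x)"
    using assms by (simp add: C1_def grad_add fun_eq_iff)
  show "C1 (\<lambda>x. f x + g x)"
    using assms unfolding C1_def eq by (auto intro!: continuous_intros)
qed

lemma C1_mult:
  assumes "C1 f" "C1 g"
  shows "C1 (\<lambda>x. f x * g x)" "grad (\<lambda>x. f x * g x) = (\<lambda>x. f x *\<^sub>R grad g x + g x *\<^sub>R grad f x)"
proof -
  show eq: "grad (\<lambda>x. f x * g x) = (\<lambda>x. f x *\<^sub>R grad g x + g x *\<^sub>R grad f x)"
    using assms by (simp add: C1_def grad_mult fun_eq_iff)
  show "C1 (\<lambda>x. f x * g x)"
    using assms C1D(3) [OF assms(1)] C1D(3) [OF assms(2)] unfolding C1_def eq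
    by (auto intro!: continuous_intros)
qed

lemma C1_cmult:
  assumes "C1 f"
  shows "C1 (\<lambda>x. c * f x)" "grad (\<lambda>x. c * f x) = (\<lambda>x. c *\<^sub>R grad f x)"
  using C1_mult [OF C1_const(1) [of c] assms] by (simp_all add: C1_const)

lemma C1_component: "C1 (\<lambda>x. x $ i)" "grad (\<lambda>x. x $ i) = (\<lambda>x. axis i 1)"
proof -
  have "((\<lambda>x. x $ i) has_derivative (\<lambda>h. axis i 1 \<bullet> h)) (at x)" for x :: "real^'a"
    by (simp add: inner_axis' bounded_linear_imp_has_derivative bounded_linear_vec_nth)
  then show "C1 (\<lambda>x. x $ i :: real)" "grad (\<lambda>x. x $ i) = (\<lambda>x. axis i 1 :: real^'a)"
    using C1I [of "\<lambda>x. x $ i" "\<lambda>x. axis i 1 :: real^'a"] by simp_all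
qed

definition monom :: "('n::finite \<Rightarrow> nat) \<Rightarrow> real^'n \<Rightarrow> real" where
  "monom \<alpha> x = (\<Prod>i\<in>UNIV. (x $ i) ^ \<alpha> i)"

lemma finite_multiindices: "finite {\<alpha> :: 'n::finite \<Rightarrow> nat. (\<Sum>i\<in>UNIV. \<alpha> i) \<le> m}"
proof (rule finite_subset)
  show "{\<alpha> :: 'n \<Rightarrow> nat. (\<Sum>i\<in>UNIV. \<alpha> i) \<le> m} \<subseteq> PiE UNIV (\<lambda>_. {..m})"
  proof
    fix \<alpha> :: "'n \<Rightarrow> nat" assume "\<alpha> \<in> {\<alpha>. (\<Sum>i\<in>UNIV. \<alpha> i) \<le> m}"
    then have "\<alpha> i \<le> m" for i
      using member_le_sum [of i UNIV \<alpha>] by simp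
    then show "\<alpha> \<in> PiE UNIV (\<lambda>_. {..m})"
      by auto
  qed
  show "finite (PiE (UNIV :: 'n set) (\<lambda>_. {..m}))"
    by (intro finite_PiE) auto
qed

lemma poly_le_iff: "p \<in> poly_le m \<longleftrightarrow> (\<exists>c. p = (\<lambda>x. \<Sum>\<alpha>\<in>{\<alpha>. (\<Sum>i\<in>UNIV. \<alpha> i) \<le> m}. c \<alpha> * monom \<alpha> x))"
  by (simp add: poly_le_def monom_def)

lemma poly_le_add:
  assumes "p \<in> poly_le m" "q \<in> poly_le m"
  shows "(\<lambda>x. p x + q x) \<in> poly_le m"
proof -
  obtain c d where "p = (\<lambda>x. \<Sum>\<alpha>\<in>{\<alpha>. (\<Sum>i\<in>UNIV. \<alpha> i) \<le> m}. c \<alpha> * monom \<alpha> x)"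
    "q = (\<lambda>x. \<Sum>\<alpha>\<in>{\<alpha>. (\<Sum>i\<in>UNIV. \<alpha> i) \<le> m}. d \<alpha> * monom \<alpha> x)"
    using assms by (auto simp: poly_le_iff)
  then show ?thesis
    unfolding poly_le_iff by (intro exI [of _ "\<lambda>\<alpha>. c \<alpha> + d \<alpha>"]) (simp add: sum.distrib distrib_right)
qed

lemma poly_le_cmult:
  assumes "p \<in> poly_le m"
  shows "(\<lambda>x. a * p x) \<in> poly_le m"
proof -
  obtain c where "p = (\<lambda>x. \<Sum>\<alpha>\<in>{\<alpha>. (\<Sum>i\<in>UNIV. \<alpha> i) \<le> m}. c \<alpha> * monom \<alpha> x)"
    using assms by (auto simp: poly_le_iff)
  then show ?thesis
    unfolding poly_le_iff by (intro exI [of _ "\<lambda>\<alpha>. a * c \<alpha>"]) (simp add: sum_distrib_left mult.assoc)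
qed

lemma poly_le_zero: "(\<lambda>x. 0) \<in> poly_le m"
  unfolding poly_le_iff by (intro exI [of _ "\<lambda>\<alpha>. 0"]) simp

lemma poly_le_sum:
  assumes "\<And>i. i \<in> I \<Longrightarrow> p i \<in> poly_le m"
  shows "(\<lambda>x. \<Sum>i\<in>I. p i x) \<in> poly_le m"
  using assms by (induction I rule: infinite_finite_induct) (auto intro: poly_le_zero poly_le_add)

lemma monom_in_poly_le:
  assumes "(\<Sum>i\<in>UNIV. \<alpha> i) \<le> m"
  shows "monom \<alpha> \<in> poly_le m"
  unfolding poly_le_iff
proof (intro exI ext)
  fix x
  show "monom \<alpha> x = (\<Sum>\<beta>\<in>{\<alpha>. (\<Sum>i\<in>UNIV. \<alpha> i) \<le> m}. (if \<beta> = \<alpha> then 1 else 0) * monom \<beta> x)"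
    using assms by (simp add: if_distrib [of "\<lambda>t. t * _"] sum.delta finite_multiindices cong: if_cong)
qed

text \<open>
  Polynomials of bounded degree are the span of the monomials, so a linear property needs a proof for
  monomials only.
\<close>

lemma poly_le_induct [consumes 1, case_names add cmult zero mono]:
  assumes p: "p \<in> poly_le m"
    and add: "\<And>p q. p \<in> poly_le m \<Longrightarrow> q \<in> poly_le m \<Longrightarrow> P p \<Longrightarrow> P q \<Longrightarrow> P (\<lambda>x. p x + q x)"
    and cmult: "\<And>p a. p \<in> poly_le m \<Longrightarrow> P p \<Longrightarrow> P (\<lambda>x. a * p x)"
    and zero: "P (\<lambda>x. 0)"
    and mono: "\<And>\<alpha>. (\<Sum>i\<in>UNIV. \<alpha> i) \<le> m \<Longrightarrow> P (monom \<alpha>)"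
  shows "P p"
proof -
  obtain c where c: "p = (\<lambda>x. \<Sum>\<alpha>\<in>{\<alpha>. (\<Sum>i\<in>UNIV. \<alpha> i) \<le> m}. c \<alpha> * monom \<alpha> x)"
    using p by (auto simp: poly_le_iff)
  have "(\<lambda>x. \<Sum>\<alpha>\<in>A. c \<alpha> * monom \<alpha> x) \<in> poly_le m \<and> P (\<lambda>x. \<Sum>\<alpha>\<in>A. c \<alpha> * monom \<alpha> x)"
    if "finite A" "A \<subseteq> {\<alpha>. (\<Sum>i\<in>UNIV. \<alpha> i) \<le> m}" for A
    using that
    by (induction A rule: finite_induct)
       (auto intro!: zero add cmult mono poly_le_zero poly_le_add poly_le_cmult monom_in_poly_le)
  then show ?thesis
    using finite_multiindices [of m] by (auto simp: c)
qed

lemma poly_le_mono: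
  assumes "p \<in> poly_le m" "m \<le> m'"
  shows "p \<in> poly_le m'"
  using assms(1)
  by (induction rule: poly_le_induct)
     (use assms(2) in \<open>auto intro: poly_le_add poly_le_cmult poly_le_zero monom_in_poly_le\<close>)

lemma C1_monom:
  "C1 (monom \<alpha>)"
  "grad (monom \<alpha>) x $ i = real (\<alpha> i) * monom (\<alpha>(i := \<alpha> i - 1)) x"
proof -
  define g where "g x = (\<chi> i. real (\<alpha> i) * monom (\<alpha>(i := \<alpha> i - 1)) x)" for x
  have cont: "continuous_on UNIV (monom \<beta>)" for \<beta> :: "'a \<Rightarrow> nat"
    unfolding monom_def by (intro continuous_intros)
  have d: "(monom \<alpha> has_derivative (\<lambda>h. g x \<bullet> h)) (at x)" for x
  proof -
    have "((\<lambda>x. \<Prod>i\<in>UNIV. (x $ i) ^ \<alpha> i) has_derivative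
       (\<lambda>h. \<Sum>i\<in>UNIV. (real (\<alpha> i) * (h $ i) * (x $ i) ^ (\<alpha> i - 1)) * (\<Prod>j\<in>UNIV - {i}. (x $ j) ^ \<alpha> j))) (at x)"
      by (rule has_derivative_prod)
         (auto intro!: derivative_eq_intros bounded_linear_imp_has_derivative bounded_linear_vec_nth)
    then show ?thesis
      unfolding monom_def [abs_def]
    proof (rule has_derivative_eq_rhs)
      have "real (\<alpha> i) * (h $ i) * (x $ i) ^ (\<alpha> i - 1) * (\<Prod>j\<in>UNIV - {i}. (x $ j) ^ \<alpha> j) = g x $ i * h $ i" for h i
      proof -
        have "monom (\<alpha>(i := \<alpha> i - 1)) x = (x $ i) ^ (\<alpha> i - 1) * (\<Prod>j\<in>UNIV - {i}. (x $ j) ^ \<alpha> j)"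
          unfolding monom_def by (subst prod.remove [of _ i]) (auto intro!: prod.cong)
        then show ?thesis
          by (simp add: g_def)
      qed
      then show "(\<lambda>h. \<Sum>i\<in>UNIV. (real (\<alpha> i) * (h $ i) * (x $ i) ^ (\<alpha> i - 1)) * (\<Prod>j\<in>UNIV - {i}. (x $ j) ^ \<alpha> j))
        = (\<lambda>h. g x \<bullet> h)"
        unfolding inner_vec_def inner_real_def by (simp only:)
    qed
  qed
  moreover have "continuous_on UNIV g"
    unfolding g_def by (intro continuous_on_vec_lambda continuous_intros cont)
  ultimately show "C1 (monom \<alpha>)" "grad (monom \<alpha>) x $ i = real (\<alpha> i) * monom (\<alpha>(i := \<alpha> i - 1)) x"
    using C1I [of "monom \<alpha>" g] by (auto simp: g_def)
qed

lemma poly_le_C1: "p \<in> poly_le m \<Longrightarrow> C1 p"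
  by (induction rule: poly_le_induct) (auto intro: C1_add C1_cmult C1_const C1_monom)

lemma poly_le_grad:
  assumes "p \<in> poly_le m"
  shows "grad p \<in> vpoly_le (m - 1)"
  using assms
proof (induction rule: poly_le_induct)
  case (add p q)
  then show ?case
    by (auto simp: vpoly_le_def C1_add(2) poly_le_C1 intro: poly_le_add)
next
  case (cmult p a)
  then show ?case
    by (auto simp: vpoly_le_def C1_cmult(2) poly_le_C1 intro: poly_le_cmult)
next
  case zero
  then show ?case
    by (auto simp: vpoly_le_def C1_const poly_le_zero)
next
  case (mono \<alpha>)
  have "(\<lambda>x. real (\<alpha> i) * monom (\<alpha>(i := \<alpha> i - 1)) x) \<in> poly_le (m - 1)" for i
  proof (cases "\<alpha> i = 0")
    case False
    have "(\<Sum>j\<in>UNIV. (\<alpha>(i := \<alpha> i - 1)) j) = (\<alpha> i - 1) + (\<Sum>j\<in>UNIV - {i}. \<alpha> j)"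
      by (subst sum.remove [of _ i]) (auto intro!: sum.cong)
    moreover have "(\<Sum>j\<in>UNIV. \<alpha> j) = \<alpha> i + (\<Sum>j\<in>UNIV - {i}. \<alpha> j)"
      by (rule sum.remove) auto
    ultimately have "(\<Sum>j\<in>UNIV. (\<alpha>(i := \<alpha> i - 1)) j) \<le> m - 1"
      using mono False by simp
    then show ?thesis
      by (intro poly_le_cmult monom_in_poly_le)
  qed (simp add: poly_le_zero)
  then show ?case
    by (simp add: vpoly_le_def C1_monom(2))
qed

lemma poly_le_grad_0:
  assumes "p \<in> poly_le 0"
  shows "grad p = (\<lambda>x. 0)"
  using assms
proof (induction rule: poly_le_induct)
  case (mono \<alpha>)
  then have "\<alpha> i = 0" for i
    by simp
  then show ?case
    by (simp add: fun_eq_iff vec_eq_iff C1_monom(2))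
qed (simp_all add: C1_add C1_cmult C1_const poly_le_C1)

text \<open>
  The radial derivative multiplies each monomial by its degree (Euler's identity), so it preserves the
  space.  It arises in the divergence of the Raviart--Thomas part \<open>q x *\<^sub>R x\<close>.
\<close>

lemma poly_le_radial_derivative:
  assumes "p \<in> poly_le m"
  shows "(\<lambda>x. x \<bullet> grad p x) \<in> poly_le m"
  using assms
proof (induction rule: poly_le_induct)
  case (add p q)
  then show ?case
    by (auto simp: C1_add(2) poly_le_C1 inner_add_right intro: poly_le_add)
next
  case (cmult p a)
  then show ?case
    by (auto simp: C1_cmult(2) poly_le_C1 intro: poly_le_cmult)
next
  case zero
  then show ?case
    by (auto simp: C1_const poly_le_zero)
next
  case (mono \<alpha>)
  have "x $ i * (real (\<alpha> i) * monom (\<alpha>(i := \<alpha> i - 1)) x) = real (\<alpha> i) * monom \<alpha> x" for x :: "real^'a" and i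
  proof (cases "\<alpha> i = 0")
    case False
    then have "x $ i * (x $ i) ^ (\<alpha> i - 1) = (x $ i) ^ \<alpha> i"
      by (simp flip: power_Suc)
    moreover have "monom (\<alpha>(i := \<alpha> i - 1)) x = (x $ i) ^ (\<alpha> i - 1) * (\<Prod>j\<in>UNIV - {i}. (x $ j) ^ \<alpha> j)"
      unfolding monom_def by (subst prod.remove [of _ i]) (auto intro!: prod.cong)
    moreover have "monom \<alpha> x = (x $ i) ^ \<alpha> i * (\<Prod>j\<in>UNIV - {i}. (x $ j) ^ \<alpha> j)"
      unfolding monom_def by (rule prod.remove) auto
    ultimately show ?thesis
      by (metis (no_types, lifting) mult.assoc mult.left_commute)
  qed simp
  then have "(\<lambda>x. x \<bullet> grad (monom \<alpha>) x) = (\<lambda>x. \<Sum>i\<in>UNIV. real (\<alpha> i) * monom \<alpha> x)"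
    unfolding inner_vec_def inner_real_def C1_monom(2) by (simp only:)
  then show ?case
    using mono by (auto intro!: poly_le_sum poly_le_cmult monom_in_poly_le)
qed

lemma poly_le_real_polynomial: "p \<in> poly_le m \<Longrightarrow> real_polynomial_function p"
proof (induction rule: poly_le_induct)
  case (mono \<alpha>)
  show ?case
    unfolding monom_def [abs_def]
    by (intro real_polynomial_function_prod real_polynomial_function_power real_polynomial_function.intros(1)
        bounded_linear_vec_nth) auto
qed (auto intro: real_polynomial_function.intros)

lemma poly_le_polynomial: "p \<in> poly_le m \<Longrightarrow> polynomial_function p"
  using poly_le_real_polynomial real_polynomial_function_eq by metis

lemma polynomial_function_vec:
  fixes f :: "real^'n \<Rightarrow> real^'n"
  assumes "\<And>i. real_polynomial_function (\<lambda>x. f x $ i)"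
  shows "polynomial_function f"
  unfolding polynomial_function_iff_Basis_inner
  using assms by (auto simp: Basis_vec_def inner_axis real_polynomial_function_eq [symmetric])

lemma vpoly_le_polynomial: "p \<in> vpoly_le m \<Longrightarrow> polynomial_function p"
  by (auto simp: vpoly_le_def intro: polynomial_function_vec poly_le_real_polynomial)

lemma vpoly_le_inner:
  assumes "p \<in> vpoly_le m"
  shows "(\<lambda>x. p x \<bullet> v) \<in> poly_le m"
proof -
  have "(\<lambda>x. p x \<bullet> v) = (\<lambda>x. \<Sum>i\<in>UNIV. v $ i * p x $ i)"
    by (simp add: inner_vec_def mult.commute)
  then show ?thesis
    using assms by (auto simp: vpoly_le_def intro!: poly_le_sum poly_le_cmult)
qed

definition divg :: "(real^'n \<Rightarrow> real^'n) \<Rightarrow> real^'n \<Rightarrow> real" where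
  "divg \<tau> x = (\<Sum>i\<in>UNIV. grad (\<lambda>y. \<tau> y $ i) x $ i)"

definition RT_poly :: "nat \<Rightarrow> (real^'n \<Rightarrow> real^'n) set" where
  "RT_poly s = {\<tau>. \<exists>p\<in>vpoly_le s. \<exists>q\<in>poly_le s. \<tau> = (\<lambda>x. p x + q x *\<^sub>R x)}"

lemma RT_poly_C1:
  assumes "\<tau> \<in> RT_poly s"
  shows "C1 (\<lambda>x. \<tau> x $ i)"
proof -
  obtain p q where pq: "p \<in> vpoly_le s" "q \<in> poly_le s" "\<tau> = (\<lambda>x. p x + q x *\<^sub>R x)"
    using assms by (auto simp: RT_poly_def)
  then have "C1 (\<lambda>x. p x $ i)" "C1 q"
    using poly_le_C1 by (auto simp: vpoly_le_def)
  then show ?thesis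
    using pq C1_add(1) [OF \<open>C1 (\<lambda>x. p x $ i)\<close> C1_mult(1) [OF \<open>C1 q\<close> C1_component(1)], of i] by simp
qed

lemma RT_poly_divg:
  fixes \<tau> :: "real^'n \<Rightarrow> real^'n"
  assumes "\<tau> \<in> RT_poly s"
  shows "divg \<tau> \<in> poly_le s"
proof -
  obtain p q where p: "p \<in> vpoly_le s" and q: "q \<in> poly_le s" and \<tau>: "\<tau> = (\<lambda>x. p x + q x *\<^sub>R x)"
    using assms by (auto simp: RT_poly_def)
  have cp: "C1 (\<lambda>x. p x $ i)" for i
    using p poly_le_C1 by (auto simp: vpoly_le_def)
  have cq: "C1 q"
    using q poly_le_C1 by auto
  have "grad (\<lambda>y. \<tau> y $ i) x = grad (\<lambda>y. p y $ i) x + (q x *\<^sub>R axis i 1 + x $ i *\<^sub>R grad q x)" for i x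
    using C1_add(2) [OF cp [of i] C1_mult(1) [OF cq C1_component(1) [of i]]] C1_mult(2) [OF cq C1_component(1) [of i]]
    by (simp add: \<tau> C1_component(2))
  then have "divg \<tau> = (\<lambda>x. (\<Sum>i\<in>UNIV. grad (\<lambda>y. p y $ i) x $ i) + (real CARD('n) * q x + x \<bullet> grad q x))"
    by (simp add: divg_def fun_eq_iff sum.distrib inner_vec_def)
  moreover have "(\<lambda>x. grad (\<lambda>y. p y $ i) x $ i) \<in> poly_le s" for i
    using poly_le_grad [of "\<lambda>y. p y $ i" s] p poly_le_mono [of _ "s - 1" s] by (auto simp: vpoly_le_def)
  ultimately show ?thesis
    using q by (auto intro!: poly_le_add poly_le_sum poly_le_cmult poly_le_radial_derivative)
qed

lemma RT_poly_polynomial: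
  assumes "\<tau> \<in> RT_poly s"
  shows "polynomial_function \<tau>"
proof -
  obtain p q where "p \<in> vpoly_le s" "q \<in> poly_le s" "\<tau> = (\<lambda>x. p x + q x *\<^sub>R x)"
    using assms by (auto simp: RT_poly_def)
  moreover from this have "polynomial_function p" "polynomial_function q"
    using vpoly_le_polynomial poly_le_real_polynomial real_polynomial_function_eq by metis+
  ultimately show ?thesis
    by (simp add: polynomial_function_add polynomial_function_mult)
qed

text \<open>
  On a hyperplane \<open>n \<bullet> x = c\<close> the top-degree part \<open>q x *\<^sub>R x\<close> has the normal component \<open>c * q x\<close>, of
  degree at most \<open>s\<close>.
\<close>

lemma RT_poly_normal:
  assumes "\<tau> \<in> RT_poly s"
  shows "\<exists>r\<in>poly_le s. \<forall>x. n \<bullet> x = c \<longrightarrow> \<tau> x \<bullet> n = r x"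
proof -
  obtain p q where pq: "p \<in> vpoly_le s" "q \<in> poly_le s" "\<tau> = (\<lambda>x. p x + q x *\<^sub>R x)"
    using assms by (auto simp: RT_poly_def)
  then show ?thesis
    by (intro bexI [of _ "\<lambda>x. p x \<bullet> n + c * q x"])
       (auto simp: inner_add_left inner_commute [of n] intro!: poly_le_add poly_le_cmult vpoly_le_inner)
qed

lemma RT_poly_add:
  assumes "\<tau> \<in> RT_poly s" "\<tau>' \<in> RT_poly s"
  shows "(\<lambda>x. \<tau> x + \<tau>' x) \<in> RT_poly s"
proof -
  obtain p q p' q' where "p \<in> vpoly_le s" "q \<in> poly_le s" "\<tau> = (\<lambda>x. p x + q x *\<^sub>R x)"
    "p' \<in> vpoly_le s" "q' \<in> poly_le s" "\<tau>' = (\<lambda>x. p' x + q' x *\<^sub>R x)"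
    using assms by (auto simp: RT_poly_def)
  then show ?thesis
    unfolding RT_poly_def
    by (intro CollectI bexI [of _ "\<lambda>x. p x + p' x"] bexI [of _ "\<lambda>x. q x + q' x"])
       (auto simp: vpoly_le_def scaleR_add_left intro: poly_le_add)
qed

text \<open>
  Along each line through a point of the open set the difference is a polynomial in one variable with
  infinitely many zeros.
\<close>

lemma polynomial_function_eq_on_open:
  fixes p q :: "'a::euclidean_space \<Rightarrow> 'b::euclidean_space"
  assumes p: "polynomial_function p" and q: "polynomial_function q"
    and S: "open S" "z \<in> S" and eq: "\<And>x. x \<in> S \<Longrightarrow> p x = q x"
  shows "p = q"
proof -
  have "(p x - q x) \<bullet> b = 0" if b: "b \<in> Basis" for x b
  proof -
    let ?r = "\<lambda>t::real. (p (z + t *\<^sub>R (x - z)) - q (z + t *\<^sub>R (x - z))) \<bullet> b"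
    have line: "polynomial_function (\<lambda>t::real. z + t *\<^sub>R (x - z))"
      by (intro polynomial_function_add polynomial_function_const polynomial_function_bounded_linear bounded_linear_scaleR_left)
    have "polynomial_function (\<lambda>x. p x - q x)"
      using p q by blast
    from polynomial_function_compose [OF line this] have "polynomial_function (\<lambda>t. p (z + t *\<^sub>R (x - z)) - q (z + t *\<^sub>R (x - z)))"
      by (simp add: o_def)
    then have "real_polynomial_function ?r"
      using b by (simp add: polynomial_function_iff_Basis_inner [of "\<lambda>t. p (z + t *\<^sub>R (x - z)) - q (z + t *\<^sub>R (x - z))"])
    then obtain a n where a: "?r = (\<lambda>t. \<Sum>i\<le>n. a i * t ^ i)"
      using real_polynomial_function_imp_sum by blast
    obtain e where e: "e > 0" "ball z e \<subseteq> S"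
      using S openE by blast
    define d where "d = e / (norm (x - z) + 1)"
    have d: "d > 0"
      using e by (simp add: d_def add_nonneg_pos)
    have "?r t = 0" if t: "t \<in> {0<..<d}" for t
    proof -
      have "norm (t *\<^sub>R (x - z)) \<le> t * (norm (x - z) + 1)"
        using t by simp
      also have "\<dots> < d * (norm (x - z) + 1)"
        using t by (intro mult_strict_right_mono) (auto simp: add_nonneg_pos)
      also have "\<dots> = e"
        by (simp add: d_def add_nonneg_eq_0_iff)
      finally have "z + t *\<^sub>R (x - z) \<in> ball z e"
        by (simp add: dist_norm)
      then show ?thesis
        using e eq by auto
    qed
    then have "{0<..<d} \<subseteq> {t. (\<Sum>i\<le>n. a i * t ^ i) = 0}"
      using a by (auto simp: fun_eq_iff)
    moreover have "infinite {0<..<d}"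
      using d by (rule infinite_Ioo)
    ultimately have "infinite {t. (\<Sum>i\<le>n. a i * t ^ i) = 0}"
      using finite_subset by blast
    then have "\<forall>i\<le>n. a i = 0"
      by (simp add: polyfun_finite_roots)
    then have "?r 1 = 0"
      using fun_cong [OF a, of 1] by simp
    then show ?thesis
      by simp
  qed
  then show ?thesis
    by (metis eq_iff_diff_eq_0 euclidean_all_zero_iff ext)
qed

lemma continuous_AE_eq_on_interior:
  fixes p q :: "'a::euclidean_space \<Rightarrow> 'b::euclidean_space"
  assumes "continuous_on UNIV p" "continuous_on UNIV q" and ae: "AE x in lebesgue. x \<in> K \<longrightarrow> p x = q x"
    and x: "x \<in> interior K"
  shows "p x = q x"
proof (rule ccontr)
  assume ne: "p x \<noteq> q x"
  have "open {x. p x \<noteq> q x}"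
    using assms(1,2) by (rule open_Collect_neq)
  then have "open (interior K \<inter> {x. p x \<noteq> q x})"
    by (simp add: open_Int)
  moreover have "negligible (interior K \<inter> {x. p x \<noteq> q x})"
  proof -
    obtain N where N: "{x \<in> space lebesgue. \<not> (x \<in> K \<longrightarrow> p x = q x)} \<subseteq> N" "emeasure lebesgue N = 0" "N \<in> sets lebesgue"
      using ae by (rule AE_E)
    then have "negligible N"
      by (simp add: negligible_iff_null_sets null_sets_def)
    moreover have "interior K \<inter> {x. p x \<noteq> q x} \<subseteq> N"
      using N(1) interior_subset [of K] by auto
    ultimately show ?thesis
      by (rule negligible_subset)
  qed
  ultimately show False
    using open_not_negligible x ne by blast
qed

text \<open>
  Two polynomials that agree almost everywhere on \<open>K\<close> agree on its interior by continuity, hence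
  everywhere.  This turns \<open>restr\<close>, which is defined by choice, into a usable function.
\<close>

lemma restr_eq:
  fixes v :: "real^'n \<Rightarrow> 'b::euclidean_space"
  assumes p: "polynomial_function p" and K: "interior K \<noteq> {}" and ae: "AE x in lebesgue. x \<in> K \<longrightarrow> v x = p x"
  shows "restr K v = p"
proof -
  have "polynomial_function (restr K v) \<and> (AE x in lebesgue. x \<in> K \<longrightarrow> v x = restr K v x)"
    unfolding restr_def by (rule someI [of _ p]) (use p ae in blast)
  then have r: "polynomial_function (restr K v)" "AE x in lebesgue. x \<in> K \<longrightarrow> v x = restr K v x"
    by auto
  have "AE x in lebesgue. x \<in> K \<longrightarrow> restr K v x = p x"
    using ae r(2) by eventually_elim simp
  then have "restr K v x = p x" if "x \<in> interior K" for x
    using continuous_AE_eq_on_interior [OF continuous_on_polymonial_function [OF r(1)] continuous_on_polymonial_function [OF p] _ that]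
    by simp
  moreover obtain z where "z \<in> interior K"
    using K by blast
  ultimately show ?thesis
    using polynomial_function_eq_on_open [OF r(1) p open_interior, of z K] by simp
qed

section \<open>Smooth bump functions\<close>

lemma C_diff_Suc_D: "C_diff (Suc m) f \<Longrightarrow> C_diff m f"
proof (induction m arbitrary: f)
  case 0
  then show ?case
    by (auto intro!: continuous_at_imp_continuous_on differentiable_imp_continuous_within)
qed (metis C_diff.simps(2))

lemma C_diff_add: "C_diff m f \<Longrightarrow> C_diff m g \<Longrightarrow> C_diff m (\<lambda>x. f x + g x)"
proof (induction m arbitrary: f g)
  case 0
  then show ?case by (auto intro: continuous_intros)
next
  case (Suc m)
  then show ?case
    by (simp add: grad_add)
qed

lemma C_diff_mult: "C_diff m f \<Longrightarrow> C_diff m g \<Longrightarrow> C_diff m (\<lambda>x. f x * g x)"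
proof (induction m arbitrary: f g)
  case 0
  then show ?case by (auto intro: continuous_intros)
next
  case (Suc m)
  have "C_diff m (\<lambda>x. f x * grad g x $ i + g x * grad f x $ i)" for i
    using Suc.prems by (intro C_diff_add Suc.IH) (auto intro: C_diff_Suc_D simp del: C_diff.simps simp: C_diff.simps(2))
  with Suc.prems show ?case
    by (simp add: grad_mult)
qed

lemma C_diff_const: "C_diff m (\<lambda>x. c)"
  by (induction m arbitrary: c) (auto simp: C1_const(2))

lemma C_diff_component: "C_diff m (\<lambda>x. x $ i)"
proof (cases m)
  case 0
  then show ?thesis by (auto intro: continuous_intros)
next
  case (Suc k)
  have "(\<lambda>x. x $ i :: real) differentiable (at x)" for x :: "real^'a"
    using C1_component(1) [of i] by (simp add: C1_def)
  then show ?thesis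
    by (simp add: Suc C1_component(2) C_diff_const)
qed

lemma C_diff_sum: "(\<And>i. i \<in> I \<Longrightarrow> C_diff m (f i)) \<Longrightarrow> C_diff m (\<lambda>x. \<Sum>i\<in>I. f i x)"
  by (induction I rule: infinite_finite_induct) (simp_all add: C_diff_const C_diff_add)

lemma C_diff_1_imp_C1: 
  assumes "C_diff (Suc 0) f"
  shows "C1 f"
proof -
  have "continuous_on UNIV (\<lambda>x. \<chi> i. grad f x $ i)"
    using assms by (intro continuous_on_vec_lambda) auto
  with assms show ?thesis
    by (simp add: C1_def)
qed

text \<open>
  The analogue of \<open>C_diff\<close> for functions of one real variable, in which the bump functions are built.
\<close>

fun Cn :: "nat \<Rightarrow> (real \<Rightarrow> real) \<Rightarrow> bool" where
  "Cn 0 g \<longleftrightarrow> continuous_on UNIV g"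
| "Cn (Suc m) g \<longleftrightarrow> (\<exists>g'. (\<forall>t. (g has_real_derivative g' t) (at t)) \<and> Cn m g')"

lemma Cn_lincomb: "Cn m f \<Longrightarrow> Cn m g \<Longrightarrow> Cn m (\<lambda>t. a * f t + b * g t)"
proof (induction m arbitrary: f g)
  case 0
  then show ?case by (auto intro!: continuous_intros)
next
  case (Suc m)
  then obtain f' g' where "\<forall>t. (f has_real_derivative f' t) (at t)" "Cn m f'"
    "\<forall>t. (g has_real_derivative g' t) (at t)" "Cn m g'"
    by auto
  then show ?case
    using Suc.IH [of f' g']
    by (auto intro!: exI [of _ "\<lambda>t. a * f' t + b * g' t"] DERIV_add DERIV_cmult)
qed

lemma C_diff_compose:
  fixes Q :: "real^'n \<Rightarrow> real"
  assumes Q: "\<And>m. C_diff m Q"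
  shows "Cn m G \<Longrightarrow> C_diff m (\<lambda>x. G (Q x))"
proof (induction m arbitrary: G)
  case 0
  then show ?case
    using Q [of 0] continuous_on_compose2 [of UNIV G UNIV Q] by auto
next
  case (Suc m)
  then obtain G' where G': "\<And>t. (G has_real_derivative G' t) (at t)" "Cn m G'"
    by auto
  have d: "((\<lambda>x. G (Q x)) has_derivative (\<lambda>h. (G' (Q x) *\<^sub>R grad Q x) \<bullet> h)) (at x)" for x
  proof -
    have "(Q has_derivative (\<lambda>h. grad Q x \<bullet> h)) (at x)"
      using Q [of "Suc 0"] by (intro differentiable_has_derivative_grad) simp
    then show ?thesis
      using has_derivative_compose [of Q _ x UNIV G "\<lambda>h. G' (Q x) * h"] G'(1) [of "Q x"]
      by (simp add: has_field_derivative_def)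
  qed
  have "grad (\<lambda>x. G (Q x)) x = G' (Q x) *\<^sub>R grad Q x" for x
    by (rule has_derivative_gradI [OF d])
  moreover have "C_diff m (\<lambda>x. G' (Q x) * grad Q x $ i)" for i
    using Q [of "Suc m"] by (intro C_diff_mult Suc.IH G') simp
  moreover have "(\<lambda>x. G (Q x)) differentiable (at x)" for x
    using d differentiable_def by blast
  ultimately show ?case
    by simp
qed

text \<open>
  The family is closed under differentiation up to linear combinations: the derivative of the \<open>k\<close>-th
  function is the \<open>(k + 2)\<close>-nd minus \<open>k\<close> times the \<open>(k + 1)\<close>-st.  Smoothness of the first member,
  \<open>exp (- 1 / t)\<close> for positive \<open>t\<close>, therefore follows by one induction over the whole family.
\<close>

definition flat_exp :: "nat \<Rightarrow> real \<Rightarrow> real" where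
  "flat_exp k t = (if t > 0 then inverse t ^ k * exp (- inverse t) else 0)"

lemma flat_exp_tendsto_0: "(flat_exp k \<longlongrightarrow> 0) (at_right 0)"
proof -
  have "((\<lambda>t. inverse t ^ k / exp (inverse t)) \<longlongrightarrow> 0) (at_right (0::real))"
    using filterlim_compose [OF tendsto_power_div_exp_0 filterlim_inverse_at_top_right] .
  moreover have "\<forall>\<^sub>F t in at_right 0. inverse t ^ k / exp (inverse t) = flat_exp k t"
    by (auto simp: eventually_at_filter flat_exp_def exp_minus field_simps)
  ultimately show ?thesis
    by (rule Lim_transform_eventually)
qed

lemma flat_exp_has_derivative:
  "(flat_exp k has_real_derivative (1 * flat_exp (k + 2) t + (- real k) * flat_exp (k + 1) t)) (at t)"
proof -
  consider "t > 0" | "t < 0" | "t = 0" by linarith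
  then show ?thesis
  proof cases
    case 1
    have "((\<lambda>t. inverse t ^ k * exp (- inverse t)) has_real_derivative
        (1 * flat_exp (k + 2) t + (- real k) * flat_exp (k + 1) t)) (at t)"
    proof (cases k)
      case 0
      then show ?thesis
        using 1 by (auto intro!: derivative_eq_intros simp: flat_exp_def power2_eq_square)
    next
      case (Suc j)
      then show ?thesis
        using 1
        by (auto intro!: derivative_eq_intros simp: flat_exp_def algebra_simps power2_eq_square
              simp flip: power_Suc power_eq_if)
    qed
    then show ?thesis
    proof (rule DERIV_cong_ev [THEN iffD1, rotated -1])
      show "\<forall>\<^sub>F x in nhds t. inverse x ^ k * exp (- inverse x) = flat_exp k x"
        using 1 eventually_nhds_in_open [of "{0<..}" t]
        by (auto elim!: eventually_mono simp: flat_exp_def)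
    qed auto
  next
    case 2
    have "((\<lambda>t. 0) has_real_derivative (1 * flat_exp (k + 2) t + (- real k) * flat_exp (k + 1) t)) (at t)"
      using 2 by (simp add: flat_exp_def)
    then show ?thesis
    proof (rule DERIV_cong_ev [THEN iffD1, rotated -1])
      show "\<forall>\<^sub>F x in nhds t. 0 = flat_exp k x"
        using 2 eventually_nhds_in_open [of "{..<0}" t]
        by (auto elim!: eventually_mono simp: flat_exp_def)
    qed auto
  next
    case 3
    have "(flat_exp k has_real_derivative 0) (at 0)"
      unfolding has_field_derivative_iff
    proof (rule filterlim_split_at)
      have "\<forall>\<^sub>F h in at_left 0. 0 = (flat_exp k h - flat_exp k 0) / (h - 0)"
        by (auto simp: eventually_at_filter flat_exp_def)
      then show "((\<lambda>h. (flat_exp k h - flat_exp k 0) / (h - 0)) \<longlongrightarrow> 0) (at_left 0)"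
        by (rule Lim_transform_eventually [OF tendsto_const])
      have "\<forall>\<^sub>F h in at_right 0. flat_exp (Suc k) h = (flat_exp k h - flat_exp k 0) / (h - 0)"
        by (auto simp: eventually_at_filter flat_exp_def field_simps)
      then show "((\<lambda>h. (flat_exp k h - flat_exp k 0) / (h - 0)) \<longlongrightarrow> 0) (at_right 0)"
        by (rule Lim_transform_eventually [OF flat_exp_tendsto_0])
    qed
    then show ?thesis
      using 3 by (simp add: flat_exp_def)
  qed
qed

lemma flat_exp_Cn: "Cn m (flat_exp k)"
proof (induction m arbitrary: k)
  case 0
  then show ?case
    by (auto intro!: continuous_at_imp_continuous_on DERIV_isCont flat_exp_has_derivative)
next
  case (Suc m)
  have "Cn m (\<lambda>t. 1 * flat_exp (k + 2) t + (- real k) * flat_exp (k + 1) t)"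
    by (intro Cn_lincomb Suc)
  then show ?case
    unfolding Cn.simps
    by (intro exI [of _ "\<lambda>t. 1 * flat_exp (k + 2) t + (- real k) * flat_exp (k + 1) t"] conjI allI flat_exp_has_derivative)
qed

lemma flat_exp_0_simps:
  "flat_exp 0 t \<ge> 0" "flat_exp 0 t > 0 \<longleftrightarrow> t > 0" "flat_exp 0 t = 0 \<longleftrightarrow> t \<le> 0"
  by (auto simp: flat_exp_def)

lemma flat_exp_0_mono: "s \<le> t \<Longrightarrow> flat_exp 0 s \<le> flat_exp 0 t"
  by (auto simp: flat_exp_def le_imp_inverse_le)

text \<open>
  A smooth function supported in the ball of radius \<open>r\<close> around \<open>y\<close> and in the strip of width
  \<open>2 * \<epsilon>\<close> around the hyperplane \<open>n \<bullet> x = c\<close>.  The normalisation makes its values on the hyperplane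
  independent of \<open>\<epsilon>\<close>, so that letting \<open>\<epsilon>\<close> tend to 0 retains surface integrals and annihilates volume
  integrals.
\<close>

definition plane_bump :: "real^'n \<Rightarrow> real \<Rightarrow> real^'n \<Rightarrow> real \<Rightarrow> real \<Rightarrow> real^'n \<Rightarrow> real" where
  "plane_bump y r n c \<epsilon> x =
     flat_exp 0 (r\<^sup>2 - (\<Sum>i\<in>UNIV. (x $ i - y $ i)\<^sup>2)) * (flat_exp 0 (\<epsilon>\<^sup>2 - (n \<bullet> x - c)\<^sup>2) * inverse (flat_exp 0 (\<epsilon>\<^sup>2)))"

lemma norm_diff_squared_components: "(\<Sum>i\<in>UNIV. (x $ i - y $ i)\<^sup>2) = (dist x y)\<^sup>2" for x y :: "real^'n"
  by (simp add: dist_norm norm_vec_def L2_set_def sum_nonneg)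

lemma C_diff_plane_bump: "C_diff m (plane_bump y r n c \<epsilon>)"
proof -
  have aff: "C_diff m (\<lambda>x. a * x $ i + b)" for m i a b
    by (intro C_diff_add C_diff_mult C_diff_const C_diff_component)
  have "C_diff m (\<lambda>x. r\<^sup>2 + (-1) * (\<Sum>i\<in>UNIV. (1 * x $ i + (- y $ i)) * (1 * x $ i + (- y $ i))))" for m
    by (intro C_diff_add C_diff_mult C_diff_const C_diff_sum aff)
  then have Q: "C_diff m (\<lambda>x. r\<^sup>2 - (\<Sum>i\<in>UNIV. (x $ i - y $ i)\<^sup>2))" for m
    by (simp add: power2_eq_square)
  have lin: "C_diff m (\<lambda>x. (\<Sum>i\<in>UNIV. n $ i * x $ i) + (- c))" for m
    by (intro C_diff_add C_diff_mult C_diff_const C_diff_sum C_diff_component)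
  have "C_diff m (\<lambda>x. \<epsilon>\<^sup>2 + (-1) * (((\<Sum>i\<in>UNIV. n $ i * x $ i) + (- c)) * ((\<Sum>i\<in>UNIV. n $ i * x $ i) + (- c))))" for m
    by (intro C_diff_add [of _ "\<lambda>x. \<epsilon>\<^sup>2"] C_diff_mult lin C_diff_const)
  then have L: "C_diff m (\<lambda>x. \<epsilon>\<^sup>2 - (n \<bullet> x - c)\<^sup>2)" for m
    by (simp add: power2_eq_square inner_vec_def)
  show ?thesis
    unfolding plane_bump_def [abs_def]
    by (rule C_diff_mult [OF C_diff_compose [OF Q flat_exp_Cn] C_diff_mult [OF C_diff_compose [OF L flat_exp_Cn] C_diff_const]])
qed

lemma plane_bump_outside_ball:
  assumes "x \<notin> ball y r" "r \<ge> 0"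
  shows "plane_bump y r n c \<epsilon> x = 0"
proof -
  have "r\<^sup>2 \<le> (dist x y)\<^sup>2"
    using assms by (intro power_mono) (auto simp: dist_commute)
  then show ?thesis
    by (simp add: plane_bump_def flat_exp_0_simps norm_diff_squared_components)
qed

lemma plane_bump_test_function:
  assumes "cball y r \<subseteq> \<Omega>" "r \<ge> 0"
  shows "plane_bump y r n c \<epsilon> \<in> test_functions \<Omega>"
proof -
  have "{x. plane_bump y r n c \<epsilon> x \<noteq> 0} \<subseteq> cball y r"
    using plane_bump_outside_ball [OF _ assms(2)] ball_subset_cball [of y r] by blast
  then have "closure {x. plane_bump y r n c \<epsilon> x \<noteq> 0} \<subseteq> cball y r"
    by (simp add: closure_minimal)
  then show ?thesis
    using assms(1) bounded_subset [OF bounded_cball] C_diff_plane_bump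
    unfolding test_functions_def compact_eq_bounded_closed by blast
qed

lemma plane_bump_on_plane:
  assumes "n \<bullet> x = c" "\<epsilon> \<noteq> 0"
  shows "plane_bump y r n c \<epsilon> x = flat_exp 0 (r\<^sup>2 - (dist x y)\<^sup>2)"
  using assms flat_exp_0_simps(3) [of "\<epsilon>\<^sup>2"] by (simp add: plane_bump_def norm_diff_squared_components)

lemma plane_bump_bounds:
  assumes "\<epsilon> \<noteq> 0"
  shows "0 \<le> plane_bump y r n c \<epsilon> x" "plane_bump y r n c \<epsilon> x \<le> 1"
proof -
  let ?a = "flat_exp 0 (r\<^sup>2 - (\<Sum>i\<in>UNIV. (x $ i - y $ i)\<^sup>2))"
  let ?b = "flat_exp 0 (\<epsilon>\<^sup>2 - (n \<bullet> x - c)\<^sup>2)"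
  have e: "flat_exp 0 (\<epsilon>\<^sup>2) > 0"
    using assms by (simp add: flat_exp_0_simps)
  have a: "0 \<le> ?a" "?a \<le> 1"
    by (auto simp: flat_exp_def)
  have b: "0 \<le> ?b * inverse (flat_exp 0 (\<epsilon>\<^sup>2))" "?b * inverse (flat_exp 0 (\<epsilon>\<^sup>2)) \<le> 1"
    using e flat_exp_0_mono [of "\<epsilon>\<^sup>2 - (n \<bullet> x - c)\<^sup>2" "\<epsilon>\<^sup>2"] by (auto simp: flat_exp_0_simps field_simps)
  show "0 \<le> plane_bump y r n c \<epsilon> x" 
    unfolding plane_bump_def by (rule mult_nonneg_nonneg [OF a(1) b(1)])
  show "plane_bump y r n c \<epsilon> x \<le> 1"
    unfolding plane_bump_def by (rule mult_le_one [OF a(2) b(1) b(2)])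
qed

lemma plane_bump_off_plane:
  assumes "\<bar>\<epsilon>\<bar> \<le> \<bar>n \<bullet> x - c\<bar>"
  shows "plane_bump y r n c \<epsilon> x = 0"
proof -
  have "\<epsilon>\<^sup>2 \<le> (n \<bullet> x - c)\<^sup>2"
    using assms by (simp add: abs_le_square_iff)
  then show ?thesis
    by (simp add: plane_bump_def flat_exp_0_simps)
qed

section \<open>Integration by parts and surface integrals on facets\<close>

lemma simplex_vertices:
  fixes K :: "(real^'n) set"
  assumes "int CARD('n) simplex K"
  obtains C where "\<not> affine_dependent C" "card C = DIM(real^'n) + 1" "K = convex hull C"
  using assms that unfolding simplex_def
  by (metis DIM_cart DIM_real mult.right_neutral nat_int_comparison(1) of_nat_1 of_nat_add)

lemma elem_facets_simplex:
  fixes C :: "(real^'n) set"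
  assumes C: "\<not> affine_dependent C" "card C = DIM(real^'n) + 1"
  shows "bij_betw (\<lambda>a. convex hull (C - {a})) C (elem_facets (convex hull C))"
proof -
  have "2 \<le> card C"
    using C(2) DIM_positive [where 'a = "real^'n"] by linarith
  then have "elem_facets (convex hull C) = (\<lambda>a. convex hull (C - {a})) ` C"
    unfolding elem_facets_def by (auto simp: facet_of_convex_hull_affine_independent_alt [OF C(1)])
  moreover have "inj_on (\<lambda>a. convex hull (C - {a})) C"
  proof (rule inj_onI, rule ccontr)
    fix a b assume ab: "a \<in> C" "b \<in> C" "convex hull (C - {a}) = convex hull (C - {b})" "a \<noteq> b"
    then have "a \<in> convex hull (C - {b})"
      by (intro hull_inc) auto
    then have "a \<in> affine hull (C - {a})"
      using ab(3) convex_hull_subset_affine_hull by blast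
    then show False
      using C(1) ab(1) by (auto simp: affine_dependent_def)
  qed
  ultimately show ?thesis
    by (simp add: bij_betw_def)
qed

lemma outward_normal_simplex_facet:
  fixes C :: "(real^'n) set"
  assumes C: "\<not> affine_dependent C" "card C = DIM(real^'n) + 1" and a: "a \<in> C"
    and out: "outward_normal (convex hull C) (convex hull (C - {a})) n"
  obtains c where "simplex_facet C a n c"
proof -
  have n: "norm n = 1"
    using out by (simp add: outward_normal_def)
  obtain c where "\<And>b. b \<in> C - {a} \<Longrightarrow> n \<bullet> b = c" "n \<bullet> a < c"
    using facet_normal_vertices [OF C a n] out by (auto simp: outward_normal_def)
  with C a n have "simplex_facet C a n c"
    by unfold_locales auto
  then show ?thesis
    by (rule that)
qed

lemma facet_normal_form:
  fixes K :: "(real^'n) set"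
  assumes K: "int CARD('n) simplex K" and F: "F \<in> elem_facets K" and out: "outward_normal K F n"
  obtains C a c where "simplex_facet C a n c" "K = convex hull C" "F = convex hull (C - {a})"
proof -
  obtain C where C: "\<not> affine_dependent C" "card C = DIM(real^'n) + 1" "K = convex hull C"
    by (rule simplex_vertices [OF K])
  then obtain a where "a \<in> C" "F = convex hull (C - {a})"
    using elem_facets_simplex [OF C(1,2)] F by (auto simp: bij_betw_def)
  moreover then obtain c where "simplex_facet C a n c"
    using outward_normal_simplex_facet [OF C(1,2)] out C(3) by blast
  ultimately show ?thesis
    using C that by blast
qed

lemma set_integral_lebesgue_continuous:
  fixes h :: "real^'n \<Rightarrow> real"
  assumes K: "compact K" and h: "continuous_on UNIV h"
  shows "(LINT x:K|lebesgue. h x) = (LINT x:K|lborel. h x)" "set_integrable lebesgue K h"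
proof -
  have [measurable]: "h \<in> borel_measurable borel" "K \<in> sets borel"
    using h K by (auto simp: borel_measurable_continuous_onI borel_compact)
  have m: "(\<lambda>x. indicator K x *\<^sub>R h x) \<in> borel_measurable lborel"
    by measurable
  show "(LINT x:K|lebesgue. h x) = (LINT x:K|lborel. h x)"
    unfolding set_lebesgue_integral_def using m by (rule integral_completion)
  have "integrable lborel (\<lambda>x. indicator K x *\<^sub>R h x)"
    by (rule borel_integrable_compact [OF K]) (rule continuous_on_subset [OF h], simp)
  then show "set_integrable lebesgue K h"
    unfolding set_integrable_def using m integrable_completion by blast
qed

lemma set_integral_surf_continuous:
  fixes h :: "real^'n \<Rightarrow> real"
  assumes n: "norm n = 1" and F: "affine hull F = {x. n \<bullet> x = c}" "compact F" and h: "continuous_on UNIV h"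
  shows "(LINT x:F|surf F. h x) = (LINT x:F|plane_measure n c. h x)" "set_integrable (surf F) F h"
proof -
  have [measurable]: "h \<in> borel_measurable borel" "F \<in> sets borel"
    using h F by (auto simp: borel_measurable_continuous_onI borel_compact)
  have m: "(\<lambda>x. indicator F x *\<^sub>R h x) \<in> borel_measurable (plane_measure n c)"
    by measurable
  show "(LINT x:F|surf F. h x) = (LINT x:F|plane_measure n c. h x)"
    unfolding set_lebesgue_integral_def surf_eq_plane_measure [OF n F(1)] using m by (rule integral_completion)
  show "set_integrable (surf F) F h"
    using integrable_plane_measure_compact [OF n F(2) h, of c] m integrable_completion
    unfolding set_integrable_def surf_eq_plane_measure [OF n F(1)] by blast
qed

text \<open>
  Green's formula in the terms of the finite element setting: a simplex with one outward normal for each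
  facet, gradients and divergences in coordinates, and the measure \<open>surf\<close>.
\<close>

theorem green_simplex:
  fixes K :: "(real^'n) set"
  assumes K: "int CARD('n) simplex K"
    and nu: "\<And>F. F \<in> elem_facets K \<Longrightarrow> outward_normal K F (nu F)"
    and \<phi>: "C1 \<phi>" and \<tau>: "\<And>i. C1 (\<lambda>x. \<tau> x $ i)"
  shows "(LINT x:K|lebesgue. \<tau> x \<bullet> grad \<phi> x)
       = - (LINT x:K|lebesgue. divg \<tau> x * \<phi> x) + (\<Sum>F\<in>elem_facets K. LINT y:F|surf F. (\<tau> y \<bullet> nu F) * \<phi> y)"
proof -
  obtain C where C: "\<not> affine_dependent C" "card C = DIM(real^'n) + 1" "K = convex hull C"
    by (rule simplex_vertices [OF K])
  let ?F = "\<lambda>a. convex hull (C - {a})"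
  note bij = elem_facets_simplex [OF C(1,2)]
  have "\<exists>c. simplex_facet C a (nu (?F a)) c" if "a \<in> C" for a
  proof -
    have "?F a \<in> elem_facets K"
      using bij that C(3) by (auto simp: bij_betw_def)
    from outward_normal_simplex_facet [OF C(1,2) that nu [OF this, unfolded C(3)]]
    show ?thesis by blast
  qed
  then obtain c where c: "\<And>a. a \<in> C \<Longrightarrow> simplex_facet C a (nu (?F a)) (c a)"
    by metis
  interpret full_simplex C "\<lambda>a. nu (?F a)" c
    by (rule full_simplex.intro) (use C c in auto)
  have c\<tau>: "continuous_on UNIV (\<lambda>x. \<tau> x $ i)" for i
    by (intro C1D \<tau>)
  have c\<tau>2: "continuous_on UNIV \<tau>"
    using c\<tau> continuous_on_vec_lambda [of UNIV "\<lambda>i x. \<tau> x $ i"] by simp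
  have cdiv: "continuous_on UNIV (divg \<tau>)"
    unfolding divg_def [abs_def] by (intro continuous_intros continuous_on_component C1D \<tau>)
  have compK: "compact K"
    unfolding C(3) by (rule compact_simplex_facet)
  have basis: "b \<in> Basis \<Longrightarrow> \<exists>i. b = axis i 1" for b :: "real^'n"
    by (auto simp: Basis_vec_def)
  have green: "(LINT x:K|lborel. \<tau> x \<bullet> grad \<phi> x)
       = - (LINT x:K|lborel. (\<Sum>b\<in>Basis. grad (\<lambda>y. \<tau> y \<bullet> b) x \<bullet> b) * \<phi> x)
       + (\<Sum>a\<in>C. LINT y:?F a|plane_measure (nu (?F a)) (c a). (\<tau> y \<bullet> nu (?F a)) * \<phi> y)"
    unfolding C(3)
  proof (rule green_formula [where T = "\<lambda>b. grad (\<lambda>y. \<tau> y \<bullet> b)"])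
    fix b :: "real^'n" and x assume "b \<in> Basis"
    then obtain i where "b = axis i 1"
      using basis by blast
    then show "((\<lambda>x. \<tau> x \<bullet> b) has_derivative (\<lambda>h. grad (\<lambda>y. \<tau> y \<bullet> b) x \<bullet> h)) (at x)"
      "continuous_on UNIV (grad (\<lambda>y. \<tau> y \<bullet> b))"
      using C1D [OF \<tau> [of i]] by (simp_all add: inner_axis)
  qed (use C1D [OF \<phi>] in auto)
  have div: "(\<Sum>b\<in>Basis. grad (\<lambda>y. \<tau> y \<bullet> b) x \<bullet> b) = divg \<tau> x" for x
  proof -
    have "(\<Sum>b\<in>Basis. grad (\<lambda>y. \<tau> y \<bullet> b) x \<bullet> b) = (\<Sum>i\<in>UNIV. grad (\<lambda>y. \<tau> y \<bullet> axis i 1) x \<bullet> axis i 1)"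
      by (rule sum.reindex_bij_betw [symmetric])
         (auto simp: bij_betw_def Basis_vec_def inj_on_def axis_eq_axis)
    then show ?thesis
      by (simp add: divg_def inner_axis)
  qed
  have facets: "(\<Sum>F\<in>elem_facets K. LINT y:F|surf F. (\<tau> y \<bullet> nu F) * \<phi> y)
      = (\<Sum>a\<in>C. LINT y:?F a|surf (?F a). (\<tau> y \<bullet> nu (?F a)) * \<phi> y)"
    unfolding C(3) by (rule sum.reindex_bij_betw [OF bij, symmetric])
  also have "\<dots> = (\<Sum>a\<in>C. LINT y:?F a|plane_measure (nu (?F a)) (c a). (\<tau> y \<bullet> nu (?F a)) * \<phi> y)"
  proof (rule sum.cong [OF refl], rule set_integral_surf_continuous(1))
    fix a assume a: "a \<in> C"
    show "norm (nu (?F a)) = 1" using unit [OF a] .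
    show "affine hull (?F a) = {x. nu (?F a) \<bullet> x = c a}"
      using simplex_facet.affine_hull_facet [OF facet [OF a]] .
    show "compact (?F a)" by (rule compact_simplex_facet)
    show "continuous_on UNIV (\<lambda>y. (\<tau> y \<bullet> nu (?F a)) * \<phi> y)"
      by (intro continuous_intros c\<tau>2 C1D \<phi>)
  qed
  moreover have "(LINT x:K|lebesgue. \<tau> x \<bullet> grad \<phi> x) = (LINT x:K|lborel. \<tau> x \<bullet> grad \<phi> x)"
    by (rule set_integral_lebesgue_continuous [OF compK]) (intro continuous_intros c\<tau>2 C1D \<phi>)
  moreover have "(LINT x:K|lebesgue. divg \<tau> x * \<phi> x) = (LINT x:K|lborel. divg \<tau> x * \<phi> x)"
    by (rule set_integral_lebesgue_continuous [OF compK]) (intro continuous_intros cdiv C1D \<phi>)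
  ultimately show ?thesis
    using green by (simp add: div)
qed

lemma convex_vimage_plane_projection:
  assumes F: "convex F"
  shows "convex {x. x - (n \<bullet> x - c) *\<^sub>R n \<in> F}"
proof (rule convexI, clarify)
  fix x y and u v :: real
  assume *: "x - (n \<bullet> x - c) *\<^sub>R n \<in> F" "y - (n \<bullet> y - c) *\<^sub>R n \<in> F" "0 \<le> u" "0 \<le> v" "u + v = 1"
  have "u *\<^sub>R (x - (n \<bullet> x - c) *\<^sub>R n) + v *\<^sub>R (y - (n \<bullet> y - c) *\<^sub>R n) \<in> F"
    by (rule convexD [OF F]) (use * in auto)
  also have "u *\<^sub>R (x - (n \<bullet> x - c) *\<^sub>R n) + v *\<^sub>R (y - (n \<bullet> y - c) *\<^sub>R n)
     = (u *\<^sub>R x + v *\<^sub>R y) - (u * (n \<bullet> x) + v * (n \<bullet> y) - (u + v) * c) *\<^sub>R n"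
    by (simp add: algebra_simps)
  finally show "u *\<^sub>R x + v *\<^sub>R y - (n \<bullet> (u *\<^sub>R x + v *\<^sub>R y) - c) *\<^sub>R n \<in> F"
    using *(5) by (simp add: inner_add_right)
qed

text \<open>
  The set of points that project to the relative boundary of \<open>F\<close> lies in the frontier of the convex
  cylinder over \<open>F\<close>, and frontiers of convex sets are null sets.
\<close>

lemma AE_surf_rel_interior:
  fixes F :: "(real^'n) set"
  assumes n: "norm n = 1" and F: "affine hull F = {x. n \<bullet> x = c}" "closed F" "convex F"
  shows "AE x in surf F. x \<in> F \<longrightarrow> x \<in> rel_interior F"
proof -
  have nn: "n \<bullet> n = 1" using n by (simp add: dot_square_norm)
  let ?P = "\<lambda>x. x - (n \<bullet> x - c) *\<^sub>R n"
  let ?Z = "{x. ?P x \<in> F}"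
  have "rel_interior F = F - rel_frontier F"
    using F(2) rel_interior_subset [of F] by (auto simp: rel_frontier_def)
  then have [measurable]: "rel_interior F \<in> sets borel" "F \<in> sets borel"
    using F(2) by auto
  have sub: "{x. ?P x \<in> F \<and> ?P x \<notin> rel_interior F} \<subseteq> frontier ?Z"
  proof clarify
    fix x assume x: "?P x \<in> F" "?P x \<notin> rel_interior F"
    have "x \<notin> interior ?Z"
    proof
      assume "x \<in> interior ?Z"
      then obtain e where e: "e > 0" "ball x e \<subseteq> ?Z"
        by (auto simp: mem_interior)
      have "ball (?P x) e \<inter> affine hull F \<subseteq> F"
      proof
        fix z assume z: "z \<in> ball (?P x) e \<inter> affine hull F"
        then have "x + (z - ?P x) \<in> ball x e"
          by (simp add: dist_norm norm_minus_commute algebra_simps)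
        then have "?P (x + (z - ?P x)) \<in> F"
          using e by blast
        moreover have "?P (x + (z - ?P x)) = z"
        proof -
          have "n \<bullet> (x + (z - ?P x)) - c = n \<bullet> x - c"
            using z F(1) nn by (simp add: inner_diff_right inner_add_right)
          then show ?thesis
            by (simp only:) simp
        qed
        ultimately show "z \<in> F"
          by (simp only:)
      qed
      then have "?P x \<in> rel_interior F"
        using x(1) e(1) unfolding mem_rel_interior_ball by (intro conjI exI [of _ e])
      then show False
        using x(2) by contradiction
    qed
    moreover have "x \<in> closure ?Z"
      using x(1) by (intro subsetD [OF closure_subset]) simp
    ultimately show "x \<in> frontier ?Z"
      by (simp add: frontier_def)
  qed
  have "negligible (frontier ?Z)"
    by (intro negligible_convex_frontier convex_vimage_plane_projection F)
  then have neg: "negligible {x. ?P x \<in> F \<and> ?P x \<notin> rel_interior F}"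
    using sub by (rule negligible_subset)
  have [measurable]: "?P \<in> borel_measurable borel"
    by measurable
  have "{x. ?P x \<in> F \<and> ?P x \<notin> rel_interior F} \<in> sets borel"
    by measurable
  then have "{x. ?P x \<in> F \<and> ?P x \<notin> rel_interior F} \<in> null_sets lborel"
    using neg by (simp add: negligible_iff_null_sets null_sets_completion_iff)
  then have ae: "AE x in lborel. \<not> (?P x \<in> F \<and> ?P x \<notin> rel_interior F)"
    by (rule AE_I' ) auto
  have "AE x in plane_measure n c. x \<in> F \<longrightarrow> x \<in> rel_interior F"
    unfolding plane_measure_def
  proof (subst AE_distr_iff)
    show "?P \<in> borel_measurable (restrict_space lborel {x. \<bar>n \<bullet> x - c\<bar> \<le> 1 / 2})"
      by (auto intro!: measurable_restrict_space1)
    show "{x \<in> space borel. x \<in> F \<longrightarrow> x \<in> rel_interior F} \<in> sets borel"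
      by measurable
    show "AE x in restrict_space lborel {x. \<bar>n \<bullet> x - c\<bar> \<le> 1 / 2}. ?P x \<in> F \<longrightarrow> ?P x \<in> rel_interior F"
      using ae by (subst AE_restrict_space_iff) auto
  qed
  then show ?thesis
    unfolding surf_eq_plane_measure [OF n F(1)] by (rule AE_completion)
qed

text \<open>
  The points of the slab that project near \<open>y\<close> form a neighbourhood of \<open>y\<close>, so a neighbourhood of \<open>y\<close>
  in the facet has positive surface measure.
\<close>

lemma surf_integral_zero_imp_zero:
  fixes h :: "real^'n \<Rightarrow> real"
  assumes n: "norm n = 1" and F: "affine hull F = {x. n \<bullet> x = c}" "compact F"
    and h: "continuous_on UNIV h" and nonneg: "\<And>x. x \<in> F \<Longrightarrow> 0 \<le> h x"
    and zero: "(LINT x:F|surf F. h x) = 0" and y: "y \<in> rel_interior F"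
  shows "h y = 0"
proof (rule ccontr)
  assume "h y \<noteq> 0"
  let ?P = "\<lambda>x. x - (n \<bullet> x - c) *\<^sub>R n"
  have yF: "y \<in> F" and ny: "n \<bullet> y = c"
    using y rel_interior_subset hull_subset [of F affine] F(1) by blast+
  then have hy: "h y > 0"
    using nonneg \<open>h y \<noteq> 0\<close> by (metis less_eq_real_def)
  have [measurable]: "h \<in> borel_measurable borel" "F \<in> sets borel"
    using h F by (auto simp: borel_measurable_continuous_onI borel_compact)
  have int: "integrable (plane_measure n c) (\<lambda>x. indicator F x *\<^sub>R h x)"
    using integrable_plane_measure_compact [OF n F(2) h] by (simp add: set_integrable_def)
  have "(\<integral>x. indicator F x *\<^sub>R h x \<partial>plane_measure n c) = 0"
    using zero set_integral_surf_continuous(1) [OF n F h] by (simp add: set_lebesgue_integral_def)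
  then have ae: "AE x in plane_measure n c. indicator F x *\<^sub>R h x = 0"
    using integral_nonneg_eq_0_iff_AE [OF int] nonneg by (auto split: split_indicator)
  have [measurable]: "?P \<in> borel_measurable borel"
    by measurable
  have "AE x in restrict_space lborel {x. \<bar>n \<bullet> x - c\<bar> \<le> 1 / 2}. indicator F (?P x) *\<^sub>R h (?P x) = 0"
    using ae unfolding plane_measure_def
    by (subst (asm) AE_distr_iff) (auto intro!: measurable_restrict_space1)
  then have ae': "AE x in lborel. \<bar>n \<bullet> x - c\<bar> \<le> 1 / 2 \<longrightarrow> indicator F (?P x) *\<^sub>R h (?P x) = 0"
    by (subst (asm) AE_restrict_space_iff) auto
  obtain r where r: "r > 0" "ball y r \<inter> affine hull F \<subseteq> F"
    using y by (auto simp: mem_rel_interior_ball)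
  have cP: "continuous_on UNIV ?P"
    by (intro continuous_intros)
  have chP: "continuous_on UNIV (\<lambda>x. h (?P x))"
    by (rule continuous_on_compose2 [OF h cP]) auto
  define U where "U = {x. n \<bullet> x - c < 1 / 2} \<inter> {x. c - n \<bullet> x < 1 / 2} \<inter> {x. dist y (?P x) < r} \<inter> {x. 0 < h (?P x)}"
  have "open U"
    unfolding U_def by (intro open_Int open_Collect_less continuous_intros cP chP)
  moreover have "y \<in> U"
    using hy r ny by (simp add: U_def)
  moreover have "AE x in lborel. x \<notin> U"
    using ae'
  proof eventually_elim
    case (elim x)
    show ?case
    proof
      assume x: "x \<in> U"
      have "n \<bullet> ?P x = c"
        using n by (simp add: inner_diff_right dot_square_norm)
      then have "?P x \<in> F"
        using x r F(1) by (auto simp: U_def)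
      moreover have "\<bar>n \<bullet> x - c\<bar> \<le> 1 / 2"
        using x unfolding U_def by (intro abs_leI) auto
      ultimately show False
        using x elim by (auto simp: U_def)
    qed
  qed
  then have "U \<in> null_sets lborel"
    using \<open>open U\<close> by (subst AE_iff_null_sets) auto
  then have "negligible U"
    by (simp add: negligible_iff_null_sets null_sets_completionI)
  ultimately show False
    using open_not_negligible by blast
qed

section \<open>Geometry of the triangulation\<close>

text \<open>
  In a complete measure space measurability is invariant under changes on a null set.  If one function is
  not measurable, neither is the other, and both integrals are zero by convention.
\<close>

lemma integral_completion_cong_AE:
  fixes f g :: "'a \<Rightarrow> real"
  assumes ae: "AE x in completion N. f x = g x"
  shows "integral\<^sup>L (completion N) f = integral\<^sup>L (completion N) g"
    and "integrable (completion N) f \<Longrightarrow> integrable (completion N) g"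
proof -
  have meas: "g' \<in> borel_measurable (completion N)"
    if "f' \<in> borel_measurable (completion N)" "AE x in completion N. f' x = g' x" for f' g' :: "'a \<Rightarrow> real"
  proof (rule measurableI)
    fix A :: "real set" assume A: "A \<in> sets borel"
    show "g' -` A \<inter> space (completion N) \<in> sets (completion N)"
    proof (rule completion.in_sets_AE)
      show "f' -` A \<inter> space (completion N) \<in> sets (completion N)"
        using that(1) A by (rule measurable_sets)
      show "AE x in completion N. x \<in> f' -` A \<inter> space (completion N) \<longleftrightarrow> x \<in> g' -` A \<inter> space (completion N)"
        using that(2) by eventually_elim auto
    qed auto
  qed auto
  have ae': "AE x in completion N. g x = f x"
    using ae by eventually_elim simp
  show "integrable (completion N) f \<Longrightarrow> integrable (completion N) g"
    using integrable_cong_AE_imp [OF _ meas [OF _ ae] ae] borel_measurable_integrable by blast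
  show "integral\<^sup>L (completion N) f = integral\<^sup>L (completion N) g"
  proof (cases "f \<in> borel_measurable (completion N)")
    case True
    then show ?thesis
      by (intro integral_cong_AE meas [OF True ae] ae)
  next
    case False
    moreover have "g \<notin> borel_measurable (completion N)"
      using meas [OF _ ae'] False by blast
    ultimately show ?thesis
      by (metis borel_measurable_integrable not_integrable_integral_eq)
  qed
qed

lemma full_simplex_interior:
  fixes K :: "(real^'n) set"
  assumes "int CARD('n) simplex K"
  shows "rel_interior K = interior K" "interior K \<noteq> {}" "compact K" "convex K"
proof -
  obtain C where C: "\<not> affine_dependent C" "card C = DIM(real^'n) + 1" "K = convex hull C"
    by (rule simplex_vertices [OF assms])
  show "compact K" "convex K"
    using assms compact_simplex convex_simplex by blast+
  show ri: "rel_interior K = interior K"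
    by (rule rel_interior_interior) (simp add: C(3) affine_hull_convex_hull affine_hull_eq_UNIV [OF C(1,2)])
  have "K \<noteq> {}"
    using C by auto
  then show "interior K \<noteq> {}"
    using rel_interior_eq_empty [OF \<open>convex K\<close>] ri by simp
qed

lemma set_integrable_of_square_integrable:
  fixes f :: "'a \<Rightarrow> real"
  assumes f: "square_integrable M S f" and S: "S \<in> sets M" "emeasure M S < \<infinity>"
  shows "set_integrable M S f"
proof -
  have "integrable M (\<lambda>x. indicator S x + indicator S x *\<^sub>R (norm (f x))\<^sup>2)"
    using f S by (intro Bochner_Integration.integrable_add) (auto simp: square_integrable_def set_integrable_def)
  moreover have "(\<lambda>x. indicator S x *\<^sub>R f x) \<in> borel_measurable M"
    using f by (auto simp: square_integrable_def set_borel_measurable_def)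
  moreover have "norm (indicator S x *\<^sub>R f x) \<le> norm (indicator S x + indicator S x *\<^sub>R (norm (f x))\<^sup>2)" for x
  proof -
    have "\<bar>f x\<bar> \<le> 1 + (f x)\<^sup>2"
      using power2_sum [of "\<bar>f x\<bar>" "- 1"] zero_le_power2 [of "\<bar>f x\<bar> - 1"] by (simp add: power2_diff) 
    then show ?thesis
      by (auto split: split_indicator)
  qed
  ultimately show ?thesis
    unfolding set_integrable_def by (intro Bochner_Integration.integrable_bound [of M _ "\<lambda>x. indicator S x *\<^sub>R f x"]) auto
qed

lemma square_integrable_add:
  assumes "square_integrable M S f" "square_integrable M S g"
  shows "square_integrable M S (\<lambda>x. f x + g x)"
  unfolding square_integrable_def
proof
  show m: "set_borel_measurable M S (\<lambda>x. f x + g x)"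
    using assms by (auto simp: square_integrable_def set_borel_measurable_def scaleR_add_right)
  show "set_integrable M S (\<lambda>x. (norm (f x + g x))\<^sup>2)"
    unfolding set_integrable_def
  proof (rule Bochner_Integration.integrable_bound)
    show "integrable M (\<lambda>x. 2 * (indicator S x *\<^sub>R (norm (f x))\<^sup>2) + 2 * (indicator S x *\<^sub>R (norm (g x))\<^sup>2))"
      using assms by (auto simp: square_integrable_def set_integrable_def)
    have "(\<lambda>x. (norm (indicator S x *\<^sub>R (f x + g x)))\<^sup>2) \<in> borel_measurable M"
      using m unfolding set_borel_measurable_def by measurable
    moreover have "(norm (indicator S x *\<^sub>R (f x + g x)))\<^sup>2 = indicator S x *\<^sub>R (norm (f x + g x))\<^sup>2" for x
      by (auto split: split_indicator)
    ultimately show "(\<lambda>x. indicator S x *\<^sub>R (norm (f x + g x))\<^sup>2) \<in> borel_measurable M"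
      by simp
    have "(norm (f x + g x))\<^sup>2 \<le> 2 * (norm (f x))\<^sup>2 + 2 * (norm (g x))\<^sup>2" for x
    proof -
      have "(norm (f x + g x))\<^sup>2 \<le> (norm (f x) + norm (g x))\<^sup>2"
        by (intro power_mono norm_triangle_ineq) auto
      also have "\<dots> \<le> 2 * (norm (f x))\<^sup>2 + 2 * (norm (g x))\<^sup>2"
        using sum_squares_bound [of "norm (f x)" "norm (g x)"] by (simp add: power2_sum)
      finally show ?thesis .
    qed
    then show "AE x in M. norm (indicator S x *\<^sub>R (norm (f x + g x))\<^sup>2)
        \<le> norm (2 * (indicator S x *\<^sub>R (norm (f x))\<^sup>2) + 2 * (indicator S x *\<^sub>R (norm (g x))\<^sup>2))"
      by (auto split: split_indicator)
  qed
qed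

definition elem_normal :: "('n::finite) dg_setting \<Rightarrow> (real^'n) set \<Rightarrow> (real^'n) set \<Rightarrow> real^'n" where
  "elem_normal M K F = (if K = Kminus M F then nrml M F else - nrml M F)"

locale dg_mesh =
  fixes M :: "('n::finite) dg_setting"
  assumes valid: "valid_setting M"
begin

lemma finite_mesh: "finite (mesh M)"
  using valid by (simp add: valid_setting_def triangulation_def)

lemma mesh_simplex: "K \<in> mesh M \<Longrightarrow> int CARD('n) simplex K"
  using valid by (simp add: valid_setting_def)

lemmas mesh_element = full_simplex_interior [OF mesh_simplex]

lemma mesh_borel: "K \<in> mesh M \<Longrightarrow> K \<in> sets borel"
  by (intro borel_compact mesh_element)

lemma mesh_face: "K \<in> mesh M \<Longrightarrow> K' \<in> mesh M \<Longrightarrow> K \<inter> K' face_of K"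
  using valid by (simp add: valid_setting_def triangulation_def)

text \<open>
  A common face of two distinct elements is a proper face of at least one of them and so lies in its
  frontier.
\<close>

lemma mesh_overlap:
  assumes K: "K \<in> mesh M" and K': "K' \<in> mesh M" and ne: "K \<noteq> K'"
  shows "negligible (K \<inter> K')" "interior (K \<inter> K') = {}"
proof -
  have *: "T \<subseteq> frontier L" if "T face_of L" "T \<noteq> L" "L \<in> mesh M" for T L
    using face_of_subset_rel_frontier [OF that(1,2)] mesh_element(1) [OF that(3)]
    by (simp add: rel_frontier_def frontier_def)
  have "K \<inter> K' \<subseteq> frontier K \<or> K \<inter> K' \<subseteq> frontier K'"
    using * [OF mesh_face [OF K K'] _ K] * [OF mesh_face [OF K' K] _ K'] ne by (metis inf_commute)
  then show neg: "negligible (K \<inter> K')"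
    using negligible_convex_frontier mesh_element(4) K K' negligible_subset by metis
  then show "interior (K \<inter> K') = {}"
    using open_not_negligible [OF open_interior] negligible_subset [OF neg interior_subset] by blast
qed

lemma AE_unique_element:
  "AE x in lebesgue. \<forall>K\<in>mesh M. \<forall>K'\<in>mesh M. x \<in> K \<longrightarrow> x \<in> K' \<longrightarrow> K = K'"
proof -
  let ?N = "\<Union>(K, K')\<in>{(K, K'). K \<in> mesh M \<and> K' \<in> mesh M \<and> K \<noteq> K'}. K \<inter> K'"
  have "finite {(K, K'). K \<in> mesh M \<and> K' \<in> mesh M \<and> K \<noteq> K'}"
    by (rule finite_subset [of _ "mesh M \<times> mesh M"]) (auto simp: finite_mesh)
  then have "negligible ?N"
    by (intro negligible_Union) (auto intro: mesh_overlap)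
  then show ?thesis
    by (intro AE_I' [of ?N]) (auto simp: negligible_iff_null_sets)
qed

lemma domain_facts: "open (domain M)" "bounded (domain M)" "\<Union>(mesh M) = closure (domain M)"
  using valid by (auto simp: valid_setting_def polyhedral_lipschitz_domain_def)

text \<open>
  This excludes slits.  Near a boundary point \<open>x\<close> the domain is a strict subgraph in the direction
  \<open>\<nu>\<close>, so moving from \<open>x\<close> in this direction leads to points outside the closure.
\<close>

lemma interior_closure_domain: "interior (closure (domain M)) \<subseteq> domain M"
proof (rule subsetI, rule ccontr)
  fix x assume x: "x \<in> interior (closure (domain M))" "x \<notin> domain M"
  have "x \<in> frontier (domain M)"
    using x interior_subset [of "closure (domain M)"] domain_facts(1) by (auto simp: frontier_def interior_open)
  moreover have "lipschitz_boundary (domain M)"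
    using valid by (simp add: valid_setting_def polyhedral_lipschitz_domain_def)
  ultimately obtain r \<nu> L and \<zeta> :: "real^'n \<Rightarrow> real" where r: "r > 0" and nu: "norm \<nu> = 1"
    and lip: "L-lipschitz_on {z. \<nu> \<bullet> z = 0} \<zeta>"
    and graph: "\<And>y. y \<in> ball x r \<Longrightarrow> y \<in> domain M \<longleftrightarrow> \<nu> \<bullet> y < \<zeta> (y - (\<nu> \<bullet> y) *\<^sub>R \<nu>)"
    unfolding lipschitz_boundary_def by blast
  have nn: "\<nu> \<bullet> \<nu> = 1"
    using nu by (simp add: dot_square_norm)
  let ?P = "\<lambda>y. y - (\<nu> \<bullet> y) *\<^sub>R \<nu>"
  have above: "\<zeta> (?P x) \<le> \<nu> \<bullet> x"
    using graph [of x] r x by simp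
  obtain e where e: "e > 0" "ball x e \<subseteq> closure (domain M)"
    using x(1) by (auto simp: mem_interior)
  define t where "t = min e r / 2"
  have t: "t > 0" "t < e" "t < r"
    using e r by (auto simp: t_def)
  let ?z = "x + t *\<^sub>R \<nu>"
  have Pz: "?P ?z = ?P x" "\<nu> \<bullet> ?z = \<nu> \<bullet> x + t"
    using nn by (simp_all add: inner_add_right algebra_simps)
  have "continuous_on UNIV (\<lambda>y. \<zeta> (?P y))"
  proof (rule continuous_on_compose2 [OF lipschitz_on_continuous_on [OF lip]])
    show "continuous_on UNIV ?P"
      by (intro continuous_intros)
    show "range ?P \<subseteq> {z. \<nu> \<bullet> z = 0}"
      using nn by (auto simp: inner_diff_right)
  qed
  then have "open {y. \<zeta> (?P y) < \<nu> \<bullet> y}"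
    by (intro open_Collect_less continuous_intros)
  then have "open (ball x r \<inter> {y. \<zeta> (?P y) < \<nu> \<bullet> y})"
    by (intro open_Int open_ball)
  moreover have "?z \<in> ball x r \<inter> {y. \<zeta> (?P y) < \<nu> \<bullet> y}"
  proof -
    have "\<zeta> (?P ?z) < \<nu> \<bullet> ?z"
    proof -
      have "\<zeta> (?P x) < \<nu> \<bullet> ?z"
        using above t Pz(2) by linarith
      then show ?thesis
        by (metis Pz(1))
    qed
    then show ?thesis
      using t nu by (simp add: dist_norm)
  qed
  moreover have "ball x r \<inter> {y. \<zeta> (?P y) < \<nu> \<bullet> y} \<inter> domain M = {}"
    using graph by force
  ultimately have "?z \<notin> closure (domain M)"
    by (meson disjoint_iff open_Int_closure_eq_empty)
  moreover have "?z \<in> ball x e"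
    using t nu by (simp add: dist_norm)
  ultimately show False
    using e by blast
qed

lemma mesh_interior_subset: "K \<in> mesh M \<Longrightarrow> interior K \<subseteq> domain M"
  using interior_closure_domain interior_mono [of K "closure (domain M)"] domain_facts(3) by blast

lemma AE_domain_partition:
  "AE x in lebesgue. (indicator (domain M) x :: real) = (\<Sum>K\<in>mesh M. indicator K x)"
proof -
  have "frontier (domain M) \<subseteq> (\<Union>K\<in>mesh M. frontier K)"
  proof
    fix x assume x: "x \<in> frontier (domain M)"
    then have "x \<in> closure (domain M)" "x \<notin> domain M"
      using domain_facts(1) by (auto simp: frontier_def interior_open)
    then obtain K where "K \<in> mesh M" "x \<in> K"
      using domain_facts(3) by blast
    with \<open>x \<notin> domain M\<close> show "x \<in> (\<Union>K\<in>mesh M. frontier K)"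
      using mesh_interior_subset [of K] closure_subset [of K] by (auto simp: frontier_def)
  qed
  moreover have "negligible (\<Union>K\<in>mesh M. frontier K)"
    using finite_mesh by (intro negligible_Union) (auto intro: negligible_convex_frontier mesh_element)
  ultimately have "negligible (frontier (domain M))"
    using negligible_subset by blast
  then have "AE x in lebesgue. x \<notin> frontier (domain M)"
    by (intro AE_not_in) (simp add: negligible_iff_null_sets)
  with AE_unique_element show ?thesis
  proof eventually_elim
    case (elim x)
    show ?case
    proof (cases "x \<in> domain M")
      case True
      then obtain K where K: "K \<in> mesh M" "x \<in> K"
        using domain_facts(3) closure_subset by blast
      have "(\<Sum>L\<in>mesh M. indicator L x :: real) = (\<Sum>L\<in>{K}. indicator L x)"
        using finite_mesh K elim(1) by (intro sum.mono_neutral_right) (auto split: split_indicator)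
      then show ?thesis
        using K True by simp
    next
      case False
      then have "x \<notin> closure (domain M)"
        using elim(2) domain_facts(1) by (auto simp: frontier_def interior_open)
      then have "\<forall>K\<in>mesh M. x \<notin> K"
        using domain_facts(3) by blast
      then show ?thesis
        using False by simp
    qed
  qed
qed

text \<open>
  Almost every point of the domain lies in exactly one element: the elements overlap in null sets, and
  the boundary of the domain is covered by the frontiers of the elements.
\<close>

lemma set_integral_domain:
  fixes h :: "real^'n \<Rightarrow> real"
  assumes eq: "\<And>K. K \<in> mesh M \<Longrightarrow> AE x in lebesgue. x \<in> K \<longrightarrow> h x = hK K x"
    and int: "\<And>K. K \<in> mesh M \<Longrightarrow> set_integrable lebesgue K (hK K)"
  shows "set_integrable lebesgue (domain M) h"
    "(LINT x:domain M|lebesgue. h x) = (\<Sum>K\<in>mesh M. LINT x:K|lebesgue. hK K x)"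
proof -
  have sum: "integrable lebesgue (\<lambda>x. \<Sum>K\<in>mesh M. indicator K x *\<^sub>R hK K x)"
    using int by (intro Bochner_Integration.integrable_sum) (simp add: set_integrable_def)
  have "AE x in lebesgue. \<forall>K\<in>mesh M. x \<in> K \<longrightarrow> h x = hK K x"
    using finite_mesh eq by (intro AE_finite_allI) auto
  with AE_domain_partition
  have ae: "AE x in lebesgue. (\<Sum>K\<in>mesh M. indicator K x *\<^sub>R hK K x) = indicator (domain M) x *\<^sub>R h x"
  proof eventually_elim
    case (elim x)
    have "indicator (domain M) x *\<^sub>R h x = (\<Sum>K\<in>mesh M. indicator K x * h x)"
      using elim(1) by (simp add: sum_distrib_right)
    also have "\<dots> = (\<Sum>K\<in>mesh M. indicator K x *\<^sub>R hK K x)"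
      using elim(2) by (intro sum.cong) (auto split: split_indicator)
    finally show ?case by simp
  qed
  show "set_integrable lebesgue (domain M) h"
    unfolding set_integrable_def by (rule integral_completion_cong_AE(2) [OF ae sum])
  have "(LINT x:domain M|lebesgue. h x) = (\<integral>x. (\<Sum>K\<in>mesh M. indicator K x *\<^sub>R hK K x) \<partial>lebesgue)"
    unfolding set_lebesgue_integral_def by (rule integral_completion_cong_AE(1) [OF ae, symmetric])
  also have "\<dots> = (\<Sum>K\<in>mesh M. LINT x:K|lebesgue. hK K x)"
    using int by (subst Bochner_Integration.integral_sum) (auto simp: set_integrable_def set_lebesgue_integral_def)
  finally show "(LINT x:domain M|lebesgue. h x) = (\<Sum>K\<in>mesh M. LINT x:K|lebesgue. hK K x)" .
qed

lemma finite_elem_facets: "K \<in> mesh M \<Longrightarrow> finite (elem_facets K)"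
  using mesh_simplex simplex_imp_polytope finite_polytope_facets
  unfolding elem_facets_def by blast

lemma finite_facets: "finite (facets M)"
  unfolding facets_def using finite_mesh finite_elem_facets by blast

lemma facets_cases: "F \<in> facets M \<Longrightarrow> F \<in> facets_I M \<or> F \<in> bdry_facets M"
  by (auto simp: facets_I_def)

lemma facets_subsets: "facets_I M \<subseteq> facets M" "bdry_facets M \<subseteq> facets M" "facets_N M \<subseteq> bdry_facets M"
  "facets_I M \<inter> bdry_facets M = {}"
  by (auto simp: facets_I_def bdry_facets_def facets_N_def)

lemma elem_facets_subset_facets: "K \<in> mesh M \<Longrightarrow> elem_facets K \<subseteq> facets M"
  by (auto simp: facets_def)

lemma facet_elements_I:
  assumes "F \<in> facets_I M"
  shows "{K \<in> mesh M. F \<in> elem_facets K} = {Kplus M F, Kminus M F}" "Kplus M F \<noteq> Kminus M F"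
  using valid assms by (simp_all add: valid_setting_def elem_facets_def)

lemma facet_elements_bdry:
  assumes "F \<in> bdry_facets M"
  shows "{K \<in> mesh M. F \<in> elem_facets K} = {Kminus M F}"
  using valid assms by (simp add: valid_setting_def elem_facets_def)

lemma Kminus_element:
  assumes "F \<in> facets M"
  shows "Kminus M F \<in> mesh M" "F \<in> elem_facets (Kminus M F)" "outward_normal (Kminus M F) F (nrml M F)"
  using facets_cases [OF assms] facet_elements_I [of F] facet_elements_bdry [of F] valid assms
  by (auto simp: valid_setting_def)

lemma Kplus_element:
  assumes "F \<in> facets_I M"
  shows "Kplus M F \<in> mesh M" "F \<in> elem_facets (Kplus M F)"
  using facet_elements_I [OF assms] by blast+

lemma element_cases:
  assumes "K \<in> mesh M" "F \<in> elem_facets K"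
  shows "K = Kminus M F \<or> (F \<in> facets_I M \<and> K = Kplus M F)"
proof -
  have "F \<in> facets M"
    using assms by (auto simp: facets_def)
  then show ?thesis
    using facets_cases [of F] facet_elements_I(1) [of F] facet_elements_bdry [of F] assms by blast
qed

text \<open>
  If the two elements were on the same side of their common facet, both would contain a half-ball around
  a relatively interior point of the facet, and their interiors would meet.
\<close>

lemma outward_normal_Kplus:
  assumes F: "F \<in> facets_I M"
  shows "outward_normal (Kplus M F) F (- nrml M F)"
proof -
  let ?n = "nrml M F" and ?P = "Kplus M F" and ?N = "Kminus M F"
  have Ff: "F \<in> facets M"
    using F facets_subsets by blast
  note minus = Kminus_element [OF Ff] and plus = Kplus_element [OF F]
  obtain C a c where C: "simplex_facet C a ?n c" "?N = convex hull C" "F = convex hull (C - {a})"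
    by (rule facet_normal_form [OF mesh_simplex [OF minus(1)] minus(2,3)])
  interpret simplex_facet C a ?n c by fact
  obtain C' where C': "\<not> affine_dependent C'" "card C' = DIM(real^'n) + 1" "?P = convex hull C'"
    by (rule simplex_vertices [OF mesh_simplex [OF plus(1)]])
  then obtain a' where a': "a' \<in> C'" "F = convex hull (C' - {a'})"
    using bij_betw_imp_surj_on [OF elem_facets_simplex [OF C'(1,2)]] plus(2) unfolding C'(3) by blast
  have on: "?n \<bullet> x = c" if "x \<in> F" for x
    using facet_eq that C(3) by blast
  have ge: "c \<le> ?n \<bullet> a'"
  proof (rule ccontr)
    assume "\<not> c \<le> ?n \<bullet> a'"
    then interpret plus: simplex_facet C' a' ?n c
      using C' a' unit on by unfold_locales (auto intro: hull_inc)
    have "F \<noteq> {}"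
      using minus(2) by (auto simp: elem_facets_def facet_of_def)
    moreover have "convex F"
      using C(3) by simp
    ultimately obtain y where y: "y \<in> rel_interior F"
      using rel_interior_eq_empty by blast
    obtain e where e: "e > 0" "\<And>x. x \<in> ball y e \<Longrightarrow> x \<in> ?N \<longleftrightarrow> ?n \<bullet> x \<le> c"
      using simplex_eq_halfspace_near_facet y C by metis
    obtain e' where e': "e' > 0" "\<And>x. x \<in> ball y e' \<Longrightarrow> x \<in> ?P \<longleftrightarrow> ?n \<bullet> x \<le> c"
      using plus.simplex_eq_halfspace_near_facet y C' a' by metis
    define d where "d = min e e' / 2"
    have d: "d > 0" "d < e" "d < e'"
      using e e' by (auto simp: d_def)
    define U where "U = ball y e \<inter> ball y e' \<inter> {x. ?n \<bullet> x < c}"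
    have "open U"
      unfolding U_def by (intro open_Int open_ball open_halfspace_lt)
    moreover have "U \<subseteq> ?P \<inter> ?N"
      using e e' by (auto simp: U_def)
    moreover have "?n \<bullet> y = c"
      using on y rel_interior_subset by blast
    then have "y - d *\<^sub>R ?n \<in> U"
      using d unit by (simp add: U_def dist_norm inner_diff_right dot_square_norm)
    ultimately have "interior (?P \<inter> ?N) \<noteq> {}"
      using interior_maximal by blast
    then show False
      using mesh_overlap(2) [OF plus(1) minus(1)] facet_elements_I(2) [OF F] by blast
  qed
  have "?P \<subseteq> {x. c \<le> ?n \<bullet> x}"
    unfolding C'(3)
  proof (rule hull_minimal)
    show "C' \<subseteq> {x. c \<le> ?n \<bullet> x}"
      using ge on a' hull_inc [of _ "C' - {a'}"] by fastforce
  qed (rule convex_halfspace_ge)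
  then show ?thesis
    using on unit by (auto simp: outward_normal_def inner_diff_right)
qed

lemma outward_normal_elem_normal:
  assumes "K \<in> mesh M" "F \<in> elem_facets K"
  shows "outward_normal K F (elem_normal M K F)"
proof -
  have "F \<in> facets M"
    using assms by (auto simp: facets_def)
  then show ?thesis
    using element_cases [OF assms] Kminus_element(3) outward_normal_Kplus
    by (auto simp: elem_normal_def)
qed

lemma facet_hyperplane:
  assumes "F \<in> facets M"
  obtains c where "norm (nrml M F) = 1" "affine hull F = {x. nrml M F \<bullet> x = c}" "compact F" "convex F"
proof -
  note minus = Kminus_element [OF assms]
  obtain C a c where C: "simplex_facet C a (nrml M F) c" "Kminus M F = convex hull C" "F = convex hull (C - {a})"
    by (rule facet_normal_form [OF mesh_simplex [OF minus(1)] minus(2,3)])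
  interpret simplex_facet C a "nrml M F" c by fact
  show ?thesis
    using that unit affine_hull_facet C(3) finite_C by (simp add: finite_imp_compact_convex_hull)
qed

lemma set_integrable_facet:
  fixes h :: "real^'n \<Rightarrow> real"
  assumes "F \<in> facets M" "continuous_on UNIV h"
  shows "set_integrable (surf F) F h"
proof -
  obtain c where "norm (nrml M F) = 1" "affine hull F = {x. nrml M F \<bullet> x = c}" "compact F"
    using facet_hyperplane [OF assms(1)] by metis
  then show ?thesis
    by (rule set_integral_surf_continuous(2)) (rule assms(2))
qed

end

section \<open>Normal continuity of Raviart--Thomas fields\<close>

lemma grad_zero_on_open:
  fixes f :: "real^'n \<Rightarrow> real"
  assumes "open S" "x \<in> S" "\<And>z. z \<in> S \<Longrightarrow> f z = 0"
  shows "grad f x = 0"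
proof (rule has_derivative_gradI)
  have "((\<lambda>z. 0) has_derivative (\<lambda>h. 0)) (at x)"
    by simp
  then have "(f has_derivative (\<lambda>h. 0)) (at x)"
    by (rule has_derivative_transform_within_open [OF _ assms(1,2)]) (simp add: assms(3))
  then show "(f has_derivative (\<lambda>h. 0 \<bullet> h)) (at x)"
    by simp
qed

lemma continuous_borel_lebesgue:
  fixes h :: "'a::euclidean_space \<Rightarrow> 'b::euclidean_space"
  assumes "continuous_on UNIV h"
  shows "h \<in> borel_measurable lebesgue"
  using assms by (intro measurable_completion) (simp add: borel_measurable_continuous_onI)

lemma set_integral_zero_on:
  assumes "\<And>x. x \<in> A \<Longrightarrow> f x = 0"
  shows "(LINT x:A|M. f x) = 0"
proof -
  have "(\<lambda>x. indicator A x *\<^sub>R f x) = (\<lambda>x. 0)"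
    using assms by (auto split: split_indicator)
  then show ?thesis
    by (simp add: set_lebesgue_integral_def)
qed

lemma set_integral_eq_on:
  assumes "\<And>x. x \<in> A \<Longrightarrow> f x = g x"
  shows "(LINT x:A|M. f x) = (LINT x:A|M. g x)"
proof -
  have "(\<lambda>x. indicator A x *\<^sub>R f x) = (\<lambda>x. indicator A x *\<^sub>R g x)"
    using assms by (auto split: split_indicator)
  then show ?thesis
    by (simp add: set_lebesgue_integral_def)
qed

lemma test_function_C1: "\<phi> \<in> test_functions \<Omega> \<Longrightarrow> C1 \<phi>"
  unfolding test_functions_def using C_diff_1_imp_C1 by blast

lemma test_function_outside:
  assumes "\<phi> \<in> test_functions \<Omega>" "x \<notin> \<Omega>"
  shows "\<phi> x = 0"
  using assms closure_subset [of "{x. \<phi> x \<noteq> 0}"] by (auto simp: test_functions_def)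

lemma RT_poly_continuous:
  assumes "\<tau> \<in> RT_poly s"
  shows "continuous_on UNIV \<tau>" "continuous_on UNIV (divg \<tau>)"
  using assms RT_poly_polynomial continuous_on_polymonial_function RT_poly_divg poly_le_C1 C1D(3) by blast+

definition broken_div :: "('n::finite) dg_setting \<Rightarrow> (real^'n \<Rightarrow> real^'n) \<Rightarrow> real^'n \<Rightarrow> real" where
  "broken_div M \<tau> x = (\<Sum>K\<in>mesh M. indicator K x * divg (restr K \<tau>) x)"

context dg_mesh
begin

text \<open>
  Around a relatively interior point of an interior facet the two adjacent elements are complementary
  half-balls, and no other facet of these two elements comes close.
\<close>

lemma near_interior_facet:
  assumes F: "F \<in> facets_I M" and y: "y \<in> rel_interior F"
  obtains c r where "r > 0" "affine hull F = {x. nrml M F \<bullet> x = c}"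
    "\<And>x. x \<in> ball y r \<Longrightarrow> x \<in> Kminus M F \<longleftrightarrow> nrml M F \<bullet> x \<le> c"
    "\<And>x. x \<in> ball y r \<Longrightarrow> x \<in> Kplus M F \<longleftrightarrow> c \<le> nrml M F \<bullet> x"
    "ball y r \<subseteq> domain M"
    "\<And>K G. K \<in> {Kminus M F, Kplus M F} \<Longrightarrow> G \<in> elem_facets K \<Longrightarrow> G \<noteq> F \<Longrightarrow> G \<inter> ball y r = {}"
proof -
  let ?n = "nrml M F" and ?P = "Kplus M F" and ?N = "Kminus M F"
  have Ff: "F \<in> facets M"
    using F facets_subsets by blast
  note minus = Kminus_element [OF Ff] and plus = Kplus_element [OF F]
  have yF: "y \<in> F"
    using y rel_interior_subset by blast
  obtain C a c where C: "simplex_facet C a ?n c" "?N = convex hull C" "F = convex hull (C - {a})"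
    by (rule facet_normal_form [OF mesh_simplex [OF minus(1)] minus(2,3)])
  obtain C' a' c' where C': "simplex_facet C' a' (- ?n) c'" "?P = convex hull C'" "F = convex hull (C' - {a'})"
    by (rule facet_normal_form [OF mesh_simplex [OF plus(1)] plus(2) outward_normal_Kplus [OF F]])
  have hull: "affine hull F = {x. ?n \<bullet> x = c}"
    using simplex_facet.affine_hull_facet [OF C(1)] C(3) by simp
  have "?n \<bullet> y = c" "- ?n \<bullet> y = c'"
    using simplex_facet.facet_eq [OF C(1)] simplex_facet.facet_eq [OF C'(1)] yF C(3) C'(3) by blast+
  then have c': "c' = - c"
    by simp
  obtain e where e: "e > 0" "\<And>x. x \<in> ball y e \<Longrightarrow> x \<in> ?N \<longleftrightarrow> ?n \<bullet> x \<le> c"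
    using simplex_facet.simplex_eq_halfspace_near_facet [OF C(1)] y C(2,3) by metis
  obtain e' where e': "e' > 0" "\<And>x. x \<in> ball y e' \<Longrightarrow> x \<in> ?P \<longleftrightarrow> - ?n \<bullet> x \<le> c'"
    using simplex_facet.simplex_eq_halfspace_near_facet [OF C'(1)] y C'(2,3) by metis
  \<comment> \<open>The facets to be avoided; \<open>y\<close> lies in none of them, since a face containing a relatively interior point of \<open>F\<close> contains \<open>F\<close>.\<close>
  define Gs where "Gs = (elem_facets ?N \<union> elem_facets ?P) - {F}"
  have "y \<notin> G" if G: "G \<in> Gs" for G
  proof
    assume yG: "y \<in> G"
    obtain K where K: "K \<in> mesh M" "G facet_of K" "F facet_of K" "G \<noteq> F"
      using G minus plus by (auto simp: Gs_def elem_facets_def)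
    have "F \<subseteq> G"
      using K y yG by (intro subset_of_face_of [of G K F]) (auto simp: facet_of_def face_of_imp_subset)
    then have "F face_of G"
      using K by (meson face_of_imp_subset face_of_subset facet_of_imp_face_of)
    moreover have "convex G"
      using K by (meson facet_of_imp_face_of face_of_imp_convex)
    ultimately have "aff_dim F < aff_dim G"
      using K(4) face_of_aff_dim_lt by metis
    then show False
      using K by (simp add: facet_of_def)
  qed
  moreover have "closed G" if "G \<in> Gs" for G
  proof -
    have "G \<in> facets M"
      using that elem_facets_subset_facets minus plus by (auto simp: Gs_def)
    then show ?thesis
      by (metis facet_hyperplane compact_imp_closed)
  qed
  moreover have "finite Gs"
    using finite_elem_facets minus plus by (simp add: Gs_def)
  ultimately have "open (- \<Union> Gs)" "y \<in> - \<Union> Gs"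
    by (auto intro: closed_Union open_Compl)
  then obtain d where d: "d > 0" "ball y d \<subseteq> - \<Union> Gs"
    using openE by blast
  define r where "r = min d (min e e')"
  have r: "r > 0" "ball y r \<subseteq> ball y d" "ball y r \<subseteq> ball y e" "ball y r \<subseteq> ball y e'"
    using d e e' by (auto simp: r_def)
  have in_N: "x \<in> ?N \<longleftrightarrow> ?n \<bullet> x \<le> c" if "x \<in> ball y r" for x
    using e(2) that r by blast
  have in_P: "x \<in> ?P \<longleftrightarrow> c \<le> ?n \<bullet> x" if "x \<in> ball y r" for x
  proof -
    have "x \<in> ball y e'"
      using that r by blast
    then show ?thesis
      using e'(2) c' by simp
  qed
  have "ball y r \<subseteq> ?N \<union> ?P"
    using in_N in_P linear by blast
  then have "ball y r \<subseteq> closure (domain M)"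
    using domain_facts(3) minus(1) plus(1) by blast
  then have "ball y r \<subseteq> domain M"
    using interior_closure_domain interior_maximal open_ball by blast
  moreover have "G \<inter> ball y r = {}" if "K \<in> {?N, ?P}" "G \<in> elem_facets K" "G \<noteq> F" for K G
  proof -
    have "G \<in> Gs"
      using that by (auto simp: Gs_def)
    then show ?thesis
      using d r by blast
  qed
  ultimately show ?thesis
    using that [OF r(1) hull in_N in_P] by blast
qed

lemma RT_local:
  assumes "\<tau> \<in> RT M s" "K \<in> mesh M"
  shows "restr K \<tau> \<in> RT_poly s" "AE x in lebesgue. x \<in> K \<longrightarrow> \<tau> x = restr K \<tau> x"
proof -
  obtain p q where pq: "p \<in> vpoly_le s" "q \<in> poly_le s" "AE x in lebesgue. x \<in> K \<longrightarrow> \<tau> x = p x + q x *\<^sub>R x"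
    using assms by (auto simp: RT_def)
  then have t: "(\<lambda>x. p x + q x *\<^sub>R x) \<in> RT_poly s"
    by (auto simp: RT_poly_def)
  then have "restr K \<tau> = (\<lambda>x. p x + q x *\<^sub>R x)"
    using restr_eq [OF RT_poly_polynomial [OF t] mesh_element(2) [OF assms(2)] pq(3)] by simp
  then show "restr K \<tau> \<in> RT_poly s" "AE x in lebesgue. x \<in> K \<longrightarrow> \<tau> x = restr K \<tau> x"
    using t pq(3) by auto
qed

lemma green_element:
  assumes "K \<in> mesh M" "C1 \<phi>" "\<tau> \<in> RT_poly s"
  shows "(LINT x:K|lebesgue. \<tau> x \<bullet> grad \<phi> x)
       = - (LINT x:K|lebesgue. divg \<tau> x * \<phi> x)
       + (\<Sum>F\<in>elem_facets K. LINT y:F|surf F. (\<tau> y \<bullet> elem_normal M K F) * \<phi> y)"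
  using assms by (intro green_simplex mesh_simplex outward_normal_elem_normal RT_poly_C1)

lemma domain_finite_measure: "emeasure lebesgue (domain M) < \<infinity>" "domain M \<in> sets lebesgue"
  using domain_facts bounded_set_imp_lmeasurable [of "domain M"]
  by (auto simp: fmeasurable_def)

text \<open>
  Let \<open>q\<close> be the jump of the normal component, and suppose that \<open>q y \<noteq> 0\<close> at a relatively interior
  point \<open>y\<close> of the facet.  Testing the weak divergence with bump functions concentrating on the facet
  and integrating by parts on both elements expresses the fixed number \<open>\<integral>\<^sub>F q b\<close>, with \<open>b\<close> the common
  restriction of the bumps to the facet, as a volume integral of these bumps against an integrable
  function.  By dominated convergence it is zero.  But \<open>q\<close> has a constant sign on the support of \<open>b\<close>.
\<close>

lemma RT_normal_continuous:
  assumes \<tau>: "\<tau> \<in> RT M s" and F: "F \<in> facets_I M" and z: "z \<in> F"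
  shows "restr (Kplus M F) \<tau> z \<bullet> nrml M F = restr (Kminus M F) \<tau> z \<bullet> nrml M F"
proof -
  let ?n = "nrml M F" and ?P = "Kplus M F" and ?N = "Kminus M F"
  have Ff: "F \<in> facets M"
    using F facets_subsets by blast
  note minus = Kminus_element [OF Ff] and plus = Kplus_element [OF F]
  define tm where "tm = restr ?N \<tau>"
  define tp where "tp = restr ?P \<tau>"
  have tm: "tm \<in> RT_poly s" "AE x in lebesgue. x \<in> ?N \<longrightarrow> \<tau> x = tm x"
    and tp: "tp \<in> RT_poly s" "AE x in lebesgue. x \<in> ?P \<longrightarrow> \<tau> x = tp x"
    unfolding tm_def tp_def using RT_local [OF \<tau>] minus plus by auto
  note cont = RT_poly_continuous [OF tm(1)] RT_poly_continuous [OF tp(1)]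
  define q where "q x = (tm x - tp x) \<bullet> ?n" for x
  have cq: "continuous_on UNIV q"
    unfolding q_def by (intro continuous_intros cont)
  obtain w where w: "square_integrable lebesgue (domain M) w" and weak: "has_weak_div (domain M) \<tau> w"
    using \<tau> by (auto simp: RT_def Hdiv_def)
  have comp: "compact ?N" "compact ?P" "compact F" and n: "norm ?n = 1"
    using mesh_element(3) [OF minus(1)] mesh_element(3) [OF plus(1)] facet_hyperplane [OF Ff] by metis+
  have key: "q y = 0" if y: "y \<in> rel_interior F" for y
  proof (rule ccontr)
    assume qy: "q y \<noteq> 0"
    obtain c R where R: "R > 0" and hull: "affine hull F = {x. ?n \<bullet> x = c}"
      and in_N: "\<And>x. x \<in> ball y R \<Longrightarrow> x \<in> ?N \<longleftrightarrow> ?n \<bullet> x \<le> c"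
      and in_P: "\<And>x. x \<in> ball y R \<Longrightarrow> x \<in> ?P \<longleftrightarrow> c \<le> ?n \<bullet> x"
      and dom: "ball y R \<subseteq> domain M"
      and other: "\<And>K G. K \<in> {?N, ?P} \<Longrightarrow> G \<in> elem_facets K \<Longrightarrow> G \<noteq> F \<Longrightarrow> G \<inter> ball y R = {}"
      by (rule near_interior_facet [OF F y]) blast
    have on: "?n \<bullet> x = c" if "x \<in> F" for x
      using hull_inc [OF that, of affine] unfolding hull by simp
    obtain R' where R': "R' > 0" "\<And>x. dist x y < R' \<Longrightarrow> dist (q x) (q y) < \<bar>q y\<bar>"
      using cq qy unfolding continuous_on_iff by (metis UNIV_I zero_less_abs_iff)
    \<comment> \<open>The half makes the closed ball fit into the open one, and \<open>q\<close> keeps its sign on it.\<close>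
    define r where "r = min R R' / 2"
    have r: "r > 0" "cball y r \<subseteq> ball y R" "ball y r \<subseteq> ball y R'"
      using R R' by (auto simp: r_def)
    define \<phi> where "\<phi> j = plane_bump y r ?n c (1 / (real j + 1))" for j
    define b where "b x = flat_exp 0 (r\<^sup>2 - (dist x y)\<^sup>2)" for x
    have test: "\<phi> j \<in> test_functions (domain M)" for j
      unfolding \<phi>_def using r dom by (intro plane_bump_test_function) auto
    then have C1\<phi>: "C1 (\<phi> j)" for j
      by (rule test_function_C1)
    note c\<phi> = C1D(2,3) [OF C1\<phi>]
    have \<phi>_out: "\<phi> j x = 0" if "x \<notin> ball y r" for j x
      unfolding \<phi>_def using that r by (intro plane_bump_outside_ball) auto
    have grad_out: "grad (\<phi> j) x = 0" if "x \<notin> cball y r" for j x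
    proof (rule grad_zero_on_open [of "- cball y r"])
      fix z assume "z \<in> - cball y r"
      then show "\<phi> j z = 0"
        by (intro \<phi>_out) auto
    qed (use that in auto)
    have \<phi>_F: "\<phi> j x = b x" if "x \<in> F" for j x
      unfolding \<phi>_def b_def using on [OF that] by (intro plane_bump_on_plane) auto
    have green: "(LINT x:K|lebesgue. t x \<bullet> grad (\<phi> j) x)
        = - (LINT x:K|lebesgue. divg t x * \<phi> j x) + (LINT y:F|surf F. (t y \<bullet> elem_normal M K F) * \<phi> j y)"
      if K: "K \<in> {?N, ?P}" and t: "t \<in> RT_poly s" for K t j
    proof -
      have Km: "K \<in> mesh M" and FK: "F \<in> elem_facets K"
        using K minus plus by auto
      have "(\<Sum>G\<in>elem_facets K. LINT y:G|surf G. (t y \<bullet> elem_normal M K G) * \<phi> j y)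
          = (\<Sum>G\<in>{F}. LINT y:G|surf G. (t y \<bullet> elem_normal M K G) * \<phi> j y)"
      proof (rule sum.mono_neutral_right)
        show "\<forall>G\<in>elem_facets K - {F}. (LINT y:G|surf G. (t y \<bullet> elem_normal M K G) * \<phi> j y) = 0"
        proof
          fix G assume G: "G \<in> elem_facets K - {F}"
          show "(LINT y:G|surf G. (t y \<bullet> elem_normal M K G) * \<phi> j y) = 0"
          proof (rule set_integral_zero_on)
            fix x assume "x \<in> G"
            then have "x \<notin> ball y R"
              using other [OF K, of G] G by blast
            then have "x \<notin> ball y r"
              using r(2) ball_subset_cball by blast
            then show "(t x \<bullet> elem_normal M K G) * \<phi> j x = 0"
              by (simp add: \<phi>_out)
          qed
        qed
      qed (use finite_elem_facets Km FK in auto)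
      then show ?thesis
        using green_element [OF Km C1\<phi> t] by simp
    qed
    have hyperplane: "AE x in lebesgue. ?n \<bullet> x \<noteq> c"
    proof -
      have "negligible {x. ?n \<bullet> x = c}"
        using n by (intro negligible_hyperplane) auto
      then show ?thesis
        using AE_not_in [of "{x. ?n \<bullet> x = c}" lebesgue] by (simp add: negligible_iff_null_sets)
    qed
    have int_N: "set_integrable lebesgue ?N h" and int_P: "set_integrable lebesgue ?P h"
      if "continuous_on UNIV h" for h :: "real^'n \<Rightarrow> real"
      using set_integral_lebesgue_continuous(2) comp that by blast+
    have split: "(LINT x:domain M|lebesgue. \<tau> x \<bullet> grad (\<phi> j) x)
        = (LINT x:?N|lebesgue. tm x \<bullet> grad (\<phi> j) x) + (LINT x:?P|lebesgue. tp x \<bullet> grad (\<phi> j) x)" for j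
    proof -
      have cm: "continuous_on UNIV (\<lambda>x. tm x \<bullet> grad (\<phi> j) x)" "continuous_on UNIV (\<lambda>x. tp x \<bullet> grad (\<phi> j) x)"
        by (intro continuous_intros cont c\<phi>)+
      have "AE x in lebesgue. indicator (domain M) x *\<^sub>R (\<tau> x \<bullet> grad (\<phi> j) x)
          = indicator ?N x *\<^sub>R (tm x \<bullet> grad (\<phi> j) x) + indicator ?P x *\<^sub>R (tp x \<bullet> grad (\<phi> j) x)"
        using hyperplane tm(2) tp(2)
      proof eventually_elim
        case (elim x)
        show ?case
        proof (cases "x \<in> cball y r")
          case False
          then show ?thesis
            using grad_out by simp
        next
          case True
          then have "x \<in> ball y R"
            using r(2) by blast
          then show ?thesis
            using elim in_N [of x] in_P [of x] dom by (auto split: split_indicator)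
        qed
      qed
      then have "(LINT x:domain M|lebesgue. \<tau> x \<bullet> grad (\<phi> j) x)
         = (\<integral>x. indicator ?N x *\<^sub>R (tm x \<bullet> grad (\<phi> j) x) + indicator ?P x *\<^sub>R (tp x \<bullet> grad (\<phi> j) x) \<partial>lebesgue)"
        unfolding set_lebesgue_integral_def by (rule integral_completion_cong_AE(1))
      also have "\<dots> = (LINT x:?N|lebesgue. tm x \<bullet> grad (\<phi> j) x) + (LINT x:?P|lebesgue. tp x \<bullet> grad (\<phi> j) x)"
        using int_N [OF cm(1)] int_P [OF cm(2)] by (simp add: set_integrable_def set_lebesgue_integral_def)
      finally show ?thesis .
    qed
    \<comment> \<open>Independent of the bump; all volume terms together are the integral of \<open>h\<close> times the bump.\<close>
    define h where "h x = indicator ?N x * divg tm x + indicator ?P x * divg tp x - indicator (domain M) x * w x" for x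
    have int_w: "integrable lebesgue (\<lambda>x. indicator (domain M) x * w x)"
      using set_integrable_of_square_integrable [OF w domain_finite_measure(2,1)] by (simp add: set_integrable_def)
    have int_h: "integrable lebesgue h"
      unfolding h_def using int_w int_N [OF cont(2)] int_P [OF cont(4)] by (simp add: set_integrable_def)
    have \<phi>_meas [measurable]: "\<phi> j \<in> borel_measurable lebesgue" for j
      by (intro continuous_borel_lebesgue c\<phi>)
    have \<phi>_bound: "\<bar>\<phi> j x\<bar> \<le> 1" for j x
      unfolding \<phi>_def using plane_bump_bounds [of "1 / (real j + 1)" y r ?n c x] by (simp add: abs_le_iff)
    have int_mult: "integrable lebesgue (\<lambda>x. g x * \<phi> j x)" if g: "integrable lebesgue g" for g j
    proof (rule Bochner_Integration.integrable_bound [OF g])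
      show "AE x in lebesgue. norm (g x * \<phi> j x) \<le> norm (g x)"
        using \<phi>_bound by (intro AE_I2) (simp add: abs_mult mult_left_le)
    qed (use g in measurable)
    have boundary: "(LINT x:F|surf F. q x * b x) = (\<integral>x. h x * \<phi> j x \<partial>lebesgue)" for j
    proof -
      have ne: "elem_normal M ?P F = - ?n" "elem_normal M ?N F = ?n"
        using facet_elements_I(2) [OF F] by (auto simp: elem_normal_def)
      have "(LINT x:F|surf F. q x * b x) = (LINT x:F|surf F. (tm x \<bullet> ?n) * \<phi> j x + (tp x \<bullet> - ?n) * \<phi> j x)"
        by (rule set_integral_eq_on) (simp add: \<phi>_F q_def inner_diff_left algebra_simps)
      also have "\<dots> = (LINT x:F|surf F. (tm x \<bullet> ?n) * \<phi> j x) + (LINT x:F|surf F. (tp x \<bullet> - ?n) * \<phi> j x)"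
        by (intro set_integral_add set_integrable_facet [OF Ff] continuous_intros cont c\<phi>)
      also have "\<dots> = (LINT x:domain M|lebesgue. \<tau> x \<bullet> grad (\<phi> j) x)
          + (LINT x:?N|lebesgue. divg tm x * \<phi> j x) + (LINT x:?P|lebesgue. divg tp x * \<phi> j x)"
        using green [of ?N tm j] green [of ?P tp j] tm tp by (simp add: split ne)
      also have "\<dots> = (LINT x:?N|lebesgue. divg tm x * \<phi> j x) + (LINT x:?P|lebesgue. divg tp x * \<phi> j x)
          - (LINT x:domain M|lebesgue. w x * \<phi> j x)"
        using weak test by (simp add: has_weak_div_def)
      also have "\<dots> = (\<integral>x. (indicator ?N x * divg tm x) * \<phi> j x \<partial>lebesgue)
          + (\<integral>x. (indicator ?P x * divg tp x) * \<phi> j x \<partial>lebesgue) - (\<integral>x. (indicator (domain M) x * w x) * \<phi> j x \<partial>lebesgue)"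
        by (simp add: set_lebesgue_integral_def mult.assoc)
      also have "\<dots> = (\<integral>x. h x * \<phi> j x \<partial>lebesgue)"
        unfolding h_def left_diff_distrib distrib_right
        using int_mult [OF int_w] int_mult [of "\<lambda>x. indicator ?N x * divg tm x"] int_mult [of "\<lambda>x. indicator ?P x * divg tp x"]
          int_N [OF cont(2)] int_P [OF cont(4)]
        by (simp add: set_integrable_def)
      finally show ?thesis .
    qed
    have "(\<lambda>j. \<integral>x. h x * \<phi> j x \<partial>lebesgue) \<longlonglongrightarrow> (\<integral>x. 0 \<partial>(lebesgue :: (real^'n) measure))"
    proof (rule integral_dominated_convergence [where w = "\<lambda>x. norm (h x)"])
      show "AE x in lebesgue. (\<lambda>j. h x * \<phi> j x) \<longlonglongrightarrow> 0"
        using hyperplane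
      proof eventually_elim
        case (elim x)
        have "(\<lambda>j. 1 / (real j + 1)) \<longlonglongrightarrow> 0"
          using LIMSEQ_inverse_real_of_nat by (simp add: inverse_eq_divide add.commute)
        then have "\<forall>\<^sub>F j in sequentially. 1 / (real j + 1) < \<bar>?n \<bullet> x - c\<bar>"
          using elim by (intro order_tendstoD) auto
        then have "\<forall>\<^sub>F j in sequentially. h x * \<phi> j x = 0"
          by eventually_elim (simp add: \<phi>_def plane_bump_off_plane)
        then show ?case
          by (rule tendsto_eventually)
      qed
      show "\<And>j. AE x in lebesgue. norm (h x * \<phi> j x) \<le> norm (h x)"
        using \<phi>_bound by (intro AE_I2) (simp add: abs_mult mult_left_le)
      show "(\<lambda>x. h x * \<phi> j x) \<in> borel_measurable lebesgue" for j
        using int_mult [OF int_h] by blast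
    qed (use int_h in auto)
    then have zero: "(LINT x:F|surf F. q x * b x) = 0"
      by (simp add: boundary [symmetric] LIMSEQ_const_iff)
    have cb: "continuous_on UNIV b"
    proof -
      have "continuous_on UNIV (flat_exp 0)"
        using flat_exp_Cn [of 0 0] by simp
      then show ?thesis
        unfolding b_def by (rule continuous_on_compose2) (auto intro!: continuous_intros)
    qed
    \<comment> \<open>The factor \<open>q y\<close> makes the integrand nonnegative for either sign of the jump.\<close>
    have "q y * (q y * b y) = 0"
    proof (rule surf_integral_zero_imp_zero [where h = "\<lambda>x. q y * (q x * b x)", OF n hull comp(3) _ _ _ y])
      show "continuous_on UNIV (\<lambda>x. q y * (q x * b x))"
        by (intro continuous_intros cq cb)
      show "(LINT x:F|surf F. q y * (q x * b x)) = 0"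
        by (simp add: zero)
      fix x
      show "0 \<le> q y * (q x * b x)"
      proof (cases "x \<in> ball y r")
        case True
        then have "dist x y < R'"
          using subsetD [OF r(3)] by (simp add: dist_commute)
        then have "\<bar>q x - q y\<bar> < \<bar>q y\<bar>"
          using R'(2) by (simp add: dist_real_def)
        then have "0 \<le> q y * q x"
          by (cases "q y > 0") (auto simp: zero_le_mult_iff)
        moreover have "0 \<le> b x"
          by (simp add: b_def flat_exp_0_simps)
        ultimately show ?thesis
          by (metis mult.assoc mult_nonneg_nonneg)
      next
        case False
        then have "r\<^sup>2 \<le> (dist x y)\<^sup>2"
          using r by (intro power_mono) (auto simp: dist_commute)
        then have "b x = 0"
          by (simp add: b_def flat_exp_0_simps)
        then show ?thesis
          by simp
      qed
    qed
    moreover have "b y > 0"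
      using r by (simp add: b_def flat_exp_0_simps)
    ultimately show False
      using qy by simp
  qed
  have "convex F" "closed F"
    using facet_hyperplane [OF Ff] compact_imp_closed by blast+
  then have "closure (rel_interior F) = F"
    by (simp add: convex_closure_rel_interior)
  then have "q z = 0"
    using continuous_constant_on_closure [of "rel_interior F" q 0 z] key z continuous_on_subset [OF cq] by auto
  then show ?thesis
    by (simp add: q_def tm_def tp_def inner_diff_left)
qed

end

section \<open>The piecewise divergence is the weak divergence\<close>

lemma set_integral_surf_cong_AE:
  assumes "AE x in surf F. indicator A x *\<^sub>R f x = (indicator B x *\<^sub>R g x :: real)"
  shows "(LINT x:A|surf F. f x) = (LINT x:B|surf F. g x)"
    "set_integrable (surf F) A f \<Longrightarrow> set_integrable (surf F) B g"
  using integral_completion_cong_AE [OF assms [unfolded surf_def]]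
  unfolding set_lebesgue_integral_def set_integrable_def surf_def by simp_all

definition orient :: "('n::finite) dg_setting \<Rightarrow> (real^'n) set \<Rightarrow> (real^'n) set \<Rightarrow> real" where
  "orient M K F = (if K = Kminus M F then 1 else - 1)"

lemma elem_normal_orient: "elem_normal M K F = orient M K F *\<^sub>R nrml M F"
  by (simp add: elem_normal_def orient_def)

context dg_mesh
begin

lemma AE_broken_div:
  assumes K: "K \<in> mesh M"
  shows "AE x in lebesgue. x \<in> K \<longrightarrow> broken_div M \<tau> x = divg (restr K \<tau>) x"
  using AE_unique_element
proof eventually_elim
  case (elim x)
  show ?case
  proof
    assume x: "x \<in> K"
    have "broken_div M \<tau> x = (\<Sum>L\<in>{K}. indicator L x * divg (restr L \<tau>) x)"
      unfolding broken_div_def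
      using finite_mesh K elim x by (intro sum.mono_neutral_right) (auto split: split_indicator)
    then show "broken_div M \<tau> x = divg (restr K \<tau>) x"
      using x by simp
  qed
qed

lemma broken_div_measurable:
  assumes "\<And>K. K \<in> mesh M \<Longrightarrow> restr K \<tau> \<in> RT_poly s"
  shows "broken_div M \<tau> \<in> borel_measurable lebesgue"
proof -
  have "(\<lambda>x. indicator K x * divg (restr K \<tau>) x) \<in> borel_measurable lebesgue" if K: "K \<in> mesh M" for K
  proof -
    have "K \<in> sets lebesgue"
      using mesh_borel [OF K] by simp
    then show ?thesis
      using continuous_borel_lebesgue [OF RT_poly_continuous(2) [OF assms [OF K]]] by measurable
  qed
  then show ?thesis
    unfolding broken_div_def [abs_def] by (rule borel_measurable_sum)
qed

lemma set_borel_measurable_domain: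
  fixes h :: "real^'n \<Rightarrow> 'b::euclidean_space"
  assumes "h \<in> borel_measurable lebesgue"
  shows "set_borel_measurable lebesgue (domain M) h"
  unfolding set_borel_measurable_def using assms domain_finite_measure(2) by measurable

lemma set_integrable_element:
  fixes h :: "real^'n \<Rightarrow> real"
  assumes "K \<in> mesh M" "continuous_on UNIV h"
  shows "set_integrable lebesgue K h"
  using assms mesh_element(3) set_integral_lebesgue_continuous(2) by blast

lemma broken_div_square_integrable:
  assumes "\<And>K. K \<in> mesh M \<Longrightarrow> restr K \<tau> \<in> RT_poly s"
  shows "square_integrable lebesgue (domain M) (broken_div M \<tau>)"
  unfolding square_integrable_def
proof
  note m = broken_div_measurable [OF assms]
  show "set_borel_measurable lebesgue (domain M) (broken_div M \<tau>)"
    by (rule set_borel_measurable_domain [OF m])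
  show "set_integrable lebesgue (domain M) (\<lambda>x. (norm (broken_div M \<tau> x))\<^sup>2)"
  proof (rule set_integral_domain(1))
    fix K assume K: "K \<in> mesh M"
    show "AE x in lebesgue. x \<in> K \<longrightarrow> (norm (broken_div M \<tau> x))\<^sup>2 = (norm (divg (restr K \<tau>) x))\<^sup>2"
      using AE_broken_div [OF K, of \<tau>] by eventually_elim simp
    show "set_integrable lebesgue K (\<lambda>x. (norm (divg (restr K \<tau>) x))\<^sup>2)"
      by (intro set_integrable_element K continuous_intros RT_poly_continuous(2) [OF assms [OF K]])
  qed
qed

lemma broken_div_DG:
  assumes "\<And>K. K \<in> mesh M \<Longrightarrow> restr K \<tau> \<in> RT_poly s"
  shows "broken_div M \<tau> \<in> DG M s"
  unfolding DG_def
proof (intro CollectI conjI ballI)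
  show "square_integrable lebesgue (domain M) (broken_div M \<tau>)"
    using broken_div_square_integrable [OF assms] .
  fix K assume K: "K \<in> mesh M"
  show "\<exists>p\<in>poly_le s. AE x in lebesgue. x \<in> K \<longrightarrow> broken_div M \<tau> x = p x"
    using AE_broken_div [OF K] RT_poly_divg [OF assms [OF K]] by blast
qed

text \<open>
  Sum Green's formula over the elements and collect the surface terms by facets.  The two contributions
  of an interior facet cancel, and test functions vanish on the boundary.
\<close>

lemma weak_div_broken_div:
  assumes poly: "\<And>K. K \<in> mesh M \<Longrightarrow> restr K \<tau> \<in> RT_poly s"
    and loc: "\<And>K. K \<in> mesh M \<Longrightarrow> AE x in lebesgue. x \<in> K \<longrightarrow> \<tau> x = restr K \<tau> x"
    and normal: "\<And>F x. F \<in> facets_I M \<Longrightarrow> x \<in> F \<Longrightarrow>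
       restr (Kplus M F) \<tau> x \<bullet> nrml M F = restr (Kminus M F) \<tau> x \<bullet> nrml M F"
  shows "has_weak_div (domain M) \<tau> (broken_div M \<tau>)"
  unfolding has_weak_div_def
proof
  fix \<phi> assume test: "\<phi> \<in> test_functions (domain M)"
  note C1 = test_function_C1 [OF test]
  let ?t = "\<lambda>K. restr K \<tau>"
  let ?B = "\<lambda>K F. LINT y:F|surf F. (?t K y \<bullet> elem_normal M K F) * \<phi> y"
  have "(LINT x:domain M|lebesgue. \<tau> x \<bullet> grad \<phi> x) = (\<Sum>K\<in>mesh M. LINT x:K|lebesgue. ?t K x \<bullet> grad \<phi> x)"
  proof (rule set_integral_domain(2))
    fix K assume K: "K \<in> mesh M"
    show "AE x in lebesgue. x \<in> K \<longrightarrow> \<tau> x \<bullet> grad \<phi> x = ?t K x \<bullet> grad \<phi> x"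
      using loc [OF K] by eventually_elim simp
    show "set_integrable lebesgue K (\<lambda>x. ?t K x \<bullet> grad \<phi> x)"
      by (intro set_integrable_element K continuous_intros RT_poly_continuous(1) [OF poly [OF K]] C1D C1)
  qed
  also have "\<dots> = - (\<Sum>K\<in>mesh M. LINT x:K|lebesgue. divg (?t K) x * \<phi> x) + (\<Sum>K\<in>mesh M. \<Sum>F\<in>elem_facets K. ?B K F)"
    using green_element [OF _ C1 poly] by (simp add: sum.distrib sum_negf sum_subtractf)
  also have "(\<Sum>K\<in>mesh M. LINT x:K|lebesgue. divg (?t K) x * \<phi> x) = (LINT x:domain M|lebesgue. broken_div M \<tau> x * \<phi> x)"
  proof (rule set_integral_domain(2) [symmetric])
    fix K assume K: "K \<in> mesh M"
    show "AE x in lebesgue. x \<in> K \<longrightarrow> broken_div M \<tau> x * \<phi> x = divg (?t K) x * \<phi> x"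
      using AE_broken_div [OF K, of \<tau>] by eventually_elim simp
    show "set_integrable lebesgue K (\<lambda>x. divg (?t K) x * \<phi> x)"
      by (intro set_integrable_element K continuous_intros RT_poly_continuous(2) [OF poly [OF K]] C1D C1)
  qed
  also have "(\<Sum>K\<in>mesh M. \<Sum>F\<in>elem_facets K. ?B K F) = (\<Sum>K\<in>mesh M. \<Sum>F | F \<in> facets M \<and> F \<in> elem_facets K. ?B K F)"
    by (intro sum.cong refl) (use elem_facets_subset_facets in auto)
  also have "\<dots> = (\<Sum>F\<in>facets M. \<Sum>K | K \<in> mesh M \<and> F \<in> elem_facets K. ?B K F)"
    by (rule sum.swap_restrict [OF finite_mesh finite_facets])
  also have "\<dots> = 0"
  proof (rule sum.neutral, rule ballI)
    fix F assume F: "F \<in> facets M"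
    show "(\<Sum>K | K \<in> mesh M \<and> F \<in> elem_facets K. ?B K F) = 0"
    proof (cases "F \<in> facets_I M")
      case True
      have "?B (Kplus M F) F = (LINT y:F|surf F. - ((?t (Kminus M F) y \<bullet> nrml M F) * \<phi> y))"
        using facet_elements_I(2) [OF True]
        by (intro set_integral_eq_on) (simp add: elem_normal_def normal [OF True])
      also have "\<dots> = - ?B (Kminus M F) F"
        by (simp add: elem_normal_def set_lebesgue_integral_def)
      finally show ?thesis
        using facet_elements_I [OF True] by simp
    next
      case False
      then have "F \<in> bdry_facets M"
        using F facets_cases by blast
      then have "F \<subseteq> frontier (domain M)"
        by (simp add: bdry_facets_def)
      then have "\<phi> x = 0" if "x \<in> F" for x
        using that test_function_outside [OF test, of x] domain_facts(1) by (auto simp: frontier_def interior_open)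
      then show ?thesis
        by (intro sum.neutral ballI set_integral_zero_on) simp
    qed
  qed
  finally show "(LINT x:domain M|lebesgue. \<tau> x \<bullet> grad \<phi> x) = - (LINT x:domain M|lebesgue. broken_div M \<tau> x * \<phi> x)"
    by simp
qed

text \<open>
  Normal continuity is a pointwise condition and hence inherited by sums; with the previous lemma it
  yields the weak divergence of the sum directly, as its piecewise divergence.
\<close>

lemma RT_add:
  assumes \<sigma>: "\<sigma> \<in> RT M s" and \<tau>: "\<tau> \<in> RT M s"
  defines "\<rho> \<equiv> \<lambda>x. \<sigma> x + \<tau> x"
  shows "\<rho> \<in> RT M s"
    and "K \<in> mesh M \<Longrightarrow> restr K \<rho> = (\<lambda>x. restr K \<sigma> x + restr K \<tau> x)"
    and "has_weak_div (domain M) \<rho> (broken_div M \<rho>)"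
proof -
  have loc: "AE x in lebesgue. x \<in> K \<longrightarrow> \<rho> x = restr K \<sigma> x + restr K \<tau> x" if "K \<in> mesh M" for K
    using RT_local(2) [OF \<sigma> that] RT_local(2) [OF \<tau> that] by eventually_elim (simp add: \<rho>_def)
  have poly: "(\<lambda>x. restr K \<sigma> x + restr K \<tau> x) \<in> RT_poly s" if "K \<in> mesh M" for K
    by (intro RT_poly_add RT_local [OF \<sigma> that] RT_local [OF \<tau> that])
  show restr: "restr K \<rho> = (\<lambda>x. restr K \<sigma> x + restr K \<tau> x)" if "K \<in> mesh M" for K
    by (intro restr_eq RT_poly_polynomial [OF poly] mesh_element(2) loc that)
  have poly': "restr K \<rho> \<in> RT_poly s" if "K \<in> mesh M" for K
    using poly restr that by simp
  have sq: "square_integrable lebesgue (domain M) \<rho>"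
    using \<sigma> \<tau> unfolding \<rho>_def by (intro square_integrable_add) (auto simp: RT_def Hdiv_def)
  show weak: "has_weak_div (domain M) \<rho> (broken_div M \<rho>)"
  proof (rule weak_div_broken_div [OF poly'])
    show "AE x in lebesgue. x \<in> K \<longrightarrow> \<rho> x = restr K \<rho> x" if "K \<in> mesh M" for K
      using loc restr that by simp
    fix F x assume F: "F \<in> facets_I M" and x: "x \<in> F"
    have "F \<in> facets M"
      using F facets_subsets by blast
    then show "restr (Kplus M F) \<rho> x \<bullet> nrml M F = restr (Kminus M F) \<rho> x \<bullet> nrml M F"
      using RT_normal_continuous [OF \<sigma> F x] RT_normal_continuous [OF \<tau> F x] Kminus_element(1) Kplus_element(1) [OF F]
      by (simp add: restr inner_add_left)
  qed
  have "\<exists>p\<in>vpoly_le s. \<exists>q\<in>poly_le s. AE x in lebesgue. x \<in> K \<longrightarrow> \<rho> x = p x + q x *\<^sub>R x" if K: "K \<in> mesh M" for K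
  proof -
    obtain p q where pq: "p \<in> vpoly_le s" "q \<in> poly_le s" "(\<lambda>x. restr K \<sigma> x + restr K \<tau> x) = (\<lambda>x. p x + q x *\<^sub>R x)"
      using poly [OF K] unfolding RT_poly_def by blast
    have "AE x in lebesgue. x \<in> K \<longrightarrow> \<rho> x = p x + q x *\<^sub>R x"
      using loc [OF K] fun_cong [OF pq(3)] by simp
    with pq(1,2) show ?thesis
      by blast
  qed
  then show "\<rho> \<in> RT M s"
    using sq weak broken_div_square_integrable [OF poly'] by (auto simp: RT_def Hdiv_def)
qed

text \<open>
  Green's formula on \<open>K\<close>, with the normal traces taken from the reference side of each facet.  For the
  facets with \<open>K\<close> on the other side this is where normal continuity enters.
\<close>

lemma RT_element_identity:
  assumes \<tau>: "\<tau> \<in> RT M s" and K: "K \<in> mesh M" and \<phi>: "C1 \<phi>"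
  shows "(LINT x:K|lebesgue. divg (restr K \<tau>) x * \<phi> x)
       = - (LINT x:K|lebesgue. \<tau> x \<bullet> grad \<phi> x)
       + (\<Sum>F\<in>elem_facets K. orient M K F * (LINT x:F|surf F. normal_trace M F \<tau> x * \<phi> x))"
proof -
  note t = RT_local [OF \<tau> K]
  have "(LINT y:F|surf F. (restr K \<tau> y \<bullet> elem_normal M K F) * \<phi> y)
      = orient M K F * (LINT x:F|surf F. normal_trace M F \<tau> x * \<phi> x)" if F: "F \<in> elem_facets K" for F
  proof -
    have "restr K \<tau> y \<bullet> nrml M F = restr (Kminus M F) \<tau> y \<bullet> nrml M F" if "y \<in> F" for y
      using element_cases [OF K F] RT_normal_continuous [OF \<tau> _ that] by auto
    then have "(LINT y:F|surf F. (restr K \<tau> y \<bullet> elem_normal M K F) * \<phi> y)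
        = (LINT y:F|surf F. orient M K F * (normal_trace M F \<tau> y * \<phi> y))"
      by (intro set_integral_eq_on) (simp add: elem_normal_orient normal_trace_def)
    then show ?thesis
      by simp
  qed
  moreover have "(LINT x:K|lebesgue. \<tau> x \<bullet> grad \<phi> x) = (LINT x:K|lebesgue. restr K \<tau> x \<bullet> grad \<phi> x)"
    unfolding set_lebesgue_integral_def
  proof (rule integral_completion_cong_AE(1))
    show "AE x in lebesgue. indicator K x *\<^sub>R (\<tau> x \<bullet> grad \<phi> x) = indicator K x *\<^sub>R (restr K \<tau> x \<bullet> grad \<phi> x)"
      using t(2) by eventually_elim (auto split: split_indicator)
  qed
  ultimately show ?thesis
    using green_element [OF K \<phi> t(1)] by simp
qed

end

section \<open>Testing the discontinuous Galerkin equation on one element\<close>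

abbreviation cutoff :: "'a set \<Rightarrow> ('a \<Rightarrow> 'b::zero) \<Rightarrow> 'a \<Rightarrow> 'b" where
  "cutoff K p \<equiv> (\<lambda>x. if x \<in> K then p x else 0)"

context dg_mesh
begin

lemma restr_cutoff:
  fixes p :: "real^'n \<Rightarrow> 'b::euclidean_space"
  assumes K: "K \<in> mesh M" and L: "L \<in> mesh M" and p: "polynomial_function p"
  shows "restr L (cutoff K p) = (if L = K then p else (\<lambda>x. 0))"
proof (rule restr_eq)
  show "polynomial_function (if L = K then p else (\<lambda>x. 0))"
    using p by auto
  show "AE x in lebesgue. x \<in> L \<longrightarrow> cutoff K p x = (if L = K then p else (\<lambda>x. 0)) x"
    using AE_unique_element by eventually_elim (use K L in auto)
qed (rule mesh_element [OF L])

lemma cutoff_DG: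
  assumes K: "K \<in> mesh M" and \<phi>: "\<phi> \<in> poly_le k"
  shows "cutoff K \<phi> \<in> DG M k"
proof -
  have c: "continuous_on UNIV \<phi>"
    by (intro C1D poly_le_C1 [OF \<phi>])
  have m: "cutoff K \<phi> \<in> borel_measurable lebesgue"
    using continuous_borel_lebesgue [OF c] mesh_borel [OF K] by (intro measurable_If_set) auto
  have "AE x in lebesgue. x \<in> L \<longrightarrow> cutoff K \<phi> x = (if L = K then \<phi> x else 0)" if "L \<in> mesh M" for L
    using AE_unique_element by eventually_elim (use K that in auto)
  note loc = this
  have "square_integrable lebesgue (domain M) (cutoff K \<phi>)"
    unfolding square_integrable_def
  proof
    show "set_borel_measurable lebesgue (domain M) (cutoff K \<phi>)"
      by (rule set_borel_measurable_domain [OF m])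
    show "set_integrable lebesgue (domain M) (\<lambda>x. (norm (cutoff K \<phi> x))\<^sup>2)"
    proof (rule set_integral_domain(1))
      fix L assume L: "L \<in> mesh M"
      show "AE x in lebesgue. x \<in> L \<longrightarrow> (norm (cutoff K \<phi> x))\<^sup>2 = (norm (if L = K then \<phi> x else 0))\<^sup>2"
        using loc [OF L] by eventually_elim simp
      show "set_integrable lebesgue L (\<lambda>x. (norm (if L = K then \<phi> x else 0))\<^sup>2)"
        by (intro set_integrable_element [OF L]) (cases "L = K"; auto intro!: continuous_intros c)
    qed
  qed
  moreover have "\<exists>p\<in>poly_le k. AE x in lebesgue. x \<in> L \<longrightarrow> cutoff K \<phi> x = p x" if L: "L \<in> mesh M" for L
    using loc [OF L] \<phi> poly_le_zero [of k]
    by (intro bexI [of _ "if L = K then \<phi> else (\<lambda>x. 0)"]) (auto split: if_split_asm)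
  ultimately show ?thesis
    by (simp add: DG_def)
qed

lemma facet_elements_iff:
  assumes "K \<in> mesh M" "F \<in> facets M"
  shows "F \<in> elem_facets K \<longleftrightarrow> K = Kminus M F \<or> (F \<in> facets_I M \<and> K = Kplus M F)"
  using element_cases [OF assms(1)] Kminus_element(2) [OF assms(2)] Kplus_element(2) by blast

lemma jump_cutoff:
  assumes K: "K \<in> mesh M" and \<phi>: "\<phi> \<in> poly_le k" and F: "F \<in> facets M"
  shows "jump M F (cutoff K \<phi>) x = (if F \<in> elem_facets K then orient M K F * \<phi> x else 0)"
proof -
  have p: "polynomial_function \<phi>"
    by (rule poly_le_polynomial [OF \<phi>])
  show ?thesis
    using facet_elements_iff [OF K F] facet_elements_I(2) [of F] restr_cutoff [OF K Kminus_element(1) [OF F] p]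
      restr_cutoff [OF K Kplus_element(1) p]
    by (auto simp: jump_def orient_def)
qed

text \<open>
  The symmetrisation term of the bilinear form sees exactly the extension of \<open>\<nabla>\<phi>\<close> by zero that occurs
  in the definition of the correction flux.
\<close>

lemma avg_grad_flux_cutoff:
  assumes K: "K \<in> mesh M" and \<phi>: "\<phi> \<in> poly_le k" and F: "F \<in> facets M"
  shows "avg_grad_flux M F (cutoff K \<phi>) x = avg_flux M F (cutoff K (grad \<phi>)) x"
    and "F \<notin> elem_facets K \<Longrightarrow> avg_flux M F (cutoff K (grad \<phi>)) x = 0"
proof -
  have p: "polynomial_function \<phi>"
    by (rule poly_le_polynomial [OF \<phi>])
  have g: "polynomial_function (grad \<phi>)"
    by (rule vpoly_le_polynomial [OF poly_le_grad [OF \<phi>]])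
  have eq: "grad (restr L (cutoff K \<phi>)) = (if L = K then grad \<phi> else (\<lambda>x. 0))"
    "restr L (cutoff K (grad \<phi>)) = (if L = K then grad \<phi> else (\<lambda>x. 0))" if "L \<in> mesh M" for L
    using restr_cutoff [OF K that p] restr_cutoff [OF K that g] by (auto simp: C1_const)
  show "avg_grad_flux M F (cutoff K \<phi>) x = avg_flux M F (cutoff K (grad \<phi>)) x"
    using eq [OF Kminus_element(1) [OF F]] eq [OF Kplus_element(1), of F]
    by (simp add: avg_grad_flux_def avg_flux_def wavg_def)
  show "F \<notin> elem_facets K \<Longrightarrow> avg_flux M F (cutoff K (grad \<phi>)) x = 0"
    using eq(2) [OF Kminus_element(1) [OF F]] eq(2) [OF Kplus_element(1), of F] facet_elements_iff [OF K F]
    by (auto simp: avg_flux_def wavg_def matrix_vector_mult_0_right)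
qed

lemma a_dg_cutoff:
  assumes K: "K \<in> mesh M" and \<phi>: "\<phi> \<in> poly_le k"
  shows "a_dg M \<gamma> \<delta> u (cutoff K \<phi>)
     = (LINT x:K|lebesgue. (coef M K *v grad (restr K u) x) \<bullet> grad \<phi> x)
     + (\<Sum>F\<in>elem_facets K - facets_N M. orient M K F *
          (\<gamma> * (alpha_min M F / diameter F) * (LINT x:F|surf F. jump M F u x * \<phi> x)))
     - (\<Sum>F\<in>elem_facets K - facets_N M. orient M K F * (LINT x:F|surf F. avg_grad_flux M F u x * \<phi> x))
     + \<delta> * (\<Sum>F\<in>elem_facets K - facets_N M. LINT x:F|surf F. avg_flux M F (cutoff K (grad \<phi>)) x * jump M F u x)"
proof -
  let ?v = "cutoff K \<phi>"
  have p: "polynomial_function \<phi>"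
    by (rule poly_le_polynomial [OF \<phi>])
  have local_sum: "(\<Sum>F\<in>facets M - facets_N M. T F) = (\<Sum>F\<in>elem_facets K - facets_N M. T' F)"
    if "\<And>F. F \<in> facets M \<Longrightarrow> F \<notin> elem_facets K \<Longrightarrow> T F = 0" "\<And>F. F \<in> facets M \<Longrightarrow> F \<in> elem_facets K \<Longrightarrow> T F = T' F"
    for T T' :: "(real^'n) set \<Rightarrow> real"
  proof -
    have "(\<Sum>F\<in>facets M - facets_N M. T F) = (\<Sum>F\<in>elem_facets K - facets_N M. T F)"
      using finite_facets elem_facets_subset_facets [OF K] that(1) by (intro sum.mono_neutral_right) auto
    also have "\<dots> = (\<Sum>F\<in>elem_facets K - facets_N M. T' F)"
      using elem_facets_subset_facets [OF K] that(2) by (intro sum.cong) auto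
    finally show ?thesis .
  qed
  have "(\<Sum>L\<in>mesh M. LINT x:L|lebesgue. (coef M L *v grad (restr L u) x) \<bullet> grad (restr L ?v) x)
      = (\<Sum>L\<in>{K}. LINT x:L|lebesgue. (coef M L *v grad (restr L u) x) \<bullet> grad (restr L ?v) x)"
  proof (rule sum.mono_neutral_right)
    show "\<forall>L\<in>mesh M - {K}. (LINT x:L|lebesgue. (coef M L *v grad (restr L u) x) \<bullet> grad (restr L ?v) x) = 0"
      by (intro ballI set_integral_zero_on) (simp add: restr_cutoff [OF K _ p] C1_const)
  qed (use finite_mesh K in auto)
  also have "\<dots> = (LINT x:K|lebesgue. (coef M K *v grad (restr K u) x) \<bullet> grad \<phi> x)"
    by (simp add: restr_cutoff [OF K K p])
  finally have 1: "(\<Sum>L\<in>mesh M. LINT x:L|lebesgue. (coef M L *v grad (restr L u) x) \<bullet> grad (restr L ?v) x)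
      = (LINT x:K|lebesgue. (coef M K *v grad (restr K u) x) \<bullet> grad \<phi> x)" .
  have 2: "(\<Sum>F\<in>facets M - facets_N M. LINT x:F|surf F. \<gamma> * (alpha_min M F / diameter F) * jump M F u x * jump M F ?v x)
     = (\<Sum>F\<in>elem_facets K - facets_N M. orient M K F *
          (\<gamma> * (alpha_min M F / diameter F) * (LINT x:F|surf F. jump M F u x * \<phi> x)))"
  proof (rule local_sum)
    fix F assume F: "F \<in> facets M" "F \<in> elem_facets K"
    have "(LINT x:F|surf F. \<gamma> * (alpha_min M F / diameter F) * jump M F u x * jump M F ?v x)
        = (LINT x:F|surf F. (orient M K F * (\<gamma> * (alpha_min M F / diameter F))) * (jump M F u x * \<phi> x))"
      using F by (intro set_integral_eq_on) (simp add: jump_cutoff [OF K \<phi>])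
    then show "(LINT x:F|surf F. \<gamma> * (alpha_min M F / diameter F) * jump M F u x * jump M F ?v x)
        = orient M K F * (\<gamma> * (alpha_min M F / diameter F) * (LINT x:F|surf F. jump M F u x * \<phi> x))"
      by (simp only: set_integral_mult_right mult.assoc)
  qed (simp add: jump_cutoff [OF K \<phi>] set_integral_zero_on)
  have 3: "(\<Sum>F\<in>facets M - facets_N M. LINT x:F|surf F. avg_grad_flux M F u x * jump M F ?v x)
     = (\<Sum>F\<in>elem_facets K - facets_N M. orient M K F * (LINT x:F|surf F. avg_grad_flux M F u x * \<phi> x))"
  proof (rule local_sum)
    fix F assume F: "F \<in> facets M" "F \<in> elem_facets K"
    have "(LINT x:F|surf F. avg_grad_flux M F u x * jump M F ?v x)
        = (LINT x:F|surf F. orient M K F * (avg_grad_flux M F u x * \<phi> x))"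
      using F by (intro set_integral_eq_on) (simp add: jump_cutoff [OF K \<phi>])
    then show "(LINT x:F|surf F. avg_grad_flux M F u x * jump M F ?v x)
        = orient M K F * (LINT x:F|surf F. avg_grad_flux M F u x * \<phi> x)"
      by (simp only: set_integral_mult_right)
  qed (simp add: jump_cutoff [OF K \<phi>] set_integral_zero_on)
  have 4: "(\<Sum>F\<in>facets M - facets_N M. LINT x:F|surf F. avg_grad_flux M F ?v x * jump M F u x)
     = (\<Sum>F\<in>elem_facets K - facets_N M. LINT x:F|surf F. avg_flux M F (cutoff K (grad \<phi>)) x * jump M F u x)"
  proof (rule local_sum)
    fix F assume F: "F \<in> facets M"
    then show "F \<notin> elem_facets K \<Longrightarrow> (LINT x:F|surf F. avg_grad_flux M F ?v x * jump M F u x) = 0"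
      by (intro set_integral_zero_on) (simp add: avg_grad_flux_cutoff [OF K \<phi>])
    show "(LINT x:F|surf F. avg_grad_flux M F ?v x * jump M F u x)
        = (LINT x:F|surf F. avg_flux M F (cutoff K (grad \<phi>)) x * jump M F u x)"
      using F by (intro set_integral_eq_on) (simp add: avg_grad_flux_cutoff(1) [OF K \<phi>])
  qed
  show ?thesis
    unfolding a_dg_def 1 2 3 4 ..
qed

lemma AE_facet_rel_interior:
  assumes "F \<in> facets M"
  shows "AE x in surf F. x \<in> F \<longrightarrow> x \<in> rel_interior F"
proof -
  obtain c where "norm (nrml M F) = 1" "affine hull F = {x. nrml M F \<bullet> x = c}" "compact F" "convex F"
    using facet_hyperplane [OF assms] by metis
  then show ?thesis
    by (intro AE_surf_rel_interior compact_imp_closed)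
qed

text \<open>
  The surface measure does not charge the relative boundaries of facets.  Hence the Neumann boundary
  meets a Dirichlet facet in a null set and covers a Neumann facet up to a null set.
\<close>

lemma pairing_cutoff:
  assumes K: "K \<in> mesh M" and \<phi>: "\<phi> \<in> poly_le k"
  shows "pairing_GammaN M g (cutoff K \<phi>) = (\<Sum>F\<in>elem_facets K \<inter> facets_N M. LINT x:F|surf F. g x * \<phi> x)"
proof -
  have p: "polynomial_function \<phi>"
    by (rule poly_le_polynomial [OF \<phi>])
  let ?T = "\<lambda>F. LINT x:(F \<inter> GammaN M)|surf F. g x * restr (Kminus M F) (cutoff K \<phi>) x"
  have "(\<Sum>F\<in>bdry_facets M. ?T F) = (\<Sum>F\<in>elem_facets K \<inter> facets_N M. ?T F)"
  proof (rule sum.mono_neutral_right)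
    show "finite (bdry_facets M)"
      using finite_facets facets_subsets(2) finite_subset by blast
    show "elem_facets K \<inter> facets_N M \<subseteq> bdry_facets M"
      using facets_subsets by blast
    show "\<forall>F\<in>bdry_facets M - elem_facets K \<inter> facets_N M. ?T F = 0"
    proof
      fix F assume F: "F \<in> bdry_facets M - elem_facets K \<inter> facets_N M"
      then have Ff: "F \<in> facets M"
        using facets_subsets by blast
      show "?T F = 0"
      proof (cases "F \<in> elem_facets K")
        case False
        then have "Kminus M F \<noteq> K"
          using Kminus_element(2) [OF Ff] by blast
        then show ?thesis
          by (intro set_integral_zero_on) (simp add: restr_cutoff [OF K Kminus_element(1) [OF Ff] p])
      next
        case True
        then have "F \<in> facets_D M"
          using F valid by (auto simp: valid_setting_def)
        then have sub: "rel_interior F \<subseteq> GammaD M" "GammaD M \<inter> GammaN M = {}"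
          using valid by (auto simp: facets_D_def valid_setting_def)
        have "AE x in surf F. x \<notin> F \<inter> GammaN M"
          using AE_facet_rel_interior [OF Ff] by eventually_elim (use sub in blast)
        then have "AE x in surf F. indicator (F \<inter> GammaN M) x *\<^sub>R (g x * restr (Kminus M F) (cutoff K \<phi>) x)
            = (indicator {} x *\<^sub>R 0 :: real)"
          by eventually_elim simp
        then have "?T F = (LINT x:{}|surf F. 0)"
          by (rule set_integral_surf_cong_AE(1))
        then show ?thesis
          by (simp add: set_lebesgue_integral_def)
      qed
    qed
  qed
  also have "\<dots> = (\<Sum>F\<in>elem_facets K \<inter> facets_N M. LINT x:F|surf F. g x * \<phi> x)"
  proof (rule sum.cong [OF refl])
    fix F assume F: "F \<in> elem_facets K \<inter> facets_N M"
    then have Fb: "F \<in> bdry_facets M" and Ff: "F \<in> facets M"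
      using facets_subsets by blast+
    have "K = Kminus M F"
      using F K facet_elements_bdry [OF Fb] by blast
    then have r: "restr (Kminus M F) (cutoff K \<phi>) = \<phi>"
      using restr_cutoff [OF K K p] by simp
    have sub: "rel_interior F \<subseteq> GammaN M"
      using F by (auto simp: facets_N_def)
    have "AE x in surf F. x \<in> F \<longrightarrow> x \<in> GammaN M"
      using AE_facet_rel_interior [OF Ff] by eventually_elim (use sub in blast)
    then have "AE x in surf F. indicator (F \<inter> GammaN M) x *\<^sub>R (g x * \<phi> x) = indicator F x *\<^sub>R (g x * \<phi> x)"
      by eventually_elim (auto split: split_indicator)
    then show "?T F = (LINT x:F|surf F. g x * \<phi> x)"
      unfolding r by (rule set_integral_surf_cong_AE(1))
  qed
  finally show ?thesis
    by (simp add: pairing_GammaN_def)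
qed

text \<open>
  The discontinuous Galerkin equation, tested with the cutoff of \<open>\<phi>\<close> to \<open>K\<close>, is Green's formula for the
  sum of the two fluxes on \<open>K\<close>.
\<close>

theorem element_conservation:
  assumes K: "K \<in> mesh M" and \<phi>: "\<phi> \<in> poly_le s" and sk: "s \<le> k"
    and dg: "\<forall>v\<in>DG M k. a_dg M \<gamma> \<delta> u v = (LINT x:domain M|lebesgue. f x * v x) - pairing_GammaN M g v"
    and avg: "is_averaging_flux M g s u \<sigma>" and cor: "is_correction_flux M \<gamma> \<delta> s u \<tau>"
  shows "(LINT x:domain M|lebesgue. f x * cutoff K \<phi> x)
       = (LINT x:K|lebesgue. divg (restr K \<sigma>) x * \<phi> x) + (LINT x:K|lebesgue. divg (restr K \<tau>) x * \<phi> x)"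
proof -
  let ?v = "cutoff K \<phi>"
  have \<phi>k: "\<phi> \<in> poly_le k"
    using poly_le_mono [OF \<phi> sk] .
  have C1: "C1 \<phi>"
    by (rule poly_le_C1 [OF \<phi>])
  note fK = elem_facets_subset_facets [OF K]
  let ?A = "\<lambda>F. orient M K F * (LINT x:F|surf F. normal_trace M F \<sigma> x * \<phi> x)"
  let ?C = "\<lambda>F. orient M K F * (LINT x:F|surf F. normal_trace M F \<tau> x * \<phi> x)"
  have volume: "(LINT x:K|lebesgue. (coef M K *v grad (restr K u) x) \<bullet> grad \<phi> x) = - (LINT x:K|lebesgue. \<sigma> x \<bullet> grad \<phi> x)"
      (is "?V1 = ?V2")
    "\<delta> * (\<Sum>F\<in>elem_facets K - facets_N M. LINT x:F|surf F. avg_flux M F (cutoff K (grad \<phi>)) x * jump M F u x)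
       = - (LINT x:K|lebesgue. \<tau> x \<bullet> grad \<phi> x)" (is "?W1 = ?W2")
  proof -
    have "?V1 = ?V2 \<and> ?W1 = ?W2"
    proof (cases "1 \<le> s")
      case True
      then show ?thesis
        using avg cor K poly_le_grad [OF \<phi>] by (simp add: is_averaging_flux_def is_correction_flux_def)
    next
      \<comment> \<open>For \<open>s = 0\<close> the fluxes have no volume moments, but then \<open>\<phi>\<close> is constant.\<close>
      case False
      then have g0: "grad \<phi> = (\<lambda>x. 0)"
        using poly_le_grad_0 [of \<phi>] \<phi> by (simp add: not_le)
      have "avg_flux M F (cutoff K (\<lambda>x. 0)) x = 0" if F: "F \<in> facets M" for F x
      proof -
        have "restr L (cutoff K (\<lambda>x. 0)) = (\<lambda>x. 0 :: real^'n)" if "L \<in> mesh M" for L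
          using restr_cutoff [OF K that, of "\<lambda>x. 0 :: real^'n"] by simp
        then show ?thesis
          using Kminus_element(1) [OF F] Kplus_element(1) [of F] by (simp add: avg_flux_def wavg_def matrix_vector_mult_0_right)
      qed
      then have "(LINT x:F|surf F. avg_flux M F (cutoff K (\<lambda>x. 0)) x * jump M F u x) = 0" if "F \<in> elem_facets K" for F
        using that fK by (intro set_integral_zero_on) auto
      then show ?thesis
        unfolding g0 by simp
    qed
    then show "?V1 = ?V2" "?W1 = ?W2"
      by auto
  qed
  have faces: "(\<Sum>F\<in>elem_facets K - facets_N M. orient M K F *
          (\<gamma> * (alpha_min M F / diameter F) * (LINT x:F|surf F. jump M F u x * \<phi> x))) = (\<Sum>F\<in>elem_facets K - facets_N M. ?C F)"
    "(\<Sum>F\<in>elem_facets K - facets_N M. orient M K F * (LINT x:F|surf F. avg_grad_flux M F u x * \<phi> x))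
       = - (\<Sum>F\<in>elem_facets K - facets_N M. ?A F)"
    unfolding sum_negf [symmetric]
  proof (rule sum.cong [OF refl])
    fix F assume "F \<in> elem_facets K - facets_N M"
    then have F: "F \<in> facets M - facets_N M"
      using fK by blast
    then show "orient M K F * (\<gamma> * (alpha_min M F / diameter F) * (LINT x:F|surf F. jump M F u x * \<phi> x)) = ?C F"
      using cor \<phi> by (simp add: is_correction_flux_def)
  next
    show "(\<Sum>F\<in>elem_facets K - facets_N M. orient M K F * (LINT x:F|surf F. avg_grad_flux M F u x * \<phi> x))
       = (\<Sum>F\<in>elem_facets K - facets_N M. - ?A F)"
    proof (rule sum.cong [OF refl])
      fix F assume "F \<in> elem_facets K - facets_N M"
      then have F: "F \<in> facets M - facets_N M"
        using fK by blast
      then show "orient M K F * (LINT x:F|surf F. avg_grad_flux M F u x * \<phi> x) = - ?A F"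
        using avg \<phi> by (simp add: is_averaging_flux_def)
    qed
  qed
  have neumann: "(\<Sum>F\<in>elem_facets K \<inter> facets_N M. LINT x:F|surf F. g x * \<phi> x)
      = (\<Sum>F\<in>elem_facets K \<inter> facets_N M. ?A F)" "(\<Sum>F\<in>elem_facets K \<inter> facets_N M. ?C F) = 0"
  proof -
    show "(\<Sum>F\<in>elem_facets K \<inter> facets_N M. LINT x:F|surf F. g x * \<phi> x) = (\<Sum>F\<in>elem_facets K \<inter> facets_N M. ?A F)"
    proof (rule sum.cong [OF refl])
      fix F assume F: "F \<in> elem_facets K \<inter> facets_N M"
      then have "K = Kminus M F"
        using K facet_elements_bdry [of F] facets_subsets(3) by blast
      then show "(LINT x:F|surf F. g x * \<phi> x) = ?A F"
        using F avg \<phi> by (simp add: is_averaging_flux_def orient_def)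
    qed
    show "(\<Sum>F\<in>elem_facets K \<inter> facets_N M. ?C F) = 0"
      using cor \<phi> by (intro sum.neutral) (simp add: is_correction_flux_def)
  qed
  have split: "(\<Sum>F\<in>elem_facets K. T F) = (\<Sum>F\<in>elem_facets K - facets_N M. T F) + (\<Sum>F\<in>elem_facets K \<inter> facets_N M. T F)"
    for T :: "(real^'n) set \<Rightarrow> real"
    using sum.Int_Diff [OF finite_elem_facets [OF K], of T "facets_N M"] by simp
  have "(LINT x:domain M|lebesgue. f x * ?v x) = a_dg M \<gamma> \<delta> u ?v + pairing_GammaN M g ?v"
    using dg cutoff_DG [OF K \<phi>k] by simp
  also have "\<dots> = - (LINT x:K|lebesgue. \<sigma> x \<bullet> grad \<phi> x) - (LINT x:K|lebesgue. \<tau> x \<bullet> grad \<phi> x)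
      + (\<Sum>F\<in>elem_facets K. ?A F) + (\<Sum>F\<in>elem_facets K. ?C F)"
    unfolding a_dg_cutoff [OF K \<phi>k] pairing_cutoff [OF K \<phi>k] volume faces neumann split by simp
  finally show ?thesis
    using RT_element_identity [OF _ K C1, of \<sigma> s] RT_element_identity [OF _ K C1, of \<tau> s] avg cor
    by (simp add: is_averaging_flux_def is_correction_flux_def)
qed

text \<open>
  Up to null sets, each discontinuous piecewise polynomial is the sum of the cutoffs of its local
  polynomials.
\<close>

lemma L2_projection_from_cutoffs:
  assumes f: "square_integrable lebesgue (domain M) f" and w: "w \<in> DG M s"
    and test: "\<And>K \<phi>. K \<in> mesh M \<Longrightarrow> \<phi> \<in> poly_le s \<Longrightarrow>
      (LINT x:domain M|lebesgue. f x * cutoff K \<phi> x) = (LINT x:domain M|lebesgue. w x * cutoff K \<phi> x)"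
  shows "is_L2_proj_DG M s f w"
  unfolding is_L2_proj_DG_def
proof (intro conjI ballI)
  show "w \<in> DG M s" by fact
  fix v assume v: "v \<in> DG M s"
  then have "\<forall>K\<in>mesh M. \<exists>p\<in>poly_le s. AE x in lebesgue. x \<in> K \<longrightarrow> v x = p x"
    by (simp add: DG_def)
  then obtain p where p: "\<And>K. K \<in> mesh M \<Longrightarrow> p K \<in> poly_le s"
      "\<And>K. K \<in> mesh M \<Longrightarrow> AE x in lebesgue. x \<in> K \<longrightarrow> v x = p K x"
    by metis
  have "square_integrable lebesgue (domain M) w"
    using w by (simp add: DG_def)
  then have int_fw: "set_integrable lebesgue (domain M) f" "set_integrable lebesgue (domain M) w"
    using f set_integrable_of_square_integrable domain_finite_measure by blast+
  have int: "integrable lebesgue (\<lambda>x. indicator (domain M) x *\<^sub>R (h x * cutoff K (p K) x))"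
    if h: "set_integrable lebesgue (domain M) h" and K: "K \<in> mesh M" for h K
  proof -
    have c: "continuous_on UNIV (p K)"
      by (intro C1D poly_le_C1 [OF p(1) [OF K]])
    have "compact (p K ` K)"
      using c mesh_element(3) [OF K] by (meson compact_continuous_image continuous_on_subset subset_UNIV)
    then obtain B where B: "\<And>x. x \<in> K \<Longrightarrow> \<bar>p K x\<bar> \<le> B"
      by (metis bounded_iff compact_imp_bounded imageI real_norm_def)
    have m: "cutoff K (p K) \<in> borel_measurable lebesgue"
      using continuous_borel_lebesgue [OF c] mesh_borel [OF K] by (intro measurable_If_set) auto
    have i: "integrable lebesgue (\<lambda>x. \<bar>B\<bar> * (indicator (domain M) x *\<^sub>R h x))"
      using h by (simp add: set_integrable_def)
    have "integrable lebesgue (\<lambda>x. (indicator (domain M) x *\<^sub>R h x) * cutoff K (p K) x)"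
    proof (rule Bochner_Integration.integrable_bound [OF i])
      show "(\<lambda>x. (indicator (domain M) x *\<^sub>R h x) * cutoff K (p K) x) \<in> borel_measurable lebesgue"
        using h m unfolding set_integrable_def by (intro borel_measurable_times) auto
      have "\<bar>h x\<bar> * \<bar>p K x\<bar> \<le> \<bar>B\<bar> * \<bar>h x\<bar>" if "x \<in> K" for x
        using mult_left_mono [of "\<bar>p K x\<bar>" "\<bar>B\<bar>" "\<bar>h x\<bar>"] B [OF that] by (simp add: mult.commute)
      then show "AE x in lebesgue. norm ((indicator (domain M) x *\<^sub>R h x) * cutoff K (p K) x)
          \<le> norm (\<bar>B\<bar> * (indicator (domain M) x *\<^sub>R h x))"
        by (intro AE_I2) (auto simp: abs_mult split: split_indicator)
    qed
    then show ?thesis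
      by (simp add: mult.assoc)
  qed
  have "(LINT x:domain M|lebesgue. (f x - w x) * v x)
      = (\<integral>x. (\<Sum>K\<in>mesh M. indicator (domain M) x *\<^sub>R (f x * cutoff K (p K) x) - indicator (domain M) x *\<^sub>R (w x * cutoff K (p K) x)) \<partial>lebesgue)"
    unfolding set_lebesgue_integral_def
  proof (rule integral_completion_cong_AE(1))
    have "AE x in lebesgue. \<forall>K\<in>mesh M. x \<in> K \<longrightarrow> v x = p K x"
      using finite_mesh p(2) by (intro AE_finite_allI) auto
    with AE_unique_element
    show "AE x in lebesgue. indicator (domain M) x *\<^sub>R ((f x - w x) * v x)
       = (\<Sum>K\<in>mesh M. indicator (domain M) x *\<^sub>R (f x * cutoff K (p K) x) - indicator (domain M) x *\<^sub>R (w x * cutoff K (p K) x))"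
    proof eventually_elim
      case (elim x)
      show ?case
      proof (cases "x \<in> domain M")
        case True
        then obtain K where K: "K \<in> mesh M" "x \<in> K"
          using domain_facts(3) closure_subset by blast
        have "(\<Sum>L\<in>mesh M. indicator (domain M) x *\<^sub>R (f x * cutoff L (p L) x) - indicator (domain M) x *\<^sub>R (w x * cutoff L (p L) x))
            = (\<Sum>L\<in>{K}. indicator (domain M) x *\<^sub>R (f x * cutoff L (p L) x) - indicator (domain M) x *\<^sub>R (w x * cutoff L (p L) x))"
          using finite_mesh K elim(1) by (intro sum.mono_neutral_right) auto
        then show ?thesis
          using True K elim(2) by (simp add: left_diff_distrib)
      qed simp
    qed
  qed
  also have "\<dots> = (\<Sum>K\<in>mesh M. (LINT x:domain M|lebesgue. f x * cutoff K (p K) x) - (LINT x:domain M|lebesgue. w x * cutoff K (p K) x))"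
    unfolding set_lebesgue_integral_def
    using int [OF int_fw(1)] int [OF int_fw(2)]
    by (subst Bochner_Integration.integral_sum) (auto simp: Bochner_Integration.integral_diff)
  also have "\<dots> = 0"
    using test p(1) by (intro sum.neutral) simp
  finally show "(LINT x:domain M|lebesgue. (f x - w x) * v x) = 0" .
qed

lemma integral_broken_div_cutoff:
  assumes poly: "\<And>K. K \<in> mesh M \<Longrightarrow> restr K \<tau> \<in> RT_poly s" and K: "K \<in> mesh M" and \<phi>: "\<phi> \<in> poly_le k"
  shows "(LINT x:domain M|lebesgue. broken_div M \<tau> x * cutoff K \<phi> x) = (LINT x:K|lebesgue. divg (restr K \<tau>) x * \<phi> x)"
proof -
  have c: "continuous_on UNIV \<phi>"
    by (intro C1D poly_le_C1 [OF \<phi>])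
  let ?h = "\<lambda>L x. if L = K then divg (restr K \<tau>) x * \<phi> x else 0"
  have "(LINT x:domain M|lebesgue. broken_div M \<tau> x * cutoff K \<phi> x) = (\<Sum>L\<in>mesh M. LINT x:L|lebesgue. ?h L x)"
  proof (rule set_integral_domain(2))
    fix L assume L: "L \<in> mesh M"
    show "AE x in lebesgue. x \<in> L \<longrightarrow> broken_div M \<tau> x * cutoff K \<phi> x = ?h L x"
      using AE_unique_element AE_broken_div [OF K, of \<tau>] by eventually_elim (use K L in auto)
    show "set_integrable lebesgue L (?h L)"
      by (intro set_integrable_element [OF L])
         (cases "L = K"; auto intro!: continuous_intros c RT_poly_continuous(2) [OF poly [OF K]])
  qed
  also have "\<dots> = (\<Sum>L\<in>{K}. LINT x:L|lebesgue. ?h L x)"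
    using finite_mesh K by (intro sum.mono_neutral_right) (auto simp: set_integral_zero_on)
  finally show ?thesis
    by simp
qed

text \<open>
  The normal trace is itself a polynomial of degree at most \<open>s\<close> on the facet, so it is determined by its
  moments.  The polynomial representative of \<open>g\<close> gives the integrability that separates the moments of
  the difference.
\<close>

lemma normal_trace_neumann:
  assumes F: "F \<in> facets_N M" and \<rho>: "\<rho> \<in> RT M s"
    and g: "AE x in surf F. x \<in> F \<longrightarrow> g x = p x" "p \<in> poly_le m"
    and moments: "\<And>\<phi>. \<phi> \<in> poly_le s \<Longrightarrow>
        (LINT x:F|surf F. normal_trace M F \<rho> x * \<phi> x) = (LINT x:F|surf F. g x * \<phi> x)"
  shows "\<exists>gs. is_L2_proj_facet F s g gs \<and> (\<forall>x\<in>F. normal_trace M F \<rho> x = gs x)"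
proof -
  have Ff: "F \<in> facets M"
    using F facets_subsets by blast
  obtain c where hull: "affine hull F = {x. nrml M F \<bullet> x = c}"
    using facet_hyperplane [OF Ff] by metis
  obtain gs where gs: "gs \<in> poly_le s" "\<And>x. nrml M F \<bullet> x = c \<Longrightarrow> restr (Kminus M F) \<rho> x \<bullet> nrml M F = gs x"
    using RT_poly_normal [OF RT_local(1) [OF \<rho> Kminus_element(1) [OF Ff]]] by blast
  have eq: "normal_trace M F \<rho> x = gs x" if "x \<in> F" for x
    using gs(2) hull_inc [OF that, of affine] unfolding hull normal_trace_def by simp
  have "(LINT x:F|surf F. (g x - gs x) * \<phi> x) = 0" if \<phi>: "\<phi> \<in> poly_le s" for \<phi>
  proof -
    have c: "continuous_on UNIV \<phi>" "continuous_on UNIV p" "continuous_on UNIV gs"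
      using \<phi> g(2) gs(1) poly_le_C1 C1D(3) by blast+
    have i: "set_integrable (surf F) F (\<lambda>x. p x * \<phi> x)"
      by (intro set_integrable_facet Ff continuous_intros c)
    have "AE x in surf F. indicator F x *\<^sub>R (p x * \<phi> x) = indicator F x *\<^sub>R (g x * \<phi> x)"
      using g(1) by eventually_elim (auto split: split_indicator)
    then have "set_integrable (surf F) F (\<lambda>x. g x * \<phi> x)"
      by (rule set_integral_surf_cong_AE(2)) (rule i)
    moreover have "set_integrable (surf F) F (\<lambda>x. gs x * \<phi> x)"
      by (intro set_integrable_facet Ff continuous_intros c)
    ultimately have "(LINT x:F|surf F. (g x - gs x) * \<phi> x) = (LINT x:F|surf F. g x * \<phi> x) - (LINT x:F|surf F. gs x * \<phi> x)"
      by (simp add: left_diff_distrib set_integral_diff)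
    also have "(LINT x:F|surf F. gs x * \<phi> x) = (LINT x:F|surf F. normal_trace M F \<rho> x * \<phi> x)"
      by (rule set_integral_eq_on) (simp add: eq)
    finally show ?thesis
      using moments [OF \<phi>] by simp
  qed
  then show ?thesis
    using gs(1) eq by (auto simp: is_L2_proj_facet_def)
qed

lemma normal_trace_add_moment:
  assumes \<sigma>: "\<sigma> \<in> RT M s" and \<tau>: "\<tau> \<in> RT M s" and F: "F \<in> facets M" and \<phi>: "\<phi> \<in> poly_le s"
  shows "(LINT x:F|surf F. normal_trace M F (\<lambda>x. \<sigma> x + \<tau> x) x * \<phi> x)
      = (LINT x:F|surf F. normal_trace M F \<sigma> x * \<phi> x) + (LINT x:F|surf F. normal_trace M F \<tau> x * \<phi> x)"
proof -
  note K = Kminus_element(1) [OF F]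
  have c: "continuous_on UNIV (\<lambda>x. normal_trace M F \<rho> x * \<phi> x)" if "\<rho> \<in> RT M s" for \<rho>
    unfolding normal_trace_def
    by (intro continuous_intros RT_poly_continuous(1) [OF RT_local(1) [OF that K]] C1D poly_le_C1 [OF \<phi>])
  show ?thesis
    using set_integrable_facet [OF F c [OF \<sigma>]] set_integrable_facet [OF F c [OF \<tau>]]
    by (subst set_integral_add(2) [symmetric]) (auto simp: normal_trace_def RT_add(2) [OF \<sigma> \<tau> K] inner_add_left distrib_right)
qed

end

theorem lemma3p1:
  fixes M :: "('n::finite) dg_setting"
    and k s :: nat and \<gamma> \<delta> :: real
    and f g u :: "real^'n \<Rightarrow> real"
    and \<sigma>avg \<sigma>cor :: "real^'n \<Rightarrow> real^'n"
  assumes "valid_setting M"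
    and "1 \<le> k" and "s \<le> k" and "0 < \<gamma>" and "\<delta> \<in> {1, 0, -1}"
    and "square_integrable lebesgue (domain M) f"
    and "g \<in> L2_GammaN M"
    and "\<forall>F\<in>facets_N M. \<exists>p\<in>poly_le (k - 1). AE x in surf F. x \<in> F \<longrightarrow> g x = p x"
    and "u \<in> DG M k"
    and "\<forall>v\<in>DG M k. a_dg M \<gamma> \<delta> u v
           = (LINT x:domain M|lebesgue. f x * v x) - pairing_GammaN M g v"
    and "is_averaging_flux M g s u \<sigma>avg"
    and "is_correction_flux M \<gamma> \<delta> s u \<sigma>cor"
  shows "(\<lambda>x. \<sigma>avg x + \<sigma>cor x) \<in> RT M s
       \<and> (\<lambda>x. \<sigma>avg x + \<sigma>cor x) \<in> RT_data M f g s"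
proof -
  interpret dg_mesh M
    by unfold_locales (rule assms(1))
  define \<rho> where "\<rho> = (\<lambda>x. \<sigma>avg x + \<sigma>cor x)"
  have RT: "\<sigma>avg \<in> RT M s" "\<sigma>cor \<in> RT M s"
    using assms(11,12) by (auto simp: is_averaging_flux_def is_correction_flux_def)
  have \<rho>: "\<rho> \<in> RT M s" and weak: "has_weak_div (domain M) \<rho> (broken_div M \<rho>)"
    using RT_add [OF RT] by (simp_all add: \<rho>_def)
  have poly: "restr K \<rho> \<in> RT_poly s" if "K \<in> mesh M" for K
    using RT_local(1) [OF \<rho> that] .
  have "is_L2_proj_DG M s f (broken_div M \<rho>)"
  proof (rule L2_projection_from_cutoffs [OF assms(6) broken_div_DG [OF poly]])
    fix K and \<phi> :: "real^'n \<Rightarrow> real" assume K: "K \<in> mesh M" and \<phi>: "\<phi> \<in> poly_le s"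
    have t: "restr K \<sigma>avg \<in> RT_poly s" "restr K \<sigma>cor \<in> RT_poly s"
      using RT_local(1) RT K by auto
    have "divg (restr K \<rho>) x = divg (restr K \<sigma>avg) x + divg (restr K \<sigma>cor) x" for x
      using C1_add(2) [OF RT_poly_C1 [OF t(1)] RT_poly_C1 [OF t(2)]]
      by (simp add: \<rho>_def RT_add(2) [OF RT K] divg_def sum.distrib)
    then have "(LINT x:K|lebesgue. divg (restr K \<rho>) x * \<phi> x)
        = (LINT x:K|lebesgue. divg (restr K \<sigma>avg) x * \<phi> x) + (LINT x:K|lebesgue. divg (restr K \<sigma>cor) x * \<phi> x)"
      by (simp add: distrib_right)
         (intro set_integral_add set_integrable_element K continuous_intros RT_poly_continuous(2) [OF t(1)]
           RT_poly_continuous(2) [OF t(2)] C1D poly_le_C1 [OF \<phi>])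
    then show "(LINT x:domain M|lebesgue. f x * cutoff K \<phi> x) = (LINT x:domain M|lebesgue. broken_div M \<rho> x * cutoff K \<phi> x)"
      using element_conservation [OF K \<phi> assms(3,10,11,12)] integral_broken_div_cutoff [OF poly K \<phi>] by simp
  qed
  moreover have "\<exists>gs. is_L2_proj_facet F s g gs \<and> (\<forall>x\<in>F. normal_trace M F \<rho> x = gs x)" if F: "F \<in> facets_N M" for F
  proof -
    obtain p where p: "p \<in> poly_le (k - 1)" "AE x in surf F. x \<in> F \<longrightarrow> g x = p x"
      using assms(8) F by blast
    have "F \<in> facets M"
      using F facets_subsets by blast
    then have "(LINT x:F|surf F. normal_trace M F \<rho> x * \<phi> x) = (LINT x:F|surf F. g x * \<phi> x)" if "\<phi> \<in> poly_le s" for \<phi>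
      using normal_trace_add_moment [OF RT _ that] that F assms(11,12)
      by (simp add: \<rho>_def is_averaging_flux_def is_correction_flux_def)
    then show ?thesis
      by (rule normal_trace_neumann [OF F \<rho> p(2,1)])
  qed
  ultimately show ?thesis
    using \<rho> weak unfolding RT_data_def \<rho>_def by blast
qed

end
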